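(* Fix an inverse temperature $\beta>0$. Let $\rho=\tfrac12(\mathbb 1+\mathbf r\cdot\boldsymbol\sigma)$ be a single-qubit state with Hamiltonian $H=\mathbf h\cdot\boldsymbol\sigma$, $\|\mathbf h\|_2=1$, and let $E_{\mathbf r}:=\mathrm{tr}(\rho H)=\mathbf h\cdot\mathbf r$. Assume $\mathrm{STAB}_1(E_{\mathbf r})\neq\emptyset$. Then the heat-based nonstabilizer witness detects $\rho$ if and only if $$\|\mathbf r\|_2>R_\star(E_{\mathbf r}),\qquad R_\star(E):=\max\{\|\mathbf s\|_2:\ \|\mathbf s\|_1\le 1,\ \mathbf h\cdot\mathbf s=E\}.$$
   Context: $\boldsymbol\sigma=(X,Y,Z)$ are the Pauli matrices; qubit states are $\rho(\mathbf r)=\tfrac12(\mathbb 1+\mathbf r\cdot\boldsymbol\sigma)$ with $\|\mathbf r\|_2\le1$. The single-qubit stabilizer polytope is $\mathrm{STAB}_1=\{\rho(\mathbf r):\|\mathbf r\|_1\le 1\}$ (convex hull of the eigenstates of $X,Y,Z$), and $\mathrm{STAB}_1(E_0)=\{\sigma\in\mathrm{STAB}_1:\mathrm{tr}(H\sigma)=E_0\}$. Heat exchange (memory-assisted thermal operations): the system $\mathsf S$ with Hamiltonian $H$ is coupled to an environment $\mathsf E$ (Hamiltonian $H_{\mathsf E}$, state $\gamma_{\mathsf E}=e^{-\beta H_{\mathsf E}}/\mathrm{tr}\,e^{-\beta H_{\mathsf E}}$) and a memory $\mathsf M$ (Hamiltonian $H_{\mathsf M}$, arbitrary state $\rho_{\mathsf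 M}$), via a unitary $U$ with $[U,H+H_{\mathsf M}+H_{\mathsf E}]=0$, under the constraint that the final marginal of $\mathsf M$ equals $\rho_{\mathsf M}$. The heat is $Q=\mathrm{tr}[H_{\mathsf E}(\eta_{\mathsf E}-\gamma_{\mathsf E})]$, with $\eta_{\mathsf E}$ the final environment state. For a state $\rho_{\mathsf S}$, $Q_c(\rho_{\mathsf S})$ and $Q_h(\rho_{\mathsf S})$ are the minimum and maximum of $Q$ over all $H_{\mathsf E},H_{\mathsf M},U,\rho_{\mathsf M}$ satisfying these constraints. The stabilizer heat bounds at energy $E_0$ are $Q_c^{\mathrm{STAB}}(E_0)=\min_{\sigma\in\mathrm{STAB}_1(E_0)}Q_c(\sigma)$ and $Q_h^{\mathrm{STAB}}(E_0)=\max_{\sigma\in\mathrm{STAB}_1(E_0)}Q_h(\sigma)$. The heat-based witness detects $\rho$ (with energy $E_{\mathbf r}$) if its achievable optimal heat lies outside the stabilizer window, i.e. $Q_c(\rho)<Q_c^{\mathrm{STAB}}(E_{\mathbf r})$ or $Q_h(\rho)>Q_h^{\mathrm{STAB}}(E_{\mathbf r})$. *)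

theory Defs
  imports Complex_Main "Jordan_Normal_Form.Schur_Decomposition"
begin

definition mtrace :: "complex mat \<Rightarrow> complex" where
  "mtrace A = (\<Sum>i<dim_row A. A $$ (i, i))"

definition hermitian :: "nat \<Rightarrow> complex mat \<Rightarrow> bool" where
  "hermitian n A \<longleftrightarrow> A \<in> carrier_mat n n \<and> mat_adjoint A = A"

definition unitary :: "nat \<Rightarrow> complex mat \<Rightarrow> bool" where
  "unitary n U \<longleftrightarrow> U \<in> carrier_mat n n \<and> U * mat_adjoint U = 1\<^sub>m n \<and> mat_adjoint U * U = 1\<^sub>m n"

definition density :: "nat \<Rightarrow> complex mat \<Rightarrow> bool" where
  "density n A \<longleftrightarrow> hermitian n A \<and>
     (\<forall>v :: nat \<Rightarrow> complex. 0 \<le> Re (\<Sum>i<n. \<Sum>j<n. cnj (v i) * A $$ (i, j) * v j)) \<and>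
     mtrace A = 1"

text \<open>Kronecker (tensor) product; index of a tensor b is (index a) * dim_b + (index b).\<close>
definition kron :: "complex mat \<Rightarrow> complex mat \<Rightarrow> complex mat" where
  "kron A B = mat (dim_row A * dim_row B) (dim_col A * dim_col B)
     (\<lambda>(i, j). A $$ (i div dim_row B, j div dim_col B) * B $$ (i mod dim_row B, j mod dim_col B))"

definition ptrace_second :: "nat \<Rightarrow> nat \<Rightarrow> complex mat \<Rightarrow> complex mat" where
  "ptrace_second a b X = mat a a (\<lambda>(i, j). \<Sum>k<b. X $$ (i * b + k, j * b + k))"

definition ptrace_first :: "nat \<Rightarrow> nat \<Rightarrow> complex mat \<Rightarrow> complex mat" where
  "ptrace_first a b X = mat b b (\<lambda>(i, j). \<Sum>k<a. X $$ (k * b + i, k * b + j))"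

definition mexp :: "complex mat \<Rightarrow> complex mat" where
  "mexp A = mat (dim_row A) (dim_row A)
     (\<lambda>(i, j). \<Sum>k. (A ^\<^sub>m k) $$ (i, j) / of_nat (fact k))"

definition gibbs :: "real \<Rightarrow> complex mat \<Rightarrow> complex mat" where
  "gibbs \<beta> H = (1 / mtrace (mexp ((- complex_of_real \<beta>) \<cdot>\<^sub>m H))) \<cdot>\<^sub>m mexp ((- complex_of_real \<beta>) \<cdot>\<^sub>m H)"

type_synonym bloch = "real \<times> real \<times> real"

definition pauliX :: "complex mat" where "pauliX = mat_of_rows_list 2 [[0, 1], [1, 0]]"
definition pauliY :: "complex mat" where "pauliY = mat_of_rows_list 2 [[0, - \<i>], [\<i>, 0]]"
definition pauliZ :: "complex mat" where "pauliZ = mat_of_rows_list 2 [[1, 0], [0, -1]]"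

definition sigma_dot :: "bloch \<Rightarrow> complex mat" where
  "sigma_dot r = (case r of (x, y, z) \<Rightarrow>
     complex_of_real x \<cdot>\<^sub>m pauliX + complex_of_real y \<cdot>\<^sub>m pauliY + complex_of_real z \<cdot>\<^sub>m pauliZ)"

definition qstate :: "bloch \<Rightarrow> complex mat" where
  "qstate r = (1 / 2 :: complex) \<cdot>\<^sub>m (1\<^sub>m 2 + sigma_dot r)"

definition dot3 :: "bloch \<Rightarrow> bloch \<Rightarrow> real" where
  "dot3 a b = (case a of (a1, a2, a3) \<Rightarrow> case b of (b1, b2, b3) \<Rightarrow> a1 * b1 + a2 * b2 + a3 * b3)"

definition norm2 :: "bloch \<Rightarrow> real" where
  "norm2 a = sqrt (dot3 a a)"

definition norm1 :: "bloch \<Rightarrow> real" where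
  "norm1 a = (case a of (a1, a2, a3) \<Rightarrow> \<bar>a1\<bar> + \<bar>a2\<bar> + \<bar>a3\<bar>)"

text \<open>Ordering of the global space: (S \<otimes> M) \<otimes> E, dim S = 2, dim M = dM, dim E = dE.
  Hs is the system Hamiltonian, rho the initial system state.  The achievable heats:\<close>
definition heats :: "real \<Rightarrow> complex mat \<Rightarrow> complex mat \<Rightarrow> real set" where
  "heats \<beta> Hs \<rho> = {Q. \<exists>dM dE HM HE \<rho>M U.
      0 < dM \<and> 0 < dE \<and> hermitian dM HM \<and> hermitian dE HE \<and> density dM \<rho>M \<and>
      unitary (2 * dM * dE) U \<and>
      (let Htot = kron (kron Hs (1\<^sub>m dM)) (1\<^sub>m dE) + kron (kron (1\<^sub>m 2) HM) (1\<^sub>m dE)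
                  + kron (kron (1\<^sub>m 2) (1\<^sub>m dM)) HE;
           \<gamma>E = gibbs \<beta> HE;
           \<eta> = U * kron (kron \<rho> \<rho>M) \<gamma>E * mat_adjoint U;
           \<eta>E = ptrace_first (2 * dM) dE \<eta>;
           \<eta>M = ptrace_first 2 dM (ptrace_second (2 * dM) dE \<eta>)
       in U * Htot = Htot * U \<and> \<eta>M = \<rho>M \<and>
          Q = Re (mtrace (HE * (\<eta>E - \<gamma>E))))}"

definition Qc :: "real \<Rightarrow> complex mat \<Rightarrow> complex mat \<Rightarrow> real" where
  "Qc \<beta> Hs \<rho> = Inf (heats \<beta> Hs \<rho>)"

definition Qh :: "real \<Rightarrow> complex mat \<Rightarrow> complex mat \<Rightarrow> real" where
  "Qh \<beta> Hs \<rho> = Sup (heats \<beta> Hs \<rho>)"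

text \<open>Stabilizer polytope at energy E (as Bloch vectors), for H = h \<cdot> sigma.\<close>
definition stab1 :: "bloch \<Rightarrow> real \<Rightarrow> bloch set" where
  "stab1 h E = {s. norm1 s \<le> 1 \<and> dot3 h s = E}"

definition QcSTAB :: "real \<Rightarrow> bloch \<Rightarrow> real \<Rightarrow> real" where
  "QcSTAB \<beta> h E = Inf ((\<lambda>s. Qc \<beta> (sigma_dot h) (qstate s)) ` stab1 h E)"

definition QhSTAB :: "real \<Rightarrow> bloch \<Rightarrow> real \<Rightarrow> real" where
  "QhSTAB \<beta> h E = Sup ((\<lambda>s. Qh \<beta> (sigma_dot h) (qstate s)) ` stab1 h E)"

definition witness_detects :: "real \<Rightarrow> bloch \<Rightarrow> bloch \<Rightarrow> bool" where
  "witness_detects \<beta> h r \<longleftrightarrow>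
     Qc \<beta> (sigma_dot h) (qstate r) < QcSTAB \<beta> h (dot3 h r) \<or>
     Qh \<beta> (sigma_dot h) (qstate r) > QhSTAB \<beta> h (dot3 h r)"

definition Rstar :: "bloch \<Rightarrow> real \<Rightarrow> real" where
  "Rstar h E = Sup (norm2 ` stab1 h E)"

end

(* At fixed energy E the unitary freedom commuting with H leaves only |r|, hence only the entropy
   S(r), as a parameter of the set of achievable heats Q = E - e, e the final energy of the system.

   Second law: Klein's inequality for the final global state against diag(final system) (x) rho_M (x)
   gamma_E gives S(r) - beta E <= psi(e), psi(e) = h((1 + e) / 2) - beta e with h the binary entropy;
   preservation of the memory marginal cancels the memory terms.

   Achievability: every e in (-1, 1) with S(r) - beta E < psi(e) is approximated.  On n copies, the
   components of typical eigenvectors in the energy shells span subspaces of dimension about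
   exp(n S(r)); a bath whose degeneracies grow like the inverse Boltzmann factor has room to rotate them
   into strings of energy density e.  Storing partially processed strings in the memory, with a clock
   telling which qubit is the system, turns this into a one-copy protocol whose heat is the n-copy heat
   divided by n and whose memory marginal is exactly preserved.

   A longer vector of the same energy has smaller entropy, so the closed range of e strictly grows at
   its upper end (psi is continuous and the end is not 1), which strictly lowers Q_c, while Q_h is
   monotone.  The stabilizer extrema are therefore attained at the longest admissible vector. *)

theory Submission
  imports Defs "Jordan_Normal_Form.Spectral_Radius" "HOL-Analysis.Elementary_Topology"
begin

subsection \<open>Unitary kernels on finite sets\<close>

text \<open>The constructions live on kernels indexed by finite sets; only a finished protocol is
  encoded in matrices, which confines the tensor index arithmetic to one lemma. Energy is counted in
  quanta of size 2: a string is the set of its excited positions, bath levels are spaced by 2, and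
  conservation becomes equality of the integers \<open>card x + level\<close>.

  Finite memories and baths come with finite-size losses, so achievability always demands a strict
  free-energy gap and delivers the heat only up to an error. Comparing two lengths at one energy
  supplies the gap: the strictly smaller entropy of the longer vector turns the non-strict second
  law for the shorter one into the strict hypothesis for the longer one. Equal lengths are settled
  separately, since their heat sets coincide.

  Strictness is sought for \<open>Qc\<close> only. At energy 1 the function \<open>\<psi>\<close>
  equals \<open>- \<beta>\<close>, which no state undercuts, so the upper end can still move. At
  energy -1 it equals \<open>\<beta>\<close>, and the lower end of the range may already sit there
  for both lengths, leaving \<open>Qh\<close> unchanged.\<close>

definition unitary_on :: "'a set \<Rightarrow> ('a \<Rightarrow> 'a \<Rightarrow> complex) \<Rightarrow> bool" where
  "unitary_on J w \<longleftrightarrow>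
     (\<forall>x\<in>J. \<forall>y\<in>J. (\<Sum>z\<in>J. w x z * cnj (w y z)) = of_bool (x = y)) \<and>
     (\<forall>x\<in>J. \<forall>y\<in>J. (\<Sum>z\<in>J. cnj (w z x) * w z y) = of_bool (x = y))"

definition kernel_apply :: "'a set \<Rightarrow> ('a \<Rightarrow> 'a \<Rightarrow> complex) \<Rightarrow> ('a \<Rightarrow> complex) \<Rightarrow> 'a \<Rightarrow> complex" where
  "kernel_apply J w v x = (\<Sum>z\<in>J. w x z * v z)"

lemma sum_of_bool_mult_left [simp]:
  fixes f :: "'a \<Rightarrow> complex"
  assumes "finite J" "x \<in> J"
  shows "(\<Sum>z\<in>J. of_bool (x = z) * f z) = f x" "(\<Sum>z\<in>J. of_bool (z = x) * f z) = f x"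
    "(\<Sum>z\<in>J. f z * of_bool (x = z)) = f x" "(\<Sum>z\<in>J. f z * of_bool (z = x)) = f x"
  using assms by (simp_all add: of_bool_def if_distrib if_distribR cong: if_cong)

lemma cnj_of_bool [simp]: "cnj (of_bool b) = of_bool b"
  by (cases b) auto

lemma of_real_cmod_power2: "complex_of_real ((cmod z)\<^sup>2) = cnj z * z"
  by (metis complex_norm_square mult.commute of_real_power)

lemma unitary_on_id: "finite J \<Longrightarrow> unitary_on J (\<lambda>x y. of_bool (x = y))"
  unfolding unitary_on_def by auto

lemma unitary_on_mult:
  assumes J: "finite J" and u: "unitary_on J u" and w: "unitary_on J w"
  shows "unitary_on J (\<lambda>x y. \<Sum>k\<in>J. u x k * w k y)"
  unfolding unitary_on_def
proof (intro conjI ballI)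
  fix x y assume xy: "x \<in> J" "y \<in> J"
  have "(\<Sum>z\<in>J. (\<Sum>k\<in>J. u x k * w k z) * cnj (\<Sum>k\<in>J. u y k * w k z)) =
        (\<Sum>z\<in>J. \<Sum>k\<in>J. \<Sum>l\<in>J. u x k * cnj (u y l) * (w k z * cnj (w l z)))"
    by (simp add: sum_product mult_ac)
  also have "\<dots> = (\<Sum>k\<in>J. \<Sum>l\<in>J. u x k * cnj (u y l) * (\<Sum>z\<in>J. w k z * cnj (w l z)))"
    by (subst sum.swap, rule sum.cong[OF refl], subst sum.swap, simp add: sum_distrib_left)
  also have "\<dots> = (\<Sum>k\<in>J. \<Sum>l\<in>J. u x k * cnj (u y l) * of_bool (k = l))"
    using w by (simp add: unitary_on_def)
  also have "\<dots> = of_bool (x = y)" using u J xy by (simp add: unitary_on_def)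
  finally show "(\<Sum>z\<in>J. (\<Sum>k\<in>J. u x k * w k z) * cnj (\<Sum>k\<in>J. u y k * w k z)) = of_bool (x = y)" .
  have "(\<Sum>z\<in>J. cnj (\<Sum>k\<in>J. u z k * w k x) * (\<Sum>k\<in>J. u z k * w k y)) =
        (\<Sum>z\<in>J. \<Sum>k\<in>J. \<Sum>l\<in>J. cnj (w k x) * w l y * (cnj (u z k) * u z l))"
    by (simp only: cnj_sum sum_product complex_cnj_mult) (simp add: mult_ac)
  also have "\<dots> = (\<Sum>k\<in>J. \<Sum>l\<in>J. cnj (w k x) * w l y * (\<Sum>z\<in>J. cnj (u z k) * u z l))"
    by (subst sum.swap, rule sum.cong[OF refl], subst sum.swap, simp add: sum_distrib_left)
  also have "\<dots> = (\<Sum>k\<in>J. \<Sum>l\<in>J. cnj (w k x) * w l y * of_bool (k = l))"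
    using u by (simp add: unitary_on_def)
  also have "\<dots> = of_bool (x = y)" using w J xy by (simp add: unitary_on_def)
  finally show "(\<Sum>z\<in>J. cnj (\<Sum>k\<in>J. u z k * w k x) * (\<Sum>k\<in>J. u z k * w k y)) = of_bool (x = y)" .
qed

text \<open>Rows from different fibres of \<open>t\<close> have disjoint supports, so orthonormality
  only has to be checked inside a block. Taking \<open>t\<close> to be the total energy makes
  conservation automatic; taking it to be a membership test extends a unitary by the
  identity.\<close>

lemma unitary_on_direct_sum:
  assumes J: "finite J" and w: "\<And>\<tau>. \<tau> \<in> t ` J \<Longrightarrow> unitary_on {x\<in>J. t x = \<tau>} (w \<tau>)"
  shows "unitary_on J (\<lambda>x y. if t x = t y then w (t x) x y else 0)"
  unfolding unitary_on_def
proof (intro conjI ballI)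
  fix x y assume xy: "x \<in> J" "y \<in> J"
  have ux: "unitary_on {z\<in>J. t z = t x} (w (t x))" using w xy by auto
  have "(\<Sum>z\<in>J. (if t x = t z then w (t x) x z else 0) * cnj (if t y = t z then w (t y) y z else 0)) =
     (if t y = t x then \<Sum>z\<in>{z\<in>J. t z = t x}. w (t x) x z * cnj (w (t x) y z) else 0)"
    using J by (simp add: sum.inter_filter) (auto intro!: sum.cong sum.neutral)
  also have "\<dots> = of_bool (x = y)"
    using ux xy by (simp add: unitary_on_def) (metis (no_types))
  finally show "(\<Sum>z\<in>J. (if t x = t z then w (t x) x z else 0) * cnj (if t y = t z then w (t y) y z else 0))
     = of_bool (x = y)" .
  have "(\<Sum>z\<in>J. cnj (if t z = t x then w (t z) z x else 0) * (if t z = t y then w (t z) z y else 0)) =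
     (if t y = t x then \<Sum>z\<in>{z\<in>J. t z = t x}. cnj (w (t x) z x) * w (t x) z y else 0)"
    using J by (simp add: sum.inter_filter) (auto intro!: sum.cong sum.neutral)
  also have "\<dots> = of_bool (x = y)"
    using ux xy by (simp add: unitary_on_def) (metis (no_types))
  finally show "(\<Sum>z\<in>J. cnj (if t z = t x then w (t z) z x else 0) * (if t z = t y then w (t z) z y else 0))
     = of_bool (x = y)" .
qed

lemma unitary_on_isometry:
  assumes J: "finite J" and w: "unitary_on J w"
  shows "(\<Sum>x\<in>J. (cmod (kernel_apply J w v x))\<^sup>2) = (\<Sum>x\<in>J. (cmod (v x))\<^sup>2)"
proof -
  have "complex_of_real (\<Sum>x\<in>J. (cmod (kernel_apply J w v x))\<^sup>2) = (\<Sum>x\<in>J. cnj (kernel_apply J w v x) * kernel_apply J w v x)"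
    by (simp only: of_real_sum of_real_cmod_power2)
  also have "\<dots> = (\<Sum>x\<in>J. \<Sum>k\<in>J. \<Sum>l\<in>J. cnj (v k) * v l * (cnj (w x k) * w x l))"
    by (simp only: kernel_apply_def cnj_sum sum_product complex_cnj_mult) (simp add: mult_ac)
  also have "\<dots> = (\<Sum>k\<in>J. \<Sum>l\<in>J. cnj (v k) * v l * (\<Sum>x\<in>J. cnj (w x k) * w x l))"
    by (subst sum.swap, rule sum.cong[OF refl], subst sum.swap, simp add: sum_distrib_left)
  also have "\<dots> = (\<Sum>k\<in>J. \<Sum>l\<in>J. cnj (v k) * v l * of_bool (k = l))"
    using w by (simp add: unitary_on_def)
  also have "\<dots> = (\<Sum>k\<in>J. cnj (v k) * v k)" using J by simp
  also have "\<dots> = complex_of_real (\<Sum>x\<in>J. (cmod (v x))\<^sup>2)"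
    by (simp only: of_real_sum of_real_cmod_power2)
  finally show ?thesis by (simp only: of_real_eq_iff)
qed

text \<open>A Householder reflection: reflecting along the difference of \<open>u\<close> and a
  multiple of the basis vector \<open>g\<close> of the same length carries one to the other.\<close>

lemma unitary_on_aligns:
  assumes J: "finite J" and g: "g \<in> J"
  shows "\<exists>w. unitary_on J w \<and> (\<forall>x\<in>J - {g}. kernel_apply J w u x = 0)"
proof (cases "\<forall>x\<in>J. u x = 0")
  case True
  then show ?thesis using unitary_on_id[OF J] by (intro exI[of _ "\<lambda>x y. of_bool (x = y)"]) (auto simp: kernel_apply_def)
next
  case False
  define s where "s = sqrt (\<Sum>x\<in>J. (cmod (u x))\<^sup>2)"
  have s2: "s\<^sup>2 = (\<Sum>x\<in>J. (cmod (u x))\<^sup>2)" by (simp add: s_def sum_nonneg)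
  have "s\<^sup>2 > 0" using False J unfolding s2 by (auto intro: sum_pos2)
  hence s0: "s > 0" unfolding s_def by (simp add: s2[symmetric])
  \<comment> \<open>The phase opposite to that of \<open>u g\<close> makes the inner product of
    \<open>u\<close> with the target real, as a complex reflection requires, and keeps the
    difference vector away from zero.\<close>
  define \<alpha> where "\<alpha> = (if u g = 0 then of_real s else - of_real s * sgn (u g))"
  have norm\<alpha>: "\<alpha> * cnj \<alpha> = of_real (s\<^sup>2)"
    using s0 by (auto simp: \<alpha>_def complex_norm_square[symmetric] norm_mult norm_sgn)
  have au: "cnj \<alpha> * u g = - of_real (s * cmod (u g))"
  proof (cases "u g = 0")
    case False
    have "cnj \<alpha> * u g = - of_real s * (cnj (sgn (u g)) * u g)" using False by (simp add: \<alpha>_def)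
    also have "cnj (sgn (u g)) * u g = (u g * cnj (u g)) / of_real (cmod (u g))"
      by (simp add: sgn_div_norm scaleR_conv_of_real field_simps)
    also have "\<dots> = of_real (cmod (u g))"
      using False by (simp add: complex_norm_square[symmetric] power2_eq_square)
    finally show ?thesis by simp
  qed (simp add: \<alpha>_def)
  have au': "\<alpha> * cnj (u g) = - of_real (s * cmod (u g))"
    using arg_cong[OF au, of cnj] by simp
  define d where "d x = u x - \<alpha> * of_bool (x = g)" for x
  \<comment> \<open>\<open>D\<close> is the squared length of \<open>d\<close>, and the inner
    product of \<open>d\<close> with \<open>u\<close> is half of it; this is what makes the
    reflection send \<open>u\<close> to \<open>u - d\<close>.\<close>
  define D where "D = 2 * (s\<^sup>2 + s * cmod (u g))"
  have D0: "D > 0" using s0 by (auto simp: D_def intro: add_pos_nonneg)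
  have uu: "(\<Sum>z\<in>J. cnj (u z) * u z) = of_real (s\<^sup>2)"
    by (simp only: s2 of_real_sum of_real_cmod_power2)
  have du: "(\<Sum>z\<in>J. cnj (d z) * u z) = of_real (D / 2)"
  proof -
    have "(\<Sum>z\<in>J. cnj (d z) * u z) = (\<Sum>z\<in>J. cnj (u z) * u z) - (\<Sum>z\<in>J. of_bool (z = g) * (cnj \<alpha> * u z))"
      by (simp add: d_def algebra_simps sum_subtractf)
    also have "\<dots> = of_real (s\<^sup>2) - cnj \<alpha> * u g" using uu J g by simp
    finally show ?thesis by (simp add: au D_def)
  qed
  have dd: "(\<Sum>z\<in>J. cnj (d z) * d z) = of_real D"
  proof -
    have "(\<Sum>z\<in>J. cnj (d z) * d z) = (\<Sum>z\<in>J. cnj (d z) * u z) - (\<Sum>z\<in>J. of_bool (z = g) * (cnj (d z) * \<alpha>))"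
      unfolding sum_subtractf[symmetric] by (intro sum.cong refl) (simp add: d_def algebra_simps)
    also have "\<dots> = of_real (D/2) - cnj (d g) * \<alpha>" using du J g by simp
    also have "cnj (d g) * \<alpha> = \<alpha> * cnj (u g) - \<alpha> * cnj \<alpha>" by (simp add: d_def algebra_simps)
    finally show ?thesis by (simp add: au' norm\<alpha> D_def)
  qed
  define w where "w x y = of_bool (x = y) - 2 * d x * cnj (d y) / of_real D" for x y
  have wsq: "(\<Sum>z\<in>J. w x z * w z y) = of_bool (x = y)" if "x \<in> J" "y \<in> J" for x y
  proof -
    have "(\<Sum>z\<in>J. w x z * w z y) = (\<Sum>z\<in>J. of_bool (x = z) * w z y) -
        2 * d x / of_real D * (\<Sum>z\<in>J. of_bool (z = y) * cnj (d z)) +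
        4 * d x * cnj (d y) / (of_real D)\<^sup>2 * (\<Sum>z\<in>J. cnj (d z) * d z)"
      unfolding w_def sum_distrib_left sum_subtractf[symmetric] sum.distrib[symmetric]
      by (intro sum.cong refl) (simp add: algebra_simps power2_eq_square)
    also have "\<dots> = of_bool (x = y)"
      using that J D0 by (simp add: dd) (simp add: w_def power2_eq_square)
    finally show ?thesis .
  qed
  have wh: "cnj (w x y) = w y x" for x y by (simp add: w_def eq_commute[of x y] mult_ac)
  have "unitary_on J w" by (simp add: unitary_on_def wh wsq)
  moreover have "kernel_apply J w u x = 0" if "x \<in> J - {g}" for x
  proof -
    have "kernel_apply J w u x = (\<Sum>z\<in>J. of_bool (x = z) * u z) - 2 * d x / of_real D * (\<Sum>z\<in>J. cnj (d z) * u z)"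
      unfolding kernel_apply_def w_def sum_distrib_left sum_subtractf[symmetric]
      by (intro sum.cong refl) (simp add: algebra_simps)
    also have "\<dots> = u x - d x" using that J D0 by (simp add: du)
    finally show ?thesis using that by (simp add: d_def)
  qed
  ultimately show ?thesis by blast
qed

lemma kernel_apply_mult:
  "kernel_apply J (\<lambda>x y. \<Sum>k\<in>J. u x k * w k y) v x = kernel_apply J u (kernel_apply J w v) x"
proof -
  have "kernel_apply J (\<lambda>x y. \<Sum>k\<in>J. u x k * w k y) v x = (\<Sum>z\<in>J. \<Sum>k\<in>J. u x k * (w k z * v z))"
    by (simp only: kernel_apply_def sum_distrib_right mult.assoc)
  also have "\<dots> = kernel_apply J u (kernel_apply J w v) x"
    by (subst sum.swap) (simp add: kernel_apply_def sum_distrib_left)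
  finally show ?thesis .
qed

text \<open>As in a QR decomposition, one coordinate of \<open>G\<close> is spent per vector. The
  reflection for the last vector acts only outside the coordinates already spent, where the earlier
  images vanish, so it cannot spoil them.\<close>

lemma unitary_on_compresses:
  assumes J: "finite J" and "G \<subseteq> J" "d \<le> card G"
  shows "\<exists>w. unitary_on J w \<and> (\<forall>i<d. \<forall>x\<in>J - G. kernel_apply J w (v i) x = 0)"
  using assms(2,3)
proof (induction d arbitrary: G)
  case 0
  then show ?case using unitary_on_id[OF J] by auto
next
  case (Suc d)
  from Suc.prems have "G \<noteq> {}" by auto
  then obtain g where g: "g \<in> G" by blast
  define G' where "G' = G - {g}"
  have fG: "finite G" using Suc.prems(1) J finite_subset by metis
  have "d \<le> card G'" using Suc.prems g fG by (simp add: G'_def)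
  moreover have "G' \<subseteq> J" using Suc.prems by (auto simp: G'_def)
  ultimately obtain w where
    w: "unitary_on J w" "\<And>i x. i < d \<Longrightarrow> x \<in> J - G' \<Longrightarrow> kernel_apply J w (v i) x = 0"
    using Suc.IH[of G'] by meson
  define L where "L = J - G'"
  have L: "finite L" "g \<in> L" using J g Suc.prems by (auto simp: L_def G'_def)
  from unitary_on_aligns[OF L] obtain w2 where
    w2: "unitary_on L w2" "\<And>x. x \<in> L - {g} \<Longrightarrow> kernel_apply L w2 (kernel_apply J w (v d)) x = 0" by blast
  define w3 where "w3 x y = (if (x \<in> L) = (y \<in> L) then (if x \<in> L then w2 else (\<lambda>x y. of_bool (x = y))) x y else 0)" for x y
  have sets: "{x \<in> J. x \<in> L} = L" "{x\<in>J. x \<notin> L} = J \<inter> G'" by (auto simp: L_def)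
  have "unitary_on {x\<in>J. (x \<in> L) = \<tau>} (if \<tau> then w2 else (\<lambda>x y. of_bool (x = y)))" for \<tau>
    using w2 sets unitary_on_id[of "J \<inter> G'"] J by (cases \<tau>) auto
  from unitary_on_direct_sum[OF J, of "\<lambda>x. x \<in> L", OF this]
  have w3: "unitary_on J w3" unfolding w3_def .
  have w3L: "kernel_apply J w3 f x = kernel_apply L w2 f x" if "x \<in> L" for f x
  proof -
    have "kernel_apply J w3 f x = (\<Sum>z\<in>J. if z \<in> L then w2 x z * f z else 0)"
      unfolding kernel_apply_def using that by (intro sum.cong) (auto simp: w3_def)
    also have "\<dots> = kernel_apply L w2 f x"
      using J by (simp add: sum.inter_filter[symmetric] sets kernel_apply_def)
    finally show ?thesis .
  qed
  define w' where "w' x y = (\<Sum>k\<in>J. w3 x k * w k y)" for x y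
  have "unitary_on J w'" unfolding w'_def by (rule unitary_on_mult[OF J w3 w(1)])
  moreover have "kernel_apply J w' (v i) x = 0" if i: "i < Suc d" and x: "x \<in> J - G" for i x
  proof -
    have xL: "x \<in> L - {g}" using x g by (auto simp: L_def G'_def)
    have "kernel_apply J w' (v i) x = kernel_apply L w2 (kernel_apply J w (v i)) x"
      unfolding w'_def kernel_apply_mult using xL w3L by simp
    also have "\<dots> = 0"
    proof (cases "i = d")
      case False
      then have "kernel_apply J w (v i) z = 0" if "z \<in> L" for z
        using i w(2)[of i] that by (simp add: L_def)
      then show ?thesis by (simp add: kernel_apply_def[of L])
    qed (use w2 xL in auto)
    finally show ?thesis .
  qed
  ultimately show ?case by blast
qed

subsection \<open>Typical sets of biased bit strings\<close>

lemma sum_Pow_insert: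
  assumes "finite A" "k \<notin> A"
  shows "(\<Sum>x\<in>Pow (insert k A). f x) = (\<Sum>y\<in>Pow A. f y + f (insert k y))"
proof -
  have "inj_on (insert k) (Pow A)" using assms by (auto simp: inj_on_def)
  moreover have "Pow A \<inter> insert k ` Pow A = {}" using assms by auto
  ultimately show ?thesis using assms
    by (simp add: Pow_insert sum.union_disjoint sum.reindex sum.distrib)
qed

text \<open>Distributivity: each subset of \<open>A\<close> records in which factors the
  \<open>True\<close> term was picked. It turns products over qubits into sums over strings.\<close>

lemma sum_Pow_prod:
  fixes f :: "'i \<Rightarrow> bool \<Rightarrow> 'a::comm_semiring_1"
  assumes "finite A"
  shows "(\<Sum>x\<in>Pow A. \<Prod>i\<in>A. f i (i \<in> x)) = (\<Prod>i\<in>A. f i True + f i False)"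
  using assms
proof (induction A rule: finite_induct)
  case (insert k A)
  have *: "(\<Prod>i\<in>A. f i (i \<in> insert k y)) = (\<Prod>i\<in>A. f i (i \<in> y))" for y
    using insert.hyps by (intro prod.cong refl arg_cong2[of _ _ _ _ f]) auto
  hence eq: "(\<Prod>i\<in>A. f i (i = k \<or> i \<in> y)) = (\<Prod>i\<in>A. f i (i \<in> y))" for y by simp
  have "(\<Sum>x\<in>Pow (insert k A). \<Prod>i\<in>insert k A. f i (i \<in> x)) =
        (\<Sum>y\<in>Pow A. (f k False + f k True) * (\<Prod>i\<in>A. f i (i \<in> y)))"
    unfolding sum_Pow_insert[OF insert.hyps]
  proof (rule sum.cong[OF refl])
    fix y assume "y \<in> Pow A"
    hence "k \<notin> y" using insert by auto
    then show "(\<Prod>i\<in>insert k A. f i (i \<in> y)) + (\<Prod>i\<in>insert k A. f i (i \<in> insert k y)) =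
      (f k False + f k True) * (\<Prod>i\<in>A. f i (i \<in> y))"
      using insert.hyps by (simp add: eq algebra_simps)
  qed
  then show ?case using insert by (simp add: sum_distrib_left[symmetric] add.commute)
qed simp

text \<open>Subsets of \<open>{..<n}\<close> stand for bit strings, an element being a position that
  carries a one.\<close>

definition bernoulli :: "real \<Rightarrow> nat \<Rightarrow> nat set \<Rightarrow> real" where
  "bernoulli p n x = (\<Prod>i<n. if i \<in> x then p else 1 - p)"

text \<open>Natural logarithms, so that entropies and \<open>\<beta>\<close> times energies add
  without conversion. At 0 and 1 the singular logarithm is multiplied by zero.\<close>

definition binary_entropy :: "real \<Rightarrow> real" where
  "binary_entropy p = - (p * ln p + (1 - p) * ln (1 - p))"

lemma bernoulli_nonneg: "0 \<le> p \<Longrightarrow> p \<le> 1 \<Longrightarrow> bernoulli p n x \<ge> 0"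
  unfolding bernoulli_def by (intro prod_nonneg) auto

lemma bernoulli_Suc:
  assumes "x \<subseteq> {..<n}"
  shows "bernoulli p (Suc n) x = (1 - p) * bernoulli p n x" "bernoulli p (Suc n) (insert n x) = p * bernoulli p n x"
proof -
  have "(\<Prod>i<n. if i \<in> insert n x then p else 1 - p) = (\<Prod>i<n. if i \<in> x then p else 1 - p)"
    by (intro prod.cong) auto
  then show "bernoulli p (Suc n) x = (1 - p) * bernoulli p n x" "bernoulli p (Suc n) (insert n x) = p * bernoulli p n x"
    using assms by (auto simp: bernoulli_def)
qed

lemma sum_bernoulli_Suc:
  "(\<Sum>x\<in>Pow {..<Suc n}. bernoulli p (Suc n) x * f x) =
   (\<Sum>x\<in>Pow {..<n}. bernoulli p n x * ((1 - p) * f x + p * f (insert n x)))"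
  unfolding lessThan_Suc
  by (subst sum_Pow_insert) (auto simp: bernoulli_Suc algebra_simps intro!: sum.cong)

lemma sum_bernoulli: "(\<Sum>x\<in>Pow {..<n}. bernoulli p n x) = 1"
proof (induction n)
  case (Suc n)
  then show ?case using sum_bernoulli_Suc[of p n "\<lambda>_. 1"] by simp
qed (simp add: bernoulli_def)

lemma card_insert_lessThan: "x \<subseteq> {..<n :: nat} \<Longrightarrow> card (insert n x) = Suc (card x)"
  by (subst card_insert_disjoint) (auto intro: finite_subset)

lemma bernoulli_mean: "(\<Sum>x\<in>Pow {..<n}. bernoulli p n x * (real (card x) - n * p)) = 0"
proof (induction n)
  case (Suc n)
  have "(\<Sum>x\<in>Pow {..<Suc n}. bernoulli p (Suc n) x * (real (card x) - Suc n * p)) =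
     (\<Sum>x\<in>Pow {..<n}. bernoulli p n x * (real (card x) - n * p))"
    unfolding sum_bernoulli_Suc by (intro sum.cong) (auto simp: card_insert_lessThan algebra_simps)
  then show ?case using Suc by simp
qed simp

lemma bernoulli_variance: "(\<Sum>x\<in>Pow {..<n}. bernoulli p n x * (real (card x) - n * p)\<^sup>2) = n * (p * (1 - p))"
proof (induction n)
  case (Suc n)
  have "(\<Sum>x\<in>Pow {..<Suc n}. bernoulli p (Suc n) x * (real (card x) - Suc n * p)\<^sup>2) =
     (\<Sum>x\<in>Pow {..<n}. bernoulli p n x * (real (card x) - n * p)\<^sup>2 + bernoulli p n x * (p * (1 - p)))"
    unfolding sum_bernoulli_Suc
    by (intro sum.cong) (auto simp: card_insert_lessThan algebra_simps power2_eq_square)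
  then show ?case using Suc
    by (simp add: sum.distrib sum_distrib_right[symmetric] sum_bernoulli) (simp add: algebra_simps)
qed simp

text \<open>The variance is at most \<open>n / 4\<close> whatever the bias, hence the constant
  4.\<close>

lemma bernoulli_Chebyshev:
  fixes p d :: real
  assumes p: "0 \<le> p" "p \<le> 1" and n: "n > 0" and d: "d > 0"
  shows "(\<Sum>x\<in>{x\<in>Pow {..<n}. \<bar>real (card x) - n * p\<bar> \<ge> d * n}. bernoulli p n x) \<le> 1 / (4 * d\<^sup>2 * n)"
    (is "sum _ ?S \<le> _")
proof -
  have dn: "d * n > 0" using n d by simp
  have "(d * n)\<^sup>2 * sum (bernoulli p n) ?S \<le> (\<Sum>x\<in>?S. bernoulli p n x * (real (card x) - n * p)\<^sup>2)"
    unfolding sum_distrib_left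
  proof (rule sum_mono)
    fix x assume "x \<in> ?S"
    hence "(d * n)\<^sup>2 \<le> (real (card x) - n * p)\<^sup>2" using dn by (simp add: abs_le_square_iff[symmetric])
    then show "(d * n)\<^sup>2 * bernoulli p n x \<le> bernoulli p n x * (real (card x) - n * p)\<^sup>2"
      using bernoulli_nonneg[OF p] by (subst mult.commute) (intro mult_left_mono)
  qed
  also have "\<dots> \<le> (\<Sum>x\<in>Pow {..<n}. bernoulli p n x * (real (card x) - n * p)\<^sup>2)"
    using bernoulli_nonneg[OF p] by (intro sum_mono2) auto
  also have "\<dots> = n * (p * (1 - p))" by (rule bernoulli_variance)
  also have "p * (1 - p) \<le> 1 / 4"
    using zero_le_power2[of "p - 1/2"] by (simp add: power2_eq_square algebra_simps)
  finally have "(d * n)\<^sup>2 * sum (bernoulli p n) ?S \<le> n / 4" using n by simp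
  then show ?thesis using n d by (simp add: field_simps power2_eq_square)
qed

lemma eventually_bernoulli_Chebyshev:
  fixes p d e :: real
  assumes p: "0 \<le> p" "p \<le> 1" and d: "d > 0" and e: "e > 0"
  shows "\<forall>\<^sub>F n in sequentially.
    (\<Sum>x\<in>{x\<in>Pow {..<n}. \<bar>real (card x) - n * p\<bar> \<ge> d * n}. bernoulli p n x) \<le> e"
proof -
  obtain n0 where n0: "real n0 > 1 / (4 * d\<^sup>2 * e)" using reals_Archimedean2 by blast
  show ?thesis
  proof (rule eventually_sequentiallyI)
    fix n assume n: "n \<ge> Suc n0"
    hence "1 / (4 * d\<^sup>2 * e) < n" using n0 by linarith
    hence "1 / (4 * d\<^sup>2 * n) \<le> e" using n d e by (simp add: field_simps)
    then show "(\<Sum>x\<in>{x\<in>Pow {..<n}. \<bar>real (card x) - n * p\<bar> \<ge> d * n}. bernoulli p n x) \<le> e"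
      using bernoulli_Chebyshev[OF p, of n d] d n by linarith
  qed
qed

text \<open>The likelihood of a string depends only on its number of ones; expanding around the mean
  \<open>n * p\<close> isolates the entropy and leaves the deviation times the log-odds.\<close>

lemma bernoulli_exp:
  assumes p: "0 < p" "p < 1" and x: "x \<subseteq> {..<n}"
  shows "bernoulli p n x = exp (- (n * binary_entropy p) + (real (card x) - n * p) * (ln p - ln (1 - p)))"
proof -
  have fx: "finite x" using x finite_subset by blast
  have "bernoulli p n x = exp (\<Sum>i<n. if i \<in> x then ln p else ln (1 - p))"
    unfolding bernoulli_def exp_sum[OF finite_lessThan] using p by (intro prod.cong) auto
  also have "(\<Sum>i<n. if i \<in> x then ln p else ln (1 - p)) =
     (\<Sum>i<n. (if i \<in> x then ln p - ln (1 - p) else 0) + ln (1 - p))"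
    by (intro sum.cong) auto
  also have "\<dots> = card x * (ln p - ln (1 - p)) + n * ln (1 - p)"
    using x by (simp add: sum.distrib sum.If_cases Int_absorb1 del: sum.If_cases)
      (simp add: sum.inter_restrict[symmetric] Int_absorb1 flip: sum.inter_filter)
  also have "\<dots> = - (n * binary_entropy p) + (real (card x) - n * p) * (ln p - ln (1 - p))"
    by (simp add: binary_entropy_def algebra_simps)
  finally show ?thesis .
qed

lemma bernoulli_typical_bounds:
  assumes p: "0 < p" "p < 1" and x: "x \<subseteq> {..<n}" and d: "\<bar>real (card x) - n * p\<bar> < d * n"
    and e: "d * \<bar>ln p - ln (1 - p)\<bar> \<le> \<eta>"
  shows "exp (- (n * (binary_entropy p + \<eta>))) \<le> bernoulli p n x" "bernoulli p n x \<le> exp (- (n * (binary_entropy p - \<eta>)))"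
proof -
  have "\<bar>(real (card x) - n * p) * (ln p - ln (1 - p))\<bar> \<le> (d * n) * \<bar>ln p - ln (1 - p)\<bar>"
    unfolding abs_mult using d by (intro mult_right_mono) auto
  also have "\<dots> \<le> n * \<eta>" using mult_left_mono[OF e, of n] by (simp add: mult_ac)
  finally show "exp (- (n * (binary_entropy p + \<eta>))) \<le> bernoulli p n x" "bernoulli p n x \<le> exp (- (n * (binary_entropy p - \<eta>)))"
    unfolding bernoulli_exp[OF p x] by (auto simp: algebra_simps)
qed

lemma small_width:
  fixes L \<eta> :: real assumes "\<eta> > 0" "d0 > 0"
  obtains d where "d > 0" "d \<le> d0" "d * \<bar>L\<bar> \<le> \<eta>"
proof
  \<comment> \<open>The added 1 covers a vanishing \<open>L\<close>, which occurs for the fair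
    coin.\<close>
  show "min d0 (\<eta> / (\<bar>L\<bar> + 1)) > 0" using assms by simp
  show "min d0 (\<eta> / (\<bar>L\<bar> + 1)) \<le> d0" by simp
  have "min d0 (\<eta> / (\<bar>L\<bar> + 1)) * \<bar>L\<bar> \<le> \<eta> / (\<bar>L\<bar> + 1) * \<bar>L\<bar>" by (intro mult_right_mono) auto
  also have "\<dots> = \<eta> * (\<bar>L\<bar> / (\<bar>L\<bar> + 1))" by simp
  also have "\<dots> \<le> \<eta> * 1" using assms by (intro mult_left_mono) auto
  finally show "min d0 (\<eta> / (\<bar>L\<bar> + 1)) * \<bar>L\<bar> \<le> \<eta>" by simp
qed

text \<open>Every typical string has probability at least
  \<open>exp (- (n * (binary_entropy p + \<eta>)))\<close> and the total is at most 1, so there are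
  few of them. The deterministic coins get singleton sets because the log-odds diverge there;
  \<open>p = 1\<close> is the case of a pure input state.\<close>

lemma eventually_typical_upper:
  fixes p \<eta> e :: real
  assumes p: "0 \<le> p" "p \<le> 1" and h: "\<eta> > 0" and e: "e > 0"
  shows "\<forall>\<^sub>F n in sequentially. \<exists>T\<subseteq>Pow {..<n}. card T \<le> exp (n * (binary_entropy p + \<eta>)) \<and>
     (\<Sum>x\<in>Pow {..<n} - T. bernoulli p n x) \<le> e"
proof -
  consider "p = 0" | "p = 1" | "0 < p" "p < 1" using p by linarith
  then show ?thesis
  proof cases
    case 1
    have "card {{}} \<le> exp (n * (binary_entropy p + \<eta>)) \<and> (\<Sum>x\<in>Pow {..<n} - {{}}. bernoulli p n x) \<le> e" for n :: nat
    proof -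
      have "bernoulli p n x = 0" if "x \<in> Pow {..<n} - {{}}" for x
        using that 1 by (auto simp: bernoulli_def)
      then show ?thesis using 1 h e by (simp add: binary_entropy_def)
    qed
    then show ?thesis by (intro always_eventually) (auto intro!: exI[of _ "{{}}"])
  next
    case 2
    have "card {{..<n}} \<le> exp (n * (binary_entropy p + \<eta>)) \<and> (\<Sum>x\<in>Pow {..<n} - {{..<n}}. bernoulli p n x) \<le> e" for n :: nat
    proof -
      have "bernoulli p n x = 0" if "x \<in> Pow {..<n} - {{..<n}}" for x
        using that 2 by (auto simp: bernoulli_def)
      then show ?thesis using 2 h e by (simp add: binary_entropy_def)
    qed
    then show ?thesis by (intro always_eventually allI) (rule_tac x="{{..<x}}" in exI, auto)
  next
    case 3
    obtain d where d: "d > 0" "d * \<bar>ln p - ln (1 - p)\<bar> \<le> \<eta>"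
      using small_width[OF h, of 1 "ln p - ln (1 - p)"] by auto
    have "\<forall>\<^sub>F n in sequentially.
      (\<Sum>x\<in>{x\<in>Pow {..<n}. \<bar>real (card x) - n * p\<bar> \<ge> d * n}. bernoulli p n x) \<le> e"
      by (rule eventually_bernoulli_Chebyshev[OF p d(1) e])
    then show ?thesis
    proof eventually_elim
      case (elim n)
      define T where "T = {x\<in>Pow {..<n}. \<bar>real (card x) - n * p\<bar> < d * n}"
      have "exp (- (n * (binary_entropy p + \<eta>))) * card T = (\<Sum>x\<in>T. exp (- (n * (binary_entropy p + \<eta>))))" by simp
      also have "\<dots> \<le> (\<Sum>x\<in>T. bernoulli p n x)"
        by (intro sum_mono bernoulli_typical_bounds[OF 3]) (use d in \<open>auto simp: T_def\<close>)
      also have "\<dots> \<le> (\<Sum>x\<in>Pow {..<n}. bernoulli p n x)"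
        using bernoulli_nonneg[OF p] by (intro sum_mono2) (auto simp: T_def)
      finally have "card T \<le> exp (n * (binary_entropy p + \<eta>))"
        unfolding sum_bernoulli exp_minus by (simp add: field_simps)
      moreover have "Pow {..<n} - T = {x\<in>Pow {..<n}. \<bar>real (card x) - n * p\<bar> \<ge> d * n}"
        by (auto simp: T_def)
      ultimately show ?case using elim by (intro exI[of _ T]) (auto simp: T_def)
    qed
  qed
qed

lemma eventually_typical_lower:
  fixes p \<eta> d0 :: real
  assumes p: "0 < p" "p < 1" and h: "\<eta> > 0" and d0: "d0 > 0"
  shows "\<forall>\<^sub>F n in sequentially.
    card {x\<in>Pow {..<n}. \<bar>real (card x) - n * p\<bar> < d0 * n} \<ge> exp (n * (binary_entropy p - \<eta>))"
proof -
  \<comment> \<open>Half of \<open>\<eta>\<close> goes to the bound on single probabilities, the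
    other half absorbs the factor 1/2 left by Chebyshev.\<close>
  obtain d where d: "d > 0" "d \<le> d0" "d * \<bar>ln p - ln (1 - p)\<bar> \<le> \<eta> / 2"
    using small_width[of "\<eta>/2" d0 "ln p - ln (1 - p)"] h d0 by auto
  have "\<forall>\<^sub>F n in sequentially.
      (\<Sum>x\<in>{x\<in>Pow {..<n}. \<bar>real (card x) - n * p\<bar> \<ge> d * n}. bernoulli p n x) \<le> 1 / 2"
    using p d by (intro eventually_bernoulli_Chebyshev) auto
  moreover have "\<forall>\<^sub>F n in sequentially. exp (- (real n * (\<eta> / 2))) \<le> 1 / 2"
  proof -
    obtain n0 where n0: "real n0 > ln 2 / (\<eta> / 2)" using reals_Archimedean2 by blast
    show ?thesis
    proof (rule eventually_sequentiallyI)
      fix n assume "n \<ge> n0"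
      hence "ln 2 / (\<eta> / 2) \<le> n" using n0 by linarith
      hence "ln 2 \<le> n * (\<eta> / 2)" using h by (simp add: field_simps)
      hence "exp (ln 2) \<le> exp (n * (\<eta> / 2))" by (simp only: exp_le_cancel_iff)
      then show "exp (- (real n * (\<eta> / 2))) \<le> 1 / 2" by (simp add: exp_minus field_simps)
    qed
  qed
  ultimately show ?thesis
  proof eventually_elim
    case (elim n)
    define T where "T = {x\<in>Pow {..<n}. \<bar>real (card x) - n * p\<bar> < d * n}"
    have "(\<Sum>x\<in>Pow {..<n}. bernoulli p n x) = sum (bernoulli p n) (Pow {..<n} - T) + sum (bernoulli p n) T"
      by (rule sum.subset_diff) (auto simp: T_def)
    moreover have "Pow {..<n} - T = {x\<in>Pow {..<n}. \<bar>real (card x) - n * p\<bar> \<ge> d * n}"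
      by (auto simp: T_def)
    ultimately have "1 / 2 \<le> sum (bernoulli p n) T" using elim(1) by (simp add: sum_bernoulli)
    also have "\<dots> \<le> (\<Sum>x\<in>T. exp (- (n * (binary_entropy p - \<eta> / 2))))"
      by (intro sum_mono bernoulli_typical_bounds[OF p]) (use d in \<open>auto simp: T_def\<close>)
    also have "\<dots> = card T * exp (- (n * (binary_entropy p - \<eta> / 2)))" by simp
    finally have "exp (- (real n * (\<eta> / 2))) \<le> card T * exp (- (n * (binary_entropy p - \<eta> / 2)))"
      using elim(2) by linarith
    hence "exp (- (real n * (\<eta> / 2))) * exp (n * (binary_entropy p - \<eta> / 2)) \<le> card T"
      by (simp add: exp_minus field_simps)
    also have "exp (- (real n * (\<eta> / 2))) * exp (n * (binary_entropy p - \<eta> / 2)) = exp (n * (binary_entropy p - \<eta>))"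
      by (simp add: exp_add[symmetric] algebra_simps)
    finally have "exp (n * (binary_entropy p - \<eta>)) \<le> card T" .
    moreover have "card T \<le> card {x\<in>Pow {..<n}. \<bar>real (card x) - n * p\<bar> < d0 * n}"
    proof (rule card_mono)
      show "T \<subseteq> {x \<in> Pow {..<n}. \<bar>real (card x) - real n * p\<bar> < d0 * real n}"
        using mult_right_mono[OF d(2), of n] by (auto simp: T_def)
    qed simp
    ultimately show ?case by linarith
  qed
qed

subsection \<open>Protocols on many copies\<close>

text \<open>In the shell of total energy \<open>t\<close>, the vector \<open>f a\<close> tensored
  with the bath state \<open>c\<close> has only components with \<open>s\<close> equal to
  \<open>t - j c\<close>. The counting hypothesis says that the part of the shell over
  \<open>near\<close> has room for all these vectors, so \<open>unitary_on_compresses\<close>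
  applies shell by shell. The cutoff \<open>k\<close> leaves out components of low energy: they pair
  with high bath levels, whose degeneracy would demand too much room.\<close>

lemma unitary_on_shells:
  fixes s :: "'x \<Rightarrow> nat" and j :: "'b \<Rightarrow> nat" and f :: "'a \<Rightarrow> 'x \<Rightarrow> complex"
  assumes X: "finite X" and B: "finite B" and sn: "\<And>x. x \<in> X \<Longrightarrow> s x \<le> n"
    and A: "finite A" and good: "good \<subseteq> B" and near: "near \<subseteq> X"
    and count: "\<And>t. card A * card {c\<in>good. k + j c \<le> t \<and> t \<le> n + j c}
                 \<le> card {z\<in>near \<times> B. s (fst z) + j (snd z) = t}"
  shows "\<exists>W. unitary_on (X \<times> B) W \<and>
     (\<forall>z\<in>X \<times> B. \<forall>z'\<in>X \<times> B. s (fst z) + j (snd z) \<noteq> s (fst z') + j (snd z') \<longrightarrow> W z z' = 0) \<and>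
     (\<forall>a\<in>A. \<forall>c\<in>good. \<forall>x\<in>X - near. \<forall>b\<in>B. k + j c \<le> s x + j b \<longrightarrow>
        (\<Sum>y\<in>X. W (x, b) (y, c) * f a y) = 0)"
proof -
  define t where "t z = s (fst z) + j (snd z)" for z
  define J where "J \<tau> = {z\<in>X \<times> B. t z = \<tau>}" for \<tau>
  define G where "G \<tau> = {z\<in>near \<times> B. t z = \<tau>}" for \<tau>
  \<comment> \<open>Beyond \<open>n + j c\<close> the shell misses the vector altogether, since
    \<open>s\<close> is at most \<open>n\<close>.\<close>
  define I where "I \<tau> = A \<times> {c\<in>good. k + j c \<le> \<tau> \<and> \<tau> \<le> n + j c}" for \<tau>
  have fg: "finite good" using good B finite_subset by metis
  define P where "P \<tau> w \<longleftrightarrow> unitary_on (J \<tau>) w \<and>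
     (\<forall>a\<in>A. \<forall>c\<in>good. k + j c \<le> \<tau> \<longrightarrow> \<tau> \<le> n + j c \<longrightarrow>
        (\<forall>z\<in>J \<tau> - G \<tau>. kernel_apply (J \<tau>) w (\<lambda>z. of_bool (snd z = c) * f a (fst z)) z = 0))" for \<tau> w
  have "\<exists>w. P \<tau> w" for \<tau>
  proof -
    have "finite (I \<tau>)" using A fg by (simp add: I_def)
    then obtain e where e: "bij_betw e {0..<card (I \<tau>)} (I \<tau>)" using ex_bij_betw_nat_finite by blast
    have fJ: "finite (J \<tau>)" using X B by (simp add: J_def)
    have GJ: "G \<tau> \<subseteq> J \<tau>" using near by (auto simp: G_def J_def)
    have "card (I \<tau>) \<le> card (G \<tau>)"
      using count[of \<tau>] by (simp add: I_def G_def t_def card_cartesian_product)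
    from unitary_on_compresses[OF fJ GJ this, of "\<lambda>i z. of_bool (snd z = snd (e i)) * f (fst (e i)) (fst z)"]
    obtain w where w: "unitary_on (J \<tau>) w"
      "\<And>i z. i < card (I \<tau>) \<Longrightarrow> z \<in> J \<tau> - G \<tau> \<Longrightarrow>
        kernel_apply (J \<tau>) w (\<lambda>z. of_bool (snd z = snd (e i)) * f (fst (e i)) (fst z)) z = 0" by blast
    show ?thesis unfolding P_def
    proof (intro exI[of _ w] conjI w(1) ballI impI)
      fix a c z assume ac: "a \<in> A" "c \<in> good" "k + j c \<le> \<tau>" "\<tau> \<le> n + j c" and z: "z \<in> J \<tau> - G \<tau>"
      have "(a, c) \<in> I \<tau>" using ac by (simp add: I_def)
      then obtain i where "i < card (I \<tau>)" "e i = (a, c)"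
        using bij_betw_imp_surj_on[OF e] by (metis atLeastLessThan_iff imageE)
      then show "kernel_apply (J \<tau>) w (\<lambda>z. of_bool (snd z = c) * f a (fst z)) z = 0"
        using w(2)[of i z] z by simp
    qed
  qed
  then obtain w where w0: "\<And>\<tau>. P \<tau> (w \<tau>)" by metis
  have w: "\<And>\<tau>. unitary_on (J \<tau>) (w \<tau>)"
     "\<And>\<tau> a c z. a\<in>A \<Longrightarrow> c\<in>good \<Longrightarrow> k + j c \<le> \<tau> \<Longrightarrow> \<tau> \<le> n + j c \<Longrightarrow> z\<in>J \<tau> - G \<tau> \<Longrightarrow>
        kernel_apply (J \<tau>) (w \<tau>) (\<lambda>z. of_bool (snd z = c) * f a (fst z)) z = 0"
    using w0 unfolding P_def by blast+
  define W where "W z z' = (if t z = t z' then w (t z) z z' else 0)" for z z'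
  have "unitary_on (X \<times> B) W"
    unfolding W_def using X B w(1) by (intro unitary_on_direct_sum) (auto simp: J_def)
  moreover have "(\<Sum>y\<in>X. W (x, b) (y, c) * f a y) = 0"
    if that: "a \<in> A" "c \<in> good" "x \<in> X - near" "b \<in> B" "k + j c \<le> s x + j b" for a c x b
  proof -
    define \<tau> where "\<tau> = s x + j b"
    have zJ: "(x, b) \<in> J \<tau> - G \<tau>" using that by (auto simp: J_def G_def \<tau>_def t_def)
    have c: "c \<in> B" using that good by auto
    show ?thesis
    proof (cases "\<tau> \<le> n + j c")
      case False
      have "W (x, b) (y, c) = 0" if "y \<in> X" for y
        using sn[OF that] False by (simp add: W_def t_def \<tau>_def)
      then show ?thesis by simp
    next
      case True
      have "0 = kernel_apply (J \<tau>) (w \<tau>) (\<lambda>z. of_bool (snd z = c) * f a (fst z)) (x, b)"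
        using w(2)[of a c \<tau> "(x, b)"] that True zJ by (simp add: \<tau>_def)
      also have "\<dots> = (\<Sum>z\<in>J \<tau>. W (x, b) z * (of_bool (snd z = c) * f a (fst z)))"
        unfolding kernel_apply_def by (intro sum.cong refl) (auto simp: W_def J_def \<tau>_def t_def)
      also have "\<dots> = (\<Sum>z\<in>X \<times> B. W (x, b) z * (of_bool (snd z = c) * f a (fst z)))"
        by (intro sum.mono_neutral_left) (use X B in \<open>auto simp: J_def W_def t_def \<tau>_def\<close>)
      also have "\<dots> = (\<Sum>y\<in>X. \<Sum>b'\<in>B. of_bool (b' = c) * (W (x, b) (y, b') * f a y))"
        by (simp add: sum.cartesian_product split_def mult_ac)
      also have "\<dots> = (\<Sum>y\<in>X. W (x, b) (y, c) * f a y)" using B c by simp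
      finally show ?thesis by simp
    qed
  qed
  ultimately show ?thesis
    by (intro exI[of _ W] conjI) (auto simp: W_def t_def)
qed

text \<open>An output in a shell below \<open>k + j c\<close> can only come from strings with fewer
  than \<open>k\<close> quanta, and outputs in the other shells vanish outside \<open>near\<close>.
  The leak is thus bounded by the image of the truncated vector, whose norm the unitary
  preserves.\<close>

lemma unitary_on_shells_leakage:
  fixes s :: "'x \<Rightarrow> nat" and j :: "'b \<Rightarrow> nat" and f :: "'x \<Rightarrow> complex"
  assumes X: "finite X" and B: "finite B" and W: "unitary_on (X \<times> B) W" and near: "near \<subseteq> X"
    and cons: "\<And>z z'. z \<in> X \<times> B \<Longrightarrow> z' \<in> X \<times> B \<Longrightarrow>
       s (fst z) + j (snd z) \<noteq> s (fst z') + j (snd z') \<Longrightarrow> W z z' = 0"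
    and c: "c \<in> B"
    and zero: "\<And>x b. x \<in> X - near \<Longrightarrow> b \<in> B \<Longrightarrow> k + j c \<le> s x + j b \<Longrightarrow> (\<Sum>y\<in>X. W (x, b) (y, c) * f y) = 0"
  shows "(\<Sum>x\<in>X - near. \<Sum>b\<in>B. (cmod (\<Sum>y\<in>X. W (x, b) (y, c) * f y))\<^sup>2)
     \<le> (\<Sum>y\<in>{y\<in>X. s y < k}. (cmod (f y))\<^sup>2)"
proof -
  have fin: "finite (X \<times> B)" using X B by simp
  define g where "g z = of_bool (snd z = c) * of_bool (s (fst z) < k) * f (fst z)" for z
  have mg: "kernel_apply (X \<times> B) W g (x, b) = (\<Sum>y\<in>X. W (x, b) (y, c) * (of_bool (s y < k) * f y))" for x b
  proof -
    have "kernel_apply (X \<times> B) W g (x, b) =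
       (\<Sum>y\<in>X. \<Sum>b'\<in>B. of_bool (b' = c) * (W (x, b) (y, b') * (of_bool (s y < k) * f y)))"
      unfolding kernel_apply_def by (simp add: sum.cartesian_product split_def mult_ac g_def)
    then show ?thesis using B c by simp
  qed
  have le: "cmod (\<Sum>y\<in>X. W (x, b) (y, c) * f y) \<le> cmod (kernel_apply (X \<times> B) W g (x, b))"
    if x: "x \<in> X - near" and b: "b \<in> B" for x b
  proof (cases "k + j c \<le> s x + j b")
    case True
    then show ?thesis using zero[OF x b] by simp
  next
    case False
    have "W (x, b) (y, c) * f y = W (x, b) (y, c) * (of_bool (s y < k) * f y)" if "y \<in> X" for y
      using cons[of "(x, b)" "(y, c)"] False x b that c by auto
    then have "(\<Sum>y\<in>X. W (x, b) (y, c) * f y) = kernel_apply (X \<times> B) W g (x, b)"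
      unfolding mg by (rule sum.cong[OF refl])
    then show ?thesis by simp
  qed
  have "(\<Sum>x\<in>X - near. \<Sum>b\<in>B. (cmod (\<Sum>y\<in>X. W (x, b) (y, c) * f y))\<^sup>2)
     \<le> (\<Sum>x\<in>X - near. \<Sum>b\<in>B. (cmod (kernel_apply (X \<times> B) W g (x, b)))\<^sup>2)"
    by (intro sum_mono power_mono le) auto
  also have "\<dots> = (\<Sum>z\<in>(X - near) \<times> B. (cmod (kernel_apply (X \<times> B) W g z))\<^sup>2)"
    by (simp add: sum.cartesian_product)
  also have "\<dots> \<le> (\<Sum>z\<in>X \<times> B. (cmod (kernel_apply (X \<times> B) W g z))\<^sup>2)"
    using fin by (intro sum_mono2) auto
  also have "\<dots> = (\<Sum>z\<in>X \<times> B. (cmod (g z))\<^sup>2)" by (rule unitary_on_isometry[OF fin W])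
  also have "\<dots> = (\<Sum>y\<in>X. \<Sum>b\<in>B. if b = c then (if s y < k then (cmod (f y))\<^sup>2 else 0) else 0)"
    unfolding sum.cartesian_product by (intro sum.cong refl) (auto simp: g_def)
  also have "\<dots> = (\<Sum>y\<in>{y\<in>X. s y < k}. (cmod (f y))\<^sup>2)"
    using B X c by (simp add: sum.inter_filter)
  finally show ?thesis .
qed

section \<open>Products of identical qubit states and their eigenvectors\<close>

definition qubit_kernel :: "real \<Rightarrow> real \<Rightarrow> bool \<Rightarrow> bool \<Rightarrow> complex" where
  "qubit_kernel E c s s' = of_real (if s = s' then (1 + (if s then E else - E)) / 2 else c / 2)"

text \<open>Half-angle rotation: \<open>a = True\<close> labels the eigenvector of eigenvalue
  \<open>(1 + R) / 2\<close> of the state whose Bloch vector has length \<open>R\<close> and angle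
  \<open>\<phi>\<close> to the energy axis; \<open>s = True\<close> is the excited level.\<close>

definition qubit_eigenvector :: "real \<Rightarrow> bool \<Rightarrow> bool \<Rightarrow> real" where
  "qubit_eigenvector \<phi> s a = (if a then (if s then cos (\<phi>/2) else sin (\<phi>/2)) else (if s then - sin (\<phi>/2) else cos (\<phi>/2)))"

lemma qubit_kernel_eigen:
  "qubit_kernel (R * cos \<phi>) (R * sin \<phi>) s s' =
     of_real ((1 + R) / 2 * (qubit_eigenvector \<phi> s True * qubit_eigenvector \<phi> s' True) + (1 - R) / 2 * (qubit_eigenvector \<phi> s False * qubit_eigenvector \<phi> s' False))"
proof -
  define a b where "a = cos (\<phi>/2)" and "b = sin (\<phi>/2)"
  have c: "cos \<phi> = a * a - b * b" using cos_double[of "\<phi>/2"] by (simp add: a_def b_def power2_eq_square)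
  have s: "sin \<phi> = 2 * b * a" using sin_double[of "\<phi>/2"] by (simp add: a_def b_def)
  have ab: "a * a + b * b = 1" using sin_cos_squared_add[of "\<phi>/2"] by (simp add: a_def b_def power2_eq_square)
  show ?thesis unfolding qubit_kernel_def qubit_eigenvector_def of_real_eq_iff c s a_def[symmetric] b_def[symmetric]
    using ab by (cases s; cases s') (auto simp: field_simps)
qed

definition product_kernel :: "nat \<Rightarrow> real \<Rightarrow> real \<Rightarrow> nat set \<Rightarrow> nat set \<Rightarrow> complex" where
  "product_kernel n E c x x' = (\<Prod>i<n. qubit_kernel E c (i \<in> x) (i \<in> x'))"

definition product_eigenvector :: "nat \<Rightarrow> real \<Rightarrow> nat set \<Rightarrow> nat set \<Rightarrow> real" where
  "product_eigenvector n \<phi> a x = (\<Prod>i<n. qubit_eigenvector \<phi> (i \<in> x) (i \<in> a))"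

lemma product_kernel_eigen:
  "product_kernel n (R * cos \<phi>) (R * sin \<phi>) x x' =
     of_real (\<Sum>a\<in>Pow {..<n}. bernoulli ((1 + R) / 2) n a * (product_eigenvector n \<phi> a x * product_eigenvector n \<phi> a x'))"
proof -
  define f where "f i b = (if b then (1 + R) / 2 else 1 - (1 + R) / 2) * (qubit_eigenvector \<phi> (i \<in> x) b * qubit_eigenvector \<phi> (i \<in> x') b)" for i b
  have "product_kernel n (R * cos \<phi>) (R * sin \<phi>) x x' = of_real (\<Prod>i<n. f i True + f i False)"
    unfolding product_kernel_def qubit_kernel_eigen of_real_prod by (intro prod.cong refl arg_cong[of _ _ of_real]) (simp add: f_def field_simps)
  also have "(\<Prod>i<n. f i True + f i False) = (\<Sum>a\<in>Pow {..<n}. \<Prod>i<n. f i (i \<in> a))"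
    by (simp add: sum_Pow_prod)
  also have "\<dots> = (\<Sum>a\<in>Pow {..<n}. bernoulli ((1 + R) / 2) n a * (product_eigenvector n \<phi> a x * product_eigenvector n \<phi> a x'))"
    by (simp add: f_def bernoulli_def product_eigenvector_def prod.distrib)
  finally show ?thesis .
qed

text \<open>Populations in the energy basis do not see the coherence \<open>c\<close>. The energy
  statistics are thus those of a coin with bias \<open>(1 + E) / 2\<close>, while the eigenvalues
  follow a coin with bias \<open>(1 + R) / 2\<close>.\<close>

lemma product_kernel_diag: "product_kernel n E c x x = of_real (bernoulli ((1 + E) / 2) n x)"
  unfolding product_kernel_def bernoulli_def of_real_prod by (intro prod.cong) (auto simp: qubit_kernel_def field_simps)

lemma product_eigenvector_norm: "(\<Sum>x\<in>Pow {..<n}. (product_eigenvector n \<phi> a x)\<^sup>2) = 1"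
proof -
  have "(\<Sum>x\<in>Pow {..<n}. (product_eigenvector n \<phi> a x)\<^sup>2) = (\<Sum>x\<in>Pow {..<n}. \<Prod>i<n. (qubit_eigenvector \<phi> (i \<in> x) (i \<in> a))\<^sup>2)"
    by (simp add: product_eigenvector_def prod_power_distrib)
  also have "\<dots> = (\<Prod>i<n. (qubit_eigenvector \<phi> True (i \<in> a))\<^sup>2 + (qubit_eigenvector \<phi> False (i \<in> a))\<^sup>2)"
    by (rule sum_Pow_prod) simp
  also have "\<dots> = 1" by (intro prod.neutral) (auto simp: qubit_eigenvector_def)
  finally show ?thesis .
qed

text \<open>A bath whose degeneracies grow like the inverse Boltzmann factor, so that its Gibbs state is
  nearly uniform over the \<open>N + 1\<close> levels.\<close>

definition bath_degeneracy :: "real \<Rightarrow> nat \<Rightarrow> nat" where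
  "bath_degeneracy \<beta> i = nat \<lceil>exp (2 * \<beta> * i)\<rceil>"

definition bath :: "real \<Rightarrow> nat \<Rightarrow> (nat \<times> nat) set" where
  "bath \<beta> N = (SIGMA i:{..N}. {..<bath_degeneracy \<beta> i})"

definition bath_weight :: "real \<Rightarrow> nat \<Rightarrow> nat \<times> nat \<Rightarrow> real" where
  "bath_weight \<beta> N b = exp (- (\<beta> * (2 * real (fst b)))) / (\<Sum>b\<in>bath \<beta> N. exp (- (\<beta> * (2 * real (fst b)))))"

lemma bath_degeneracy_bounds:
  assumes "\<beta> > 0"
  shows "exp (2 * \<beta> * i) \<le> bath_degeneracy \<beta> i" "bath_degeneracy \<beta> i \<le> 2 * exp (2 * \<beta> * i)"
proof -
  have "exp (2 * \<beta> * i) \<ge> 1" using assms by simp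
  then show "exp (2 * \<beta> * i) \<le> bath_degeneracy \<beta> i" "bath_degeneracy \<beta> i \<le> 2 * exp (2 * \<beta> * i)"
    unfolding bath_degeneracy_def by linarith+
qed

lemma finite_bath [simp]: "finite (bath \<beta> N)" by (simp add: bath_def)

lemma sum_bath: "(\<Sum>b\<in>bath \<beta> N. h (fst b)) = (\<Sum>i\<le>N. bath_degeneracy \<beta> i * (h i :: real))"
  unfolding bath_def by (subst sum.Sigma[symmetric, where g = "\<lambda>i l. h i", unfolded split_def]) simp_all

text \<open>Rounding the degeneracy up costs at most a factor 2, which is all that separates the
  unnormalised level weights from being exactly uniform.\<close>

lemma bath_level_weight:
  assumes "\<beta> > 0"
  shows "1 \<le> bath_degeneracy \<beta> i * exp (- (\<beta> * (2 * real i)))" "bath_degeneracy \<beta> i * exp (- (\<beta> * (2 * real i))) \<le> 2"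
proof -
  have "exp (2 * \<beta> * i) * exp (- (\<beta> * (2 * real i))) = 1" by (simp add: exp_add[symmetric])
  hence "2 * exp (2 * \<beta> * i) * exp (- (\<beta> * (2 * real i))) = 2" "exp (2 * \<beta> * i) * exp (- (\<beta> * (2 * real i))) = 1" by simp_all
  then show "1 \<le> bath_degeneracy \<beta> i * exp (- (\<beta> * (2 * real i)))" "bath_degeneracy \<beta> i * exp (- (\<beta> * (2 * real i))) \<le> 2"
    using mult_right_mono[OF bath_degeneracy_bounds(1)[OF assms, of i] exp_ge_zero[of "- (\<beta> * (2 * real i))"]]
      mult_right_mono[OF bath_degeneracy_bounds(2)[OF assms, of i] exp_ge_zero[of "- (\<beta> * (2 * real i))"]] by linarith+
qed

lemma bath_partition_ge:
  assumes "\<beta> > 0" shows "(\<Sum>b\<in>bath \<beta> N. exp (- (\<beta> * (2 * real (fst b))))) \<ge> N + 1"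
proof -
  have "(\<Sum>b\<in>bath \<beta> N. exp (- (\<beta> * (2 * real (fst b))))) = (\<Sum>i\<le>N. bath_degeneracy \<beta> i * exp (- (\<beta> * (2 * real i))))"
    by (rule sum_bath)
  also have "\<dots> \<ge> (\<Sum>i\<le>N. 1)" by (intro sum_mono bath_level_weight assms)
  finally show ?thesis by simp
qed

lemma bath_weight_nonneg: "bath_weight \<beta> N b \<ge> 0"
  unfolding bath_weight_def by (intro divide_nonneg_nonneg sum_nonneg) auto

lemma sum_bath_weight: "\<beta> > 0 \<Longrightarrow> (\<Sum>b\<in>bath \<beta> N. bath_weight \<beta> N b) = 1"
  unfolding bath_weight_def sum_divide_distrib[symmetric] using bath_partition_ge[of \<beta> N] by simp

text \<open>Exchanging up to \<open>n\<close> quanta with the string must not run off either end of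
  the ladder. The \<open>2 * n\<close> levels near the ends weigh at most 2 each, against a
  partition sum of at least \<open>N + 1\<close>.\<close>

lemma bath_boundary_weight:
  fixes n N :: nat
  assumes b: "\<beta> > 0" and N: "N \<ge> 2 * n"
  shows "(\<Sum>b\<in>{b\<in>bath \<beta> N. \<not> (n \<le> fst b \<and> fst b \<le> N - n)}. bath_weight \<beta> N b) \<le> 4 * n / (N + 1)"
proof -
  define h where "h i = of_bool (\<not> (n \<le> i \<and> i \<le> N - n)) * exp (- (\<beta> * (2 * real i)))" for i
  have "(\<Sum>b\<in>{b\<in>bath \<beta> N. \<not> (n \<le> fst b \<and> fst b \<le> N - n)}. exp (- (\<beta> * (2 * real (fst b))))) = (\<Sum>b\<in>bath \<beta> N. h (fst b))"
    by (subst sum.inter_filter, simp) (rule sum.cong[OF refl], simp add: h_def)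
  also have "\<dots> = (\<Sum>i\<le>N. bath_degeneracy \<beta> i * h i)" by (rule sum_bath)
  also have "\<dots> = (\<Sum>i\<in>{i\<in>{..N}. \<not> (n \<le> i \<and> i \<le> N - n)}. bath_degeneracy \<beta> i * exp (- (\<beta> * (2 * real i))))"
    by (subst sum.inter_filter, simp) (rule sum.cong[OF refl], simp add: h_def)
  also have "\<dots> \<le> (\<Sum>i\<in>{i\<in>{..N}. \<not> (n \<le> i \<and> i \<le> N - n)}. 2)"
    by (intro sum_mono bath_level_weight b)
  also have "\<dots> = 2 * card {i\<in>{..N}. \<not> (n \<le> i \<and> i \<le> N - n)}" by simp
  also have "card {i\<in>{..N}. \<not> (n \<le> i \<and> i \<le> N - n)} \<le> card ({..<n} \<union> {N - n<..N})"
    by (intro card_mono) auto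
  also have "\<dots> \<le> card {..<n} + card {N - n<..N}" by (rule card_Un_le)
  also have "\<dots> = 2 * n" using N by simp
  finally have 1: "(\<Sum>b\<in>{b\<in>bath \<beta> N. \<not> (n \<le> fst b \<and> fst b \<le> N - n)}. exp (- (\<beta> * (2 * real (fst b))))) \<le> 4 * n" by simp
  have Z: "(\<Sum>b\<in>bath \<beta> N. exp (- (\<beta> * (2 * real (fst b))))) \<ge> N + 1" by (rule bath_partition_ge[OF b])
  show ?thesis unfolding bath_weight_def sum_divide_distrib[symmetric]
    using 1 Z by (intro frac_le) auto
qed

text \<open>On the left at most \<open>n + 1\<close> bath levels occur, each with at most
  \<open>2 * exp (2 * \<beta> * (t - k))\<close> states; on the right each string of
  \<open>near\<close> leaves at least \<open>exp (2 * \<beta> * (t - K))\<close> bath states. The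
  shell energy \<open>t\<close> cancels, and only the factor
  \<open>exp (2 * \<beta> * (K - k))\<close> and a polynomial remain.\<close>

lemma bath_shell_count:
  fixes n N k t :: nat and K \<beta> :: real
  assumes b: "\<beta> > 0" and A: "real (card A) * (2 * (n + 1)) * exp (2 * \<beta> * (K - k)) \<le> card near"
    and near: "near \<subseteq> X" "finite X" "\<And>x. x \<in> X \<Longrightarrow> s x \<le> n" "\<And>x. x \<in> near \<Longrightarrow> real (s x) \<le> K"
    and N: "N \<ge> 2 * n"
  shows "card A * card {c\<in>{b\<in>bath \<beta> N. n \<le> fst b \<and> fst b \<le> N - n}. k + fst c \<le> t \<and> t \<le> n + fst c}
     \<le> card {z\<in>near \<times> bath \<beta> N. s (fst z) + fst (snd z) = t}"
proof (cases "\<exists>c\<in>{b\<in>bath \<beta> N. n \<le> fst b \<and> fst b \<le> N - n}. k + fst c \<le> t \<and> t \<le> n + fst c")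
  case False
  hence "{c\<in>{b\<in>bath \<beta> N. n \<le> fst b \<and> fst b \<le> N - n}. k + fst c \<le> t \<and> t \<le> n + fst c} = {}" by blast
  then show ?thesis by (simp only: card.empty)
next
  case True
  hence t: "n \<le> t" "t \<le> N" "k \<le> t" using N by auto
  define C where "C = card {c\<in>{b\<in>bath \<beta> N. n \<le> fst b \<and> fst b \<le> N - n}. k + fst c \<le> t \<and> t \<le> n + fst c}"
  have fn: "finite near" using near finite_subset by metis
  have "C
     \<le> card (SIGMA i:{t - n..t - k}. {..<bath_degeneracy \<beta> i})"
    unfolding C_def by (intro card_mono) (auto simp: bath_def)
  also have "\<dots> = (\<Sum>i\<in>{t - n..t - k}. bath_degeneracy \<beta> i)" by simp
  finally have "C
     \<le> (\<Sum>i\<in>{t - n..t - k}. real (bath_degeneracy \<beta> i))" unfolding of_nat_sum[symmetric] of_nat_le_iff .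
  also have "\<dots> \<le> (\<Sum>i\<in>{t - n..t - k}. 2 * exp (2 * \<beta> * (real t - k)))"
  proof (rule sum_mono)
    fix i assume "i \<in> {t - n..t - k}"
    hence "real i \<le> real t - k" using t by auto
    hence "exp (2 * \<beta> * i) \<le> exp (2 * \<beta> * (real t - k))" using b by simp
    then show "bath_degeneracy \<beta> i \<le> 2 * exp (2 * \<beta> * (real t - k))"
      using bath_degeneracy_bounds(2)[OF b, of i] by linarith
  qed
  also have "\<dots> = card {t - n..t - k} * (2 * exp (2 * \<beta> * (real t - k)))" by simp
  also have "\<dots> \<le> (n + 1) * (2 * exp (2 * \<beta> * (real t - k)))"
    by (intro mult_right_mono) auto
  finally have 1: "C
     \<le> 2 * (n + 1) * exp (2 * \<beta> * (real t - k))" by (simp add: algebra_simps)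
  have ex: "exp (2 * \<beta> * (real t - k)) = exp (2 * \<beta> * (K - k)) * exp (2 * \<beta> * (real t - K))"
    unfolding exp_add[symmetric] by (simp add: algebra_simps)
  have "real (card A) * real C \<le> card A * (2 * (n + 1) * exp (2 * \<beta> * (real t - k)))"
    by (rule mult_left_mono[OF 1]) simp
  also have "\<dots> = (real (card A) * (2 * (n + 1)) * exp (2 * \<beta> * (K - k))) * exp (2 * \<beta> * (real t - K))"
    unfolding ex by (simp only: of_nat_mult mult.assoc)
  also have "\<dots> \<le> card near * exp (2 * \<beta> * (real t - K))"
    by (rule mult_right_mono[OF A]) simp
  also have "\<dots> = (\<Sum>x\<in>near. exp (2 * \<beta> * (real t - K)))" by simp
  also have "\<dots> \<le> (\<Sum>x\<in>near. real (bath_degeneracy \<beta> (t - s x)))"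
  proof (rule sum_mono)
    fix x assume x: "x \<in> near"
    have "s x \<le> t" using near(1,3) x t by (meson le_trans subsetD)
    hence "real t - K \<le> real (t - s x)" using near(4)[OF x] by simp
    hence "exp (2 * \<beta> * (real t - K)) \<le> exp (2 * \<beta> * real (t - s x))" using b by simp
    then show "exp (2 * \<beta> * (real t - K)) \<le> bath_degeneracy \<beta> (t - s x)"
      using bath_degeneracy_bounds(1)[OF b, of "t - s x"] by linarith
  qed
  also have "\<dots> = card (SIGMA x:near. {..<bath_degeneracy \<beta> (t - s x)})" using fn by simp
  also have "\<dots> \<le> card {z\<in>near \<times> bath \<beta> N. s (fst z) + fst (snd z) = t}"
  proof -
    define h where "h = (\<lambda>(x, l). (x, (t - s x, l :: nat)))"
    have "h ` (SIGMA x:near. {..<bath_degeneracy \<beta> (t - s x)}) \<subseteq> {z\<in>near \<times> bath \<beta> N. s (fst z) + fst (snd z) = t}"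
    proof -
      have "s x \<le> t" if "x \<in> near" for x using near(1,3) that t by (meson le_trans subsetD)
      then show ?thesis using t by (auto simp: h_def bath_def)
    qed
    moreover have "inj_on h (SIGMA x:near. {..<bath_degeneracy \<beta> (t - s x)})" by (auto simp: h_def inj_on_def)
    ultimately have "card (SIGMA x:near. {..<bath_degeneracy \<beta> (t - s x)}) \<le> card {z\<in>near \<times> bath \<beta> N. s (fst z) + fst (snd z) = t}"
      using fn by (intro card_inj_on_le[of h]) auto
    then show ?thesis by simp
  qed
  finally show ?thesis unfolding C_def[symmetric] by (simp only: of_nat_mult[symmetric] of_nat_le_iff)
qed

section \<open>The string after the n-copy protocol, bath traced out\<close>

definition nfinal :: "real \<Rightarrow> nat \<Rightarrow> nat \<Rightarrow> real \<Rightarrow> real \<Rightarrow> (nat set \<times> (nat \<times> nat) \<Rightarrow> nat set \<times> (nat \<times> nat) \<Rightarrow> complex)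
    \<Rightarrow> nat set \<Rightarrow> nat set \<Rightarrow> complex" where
  "nfinal \<beta> N n E c W x x' = (\<Sum>b\<in>bath \<beta> N. \<Sum>d\<in>bath \<beta> N. \<Sum>y\<in>Pow {..<n}. \<Sum>y'\<in>Pow {..<n}.
     W (x, b) (y, d) * (product_kernel n E c y y' * of_real (bath_weight \<beta> N d)) * cnj (W (x', b) (y', d)))"

lemma sum_rotate:
  "(\<Sum>y\<in>Y. \<Sum>z\<in>Z. \<Sum>a\<in>A. f y z a) = (\<Sum>a\<in>A. \<Sum>y\<in>Y. \<Sum>z\<in>Z. f y z a)"
proof -
  have "(\<Sum>y\<in>Y. \<Sum>z\<in>Z. \<Sum>a\<in>A. f y z a) = (\<Sum>y\<in>Y. \<Sum>a\<in>A. \<Sum>z\<in>Z. f y z a)"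
    by (intro sum.cong[OF refl] sum.swap)
  then show ?thesis by (simp only: sum.swap[of _ A Y])
qed

text \<open>Diagonalising the input turns output populations into a classical mixture, over
  eigenvectors \<open>a\<close> and bath states \<open>d\<close>, of the probabilities that this
  pair ends in the string \<open>x\<close>. Positivity and the leakage bounds are read off from this
  form.\<close>

lemma nfinal_diag:
  "nfinal \<beta> N n (R * cos \<phi>) (R * sin \<phi>) W x x =
   of_real (\<Sum>a\<in>Pow {..<n}. \<Sum>d\<in>bath \<beta> N. bernoulli ((1 + R) / 2) n a * bath_weight \<beta> N d *
      (\<Sum>b\<in>bath \<beta> N. (cmod (\<Sum>y\<in>Pow {..<n}. W (x, b) (y, d) * of_real (product_eigenvector n \<phi> a y)))\<^sup>2))"
proof -
  define X where "X = Pow {..<n}"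
  define l where "l a = complex_of_real (bernoulli ((1 + R) / 2) n a)" for a
  define f where "f a y = complex_of_real (product_eigenvector n \<phi> a y)" for a y
  define g where "g d = complex_of_real (bath_weight \<beta> N d)" for d
  have "nfinal \<beta> N n (R * cos \<phi>) (R * sin \<phi>) W x x =
    (\<Sum>b\<in>bath \<beta> N. \<Sum>d\<in>bath \<beta> N. \<Sum>y\<in>X. \<Sum>y'\<in>X.
     W (x, b) (y, d) * ((\<Sum>a\<in>X. l a * (f a y * f a y')) * g d) * cnj (W (x, b) (y', d)))"
    unfolding nfinal_def product_kernel_eigen X_def l_def f_def g_def by simp
  also have "\<dots> = (\<Sum>b\<in>bath \<beta> N. \<Sum>d\<in>bath \<beta> N. \<Sum>y\<in>X. \<Sum>y'\<in>X. \<Sum>a\<in>X.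
     l a * g d * ((W (x, b) (y, d) * f a y) * cnj (W (x, b) (y', d) * f a y')))"
    by (intro sum.cong refl) (simp add: sum_distrib_left sum_distrib_right f_def mult_ac)
  also have "\<dots> = (\<Sum>b\<in>bath \<beta> N. \<Sum>d\<in>bath \<beta> N. \<Sum>a\<in>X. \<Sum>y\<in>X. \<Sum>y'\<in>X.
     l a * g d * ((W (x, b) (y, d) * f a y) * cnj (W (x, b) (y', d) * f a y')))"
    by (intro sum.cong[OF refl] sum_rotate)
  also have "\<dots> = (\<Sum>b\<in>bath \<beta> N. \<Sum>d\<in>bath \<beta> N. \<Sum>a\<in>X. l a * g d *
     of_real ((cmod (\<Sum>y\<in>X. W (x, b) (y, d) * f a y))\<^sup>2))"
  proof (intro sum.cong refl)
    fix b d a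
    have "(\<Sum>y\<in>X. \<Sum>y'\<in>X. l a * g d * ((W (x, b) (y, d) * f a y) * cnj (W (x, b) (y', d) * f a y')))
       = l a * g d * ((\<Sum>y\<in>X. W (x, b) (y, d) * f a y) * cnj (\<Sum>y\<in>X. W (x, b) (y, d) * f a y))"
      unfolding cnj_sum sum_product by (simp only: sum_distrib_left)
    then show "(\<Sum>y\<in>X. \<Sum>y'\<in>X. l a * g d * ((W (x, b) (y, d) * f a y) * cnj (W (x, b) (y', d) * f a y')))
       = l a * g d * of_real ((cmod (\<Sum>y\<in>X. W (x, b) (y, d) * f a y))\<^sup>2)"
      by (simp only: of_real_cmod_power2 mult.commute)
  qed
  also have "\<dots> = (\<Sum>b\<in>bath \<beta> N. \<Sum>a\<in>X. \<Sum>d\<in>bath \<beta> N. l a * g d *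
     of_real ((cmod (\<Sum>y\<in>X. W (x, b) (y, d) * f a y))\<^sup>2))"
    by (intro sum.cong refl sum.swap)
  also have "\<dots> = (\<Sum>a\<in>X. \<Sum>b\<in>bath \<beta> N. \<Sum>d\<in>bath \<beta> N. l a * g d *
     of_real ((cmod (\<Sum>y\<in>X. W (x, b) (y, d) * f a y))\<^sup>2))"
    by (rule sum.swap)
  also have "\<dots> = (\<Sum>a\<in>X. \<Sum>d\<in>bath \<beta> N. \<Sum>b\<in>bath \<beta> N. l a * g d *
     of_real ((cmod (\<Sum>y\<in>X. W (x, b) (y, d) * f a y))\<^sup>2))"
    by (intro sum.cong refl sum.swap)
  finally show ?thesis
    unfolding X_def l_def f_def g_def by (simp add: sum_distrib_left)
qed

lemma kernel_apply_times:
  assumes "finite X" "finite B" "d \<in> B"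
  shows "kernel_apply (X \<times> B) W (\<lambda>z. of_bool (snd z = d) * f (fst z)) (x, b) = (\<Sum>y\<in>X. W (x, b) (y, d) * f y)"
proof -
  have "kernel_apply (X \<times> B) W (\<lambda>z. of_bool (snd z = d) * f (fst z)) (x, b) =
     (\<Sum>y\<in>X. \<Sum>b'\<in>B. of_bool (b' = d) * (W (x, b) (y, b') * f y))"
    unfolding kernel_apply_def by (simp add: sum.cartesian_product split_def mult_ac)
  then show ?thesis using assms by simp
qed

lemma unitary_on_times_isometry:
  assumes X: "finite X" and B: "finite B" and d: "d \<in> B" and W: "unitary_on (X \<times> B) W"
  shows "(\<Sum>x\<in>X. \<Sum>b\<in>B. (cmod (\<Sum>y\<in>X. W (x, b) (y, d) * f y))\<^sup>2) = (\<Sum>y\<in>X. (cmod (f y))\<^sup>2)"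
proof -
  have fin: "finite (X \<times> B)" using X B by simp
  define g where "g = (\<lambda>z :: 'a \<times> 'b. of_bool (snd z = d) * f (fst z))"
  have "(\<Sum>x\<in>X. \<Sum>b\<in>B. (cmod (\<Sum>y\<in>X. W (x, b) (y, d) * f y))\<^sup>2) = (\<Sum>z\<in>X \<times> B. (cmod (kernel_apply (X \<times> B) W g z))\<^sup>2)"
    unfolding g_def by (simp add: sum.cartesian_product split_def kernel_apply_times[OF X B d, symmetric])
  also have "\<dots> = (\<Sum>z\<in>X \<times> B. (cmod (g z))\<^sup>2)" by (rule unitary_on_isometry[OF fin W])
  also have "\<dots> = (\<Sum>y\<in>X. \<Sum>b\<in>B. if b = d then (cmod (f y))\<^sup>2 else 0)"
    unfolding sum.cartesian_product by (intro sum.cong refl) (auto simp: g_def)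
  also have "\<dots> = (\<Sum>y\<in>X. (cmod (f y))\<^sup>2)" using B d by simp
  finally show ?thesis .
qed

lemma sum_weights_bound:
  fixes p :: "'a \<Rightarrow> real" and h :: "'a \<Rightarrow> real"
  assumes "finite X" "A \<subseteq> X" "\<And>x. x \<in> X \<Longrightarrow> p x \<ge> 0" "sum p X = 1" "sum p (X - A) \<le> e"
    "\<And>x. x \<in> A \<Longrightarrow> h x \<le> u" "\<And>x. x \<in> X - A \<Longrightarrow> h x \<le> v" "u \<ge> 0" "v \<ge> 0"
  shows "(\<Sum>x\<in>X. p x * h x) \<le> u + v * e"
proof -
  have "(\<Sum>x\<in>X. p x * h x) = (\<Sum>x\<in>X - A. p x * h x) + (\<Sum>x\<in>A. p x * h x)"
    using assms by (intro sum.subset_diff) auto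
  also have "\<dots> \<le> (\<Sum>x\<in>X - A. p x * v) + (\<Sum>x\<in>A. p x * u)"
    using assms by (intro add_mono sum_mono mult_left_mono) auto
  also have "\<dots> = sum p (X - A) * v + sum p A * u" by (simp add: sum_distrib_right)
  also have "\<dots> \<le> e * v + 1 * u"
  proof -
    have "sum p A \<le> sum p X" using assms by (intro sum_mono2) auto
    then show ?thesis using assms by (intro add_mono mult_right_mono) auto
  qed
  finally show ?thesis by (simp add: mult.commute)
qed

text \<open>Weight outside \<open>near\<close> has three sources, one per error: \<open>e1\<close>
  for bath states near the ends of the ladder, \<open>e2\<close> for atypical eigenvectors outside
  \<open>A\<close>, and \<open>e3\<close> for the components of low energy cut off at
  \<open>k\<close>.\<close>

lemma nfinal_concentration:
  fixes n N k :: nat and \<beta> K :: real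
  assumes b: "\<beta> > 0" and R: "0 \<le> R" "R \<le> 1" and A: "A \<subseteq> Pow {..<n}" and near: "near \<subseteq> Pow {..<n}"
    and count: "real (card A) * (2 * (n + 1)) * exp (2 * \<beta> * (K - k)) \<le> card near"
    and K: "\<And>x. x \<in> near \<Longrightarrow> real (card x) \<le> K"
    and N: "N \<ge> 2 * n" and Ne: "4 * n / (N + 1) \<le> e1"
    and Ae: "(\<Sum>a\<in>Pow {..<n} - A. bernoulli ((1 + R) / 2) n a) \<le> e2"
    and ke: "(\<Sum>x\<in>{x\<in>Pow {..<n}. card x < k}. bernoulli ((1 + R * cos \<phi>) / 2) n x) \<le> e3"
  obtains W where "unitary_on (Pow {..<n} \<times> bath \<beta> N) W"
    "\<And>z z'. z \<in> Pow {..<n} \<times> bath \<beta> N \<Longrightarrow> z' \<in> Pow {..<n} \<times> bath \<beta> N \<Longrightarrow>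
       card (fst z) + fst (snd z) \<noteq> card (fst z') + fst (snd z') \<Longrightarrow> W z z' = 0"
    "\<And>x. Re (nfinal \<beta> N n (R * cos \<phi>) (R * sin \<phi>) W x x) \<ge> 0"
    "(\<Sum>x\<in>Pow {..<n}. Re (nfinal \<beta> N n (R * cos \<phi>) (R * sin \<phi>) W x x)) = 1"
    "(\<Sum>x\<in>Pow {..<n} - near. Re (nfinal \<beta> N n (R * cos \<phi>) (R * sin \<phi>) W x x)) \<le> e1 + e2 + e3"
proof -
  define X where "X = Pow {..<n}"
  define B where "B = bath \<beta> N"
  define good where "good = {b\<in>B. n \<le> fst b \<and> fst b \<le> N - n}"
  define l where "l = bernoulli ((1 + R) / 2) n"
  define g where "g = bath_weight \<beta> N"
  define f where "f a y = complex_of_real (product_eigenvector n \<phi> a y)" for a y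
  have X: "finite X" and B: "finite B" and fA: "finite A" and AX: "A \<subseteq> X"
    using A finite_subset by (auto simp: X_def B_def)
  have l0: "l a \<ge> 0" for a unfolding l_def using R by (intro bernoulli_nonneg) auto
  have g0: "g d \<ge> 0" for d unfolding g_def by (rule bath_weight_nonneg)
  have l1: "sum l X = 1" unfolding l_def X_def by (rule sum_bernoulli)
  have g1: "sum g B = 1" unfolding g_def B_def by (rule sum_bath_weight[OF b])
  have cn: "card x \<le> n" if "x \<in> X" for x
    using card_mono[of "{..<n}" x] that by (auto simp: X_def)
  have count': "card A * card {c\<in>good. k + fst c \<le> t \<and> t \<le> n + fst c}
       \<le> card {z\<in>near \<times> B. card (fst z) + fst (snd z) = t}" for t
    unfolding good_def B_def
    by (rule bath_shell_count[OF b count near _ _ K N]) (use X cn in \<open>auto simp: X_def\<close>)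
  have goodB: "good \<subseteq> B" by (auto simp: good_def)
  have nearX: "near \<subseteq> X" using near by (simp add: X_def)
  from unitary_on_shells[OF X B cn fA goodB nearX count', of f]
  obtain W where W: "unitary_on (X \<times> B) W"
    and cons: "\<And>z z'. z \<in> X \<times> B \<Longrightarrow> z' \<in> X \<times> B \<Longrightarrow> card (fst z) + fst (snd z) \<noteq> card (fst z') + fst (snd z') \<Longrightarrow> W z z' = 0"
    and zero: "\<And>a c x b. a\<in>A \<Longrightarrow> c\<in>good \<Longrightarrow> x\<in>X - near \<Longrightarrow> b\<in>B \<Longrightarrow> k + fst c \<le> card x + fst b \<Longrightarrow>
        (\<Sum>y\<in>X. W (x, b) (y, c) * f a y) = 0"
    by blast
  define q where "q a d x = (\<Sum>b\<in>B. (cmod (\<Sum>y\<in>X. W (x, b) (y, d) * f a y))\<^sup>2)" for a d x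
  define P where "P x = Re (nfinal \<beta> N n (R * cos \<phi>) (R * sin \<phi>) W x x)" for x
  have Pq: "P x = (\<Sum>a\<in>X. \<Sum>d\<in>B. l a * g d * q a d x)" for x
    unfolding P_def nfinal_diag Re_complex_of_real q_def l_def g_def f_def X_def B_def ..
  have q0: "q a d x \<ge> 0" for a d x unfolding q_def by (intro sum_nonneg) auto
  have norm: "(\<Sum>y\<in>X. (cmod (f a y))\<^sup>2) = 1" for a
    using product_eigenvector_norm[of n \<phi> a] by (simp add: f_def X_def)
  have q1: "(\<Sum>x\<in>X. q a d x) = 1" if "d \<in> B" for a d
    unfolding q_def unitary_on_times_isometry[OF X B that W] by (rule norm)
  have P0: "P x \<ge> 0" for x
    unfolding Pq by (intro sum_nonneg mult_nonneg_nonneg l0 g0 q0)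
  have sumP: "(\<Sum>x\<in>Y. P x) = (\<Sum>a\<in>X. \<Sum>d\<in>B. l a * g d * (\<Sum>x\<in>Y. q a d x))" for Y
  proof -
    have "(\<Sum>x\<in>Y. P x) = (\<Sum>a\<in>X. \<Sum>x\<in>Y. \<Sum>d\<in>B. l a * g d * q a d x)"
      unfolding Pq by (rule sum.swap)
    also have "\<dots> = (\<Sum>a\<in>X. \<Sum>d\<in>B. \<Sum>x\<in>Y. l a * g d * q a d x)"
      by (intro sum.cong refl sum.swap)
    finally show ?thesis by (simp add: sum_distrib_left)
  qed
  have P1: "(\<Sum>x\<in>X. P x) = 1"
    unfolding sumP by (simp add: q1 sum_distrib_left[symmetric] g1 l1)
  have lead: "(\<Sum>x\<in>X - near. q a d x) \<le> of_bool (a \<notin> A) + of_bool (d \<notin> good) +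
       (\<Sum>y\<in>{y\<in>X. card y < k}. (cmod (f a y))\<^sup>2)" if a: "a \<in> X" and d: "d \<in> B" for a d
  proof (cases "a \<in> A \<and> d \<in> good")
    case True
    then show ?thesis unfolding q_def
      using unitary_on_shells_leakage[OF X B W nearX cons d, where f = "f a" and k = k] zero by simp
  next
    case False
    have "(\<Sum>x\<in>X - near. q a d x) \<le> (\<Sum>x\<in>X. q a d x)"
      using X q0 by (intro sum_mono2) auto
    also have "\<dots> = 1" by (rule q1[OF d])
    also have "1 \<le> of_bool (a \<notin> A) + of_bool (d \<notin> good) + (\<Sum>y\<in>{y\<in>X. card y < k}. (cmod (f a y))\<^sup>2)"
    proof -
      have "(\<Sum>y\<in>{y\<in>X. card y < k}. (cmod (f a y))\<^sup>2) \<ge> 0" by (intro sum_nonneg) auto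
      then show ?thesis using False by auto
    qed
    finally show ?thesis .
  qed
  have "(\<Sum>x\<in>X - near. P x) \<le> (\<Sum>a\<in>X. \<Sum>d\<in>B. l a * g d * (of_bool (a \<notin> A) + of_bool (d \<notin> good) +
       (\<Sum>y\<in>{y\<in>X. card y < k}. (cmod (f a y))\<^sup>2)))"
    unfolding sumP by (intro sum_mono mult_left_mono lead mult_nonneg_nonneg l0 g0)
  also have "\<dots> = (\<Sum>a\<in>X. l a * of_bool (a \<notin> A)) + (\<Sum>d\<in>B. g d * of_bool (d \<notin> good)) +
       (\<Sum>a\<in>X. l a * (\<Sum>y\<in>{y\<in>X. card y < k}. (cmod (f a y))\<^sup>2))"
  proof -
    have "(\<Sum>a\<in>X. \<Sum>d\<in>B. l a * g d * (u a + v d + w a)) =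
       (\<Sum>a\<in>X. l a * u a) + (\<Sum>d\<in>B. g d * v d) + (\<Sum>a\<in>X. l a * w a)" for u v w :: "_ \<Rightarrow> real"
    proof -
      have "(\<Sum>a\<in>X. \<Sum>d\<in>B. l a * g d * (u a + v d + w a)) =
        (\<Sum>a\<in>X. l a * u a * sum g B + l a * (\<Sum>d\<in>B. g d * v d) + l a * w a * sum g B)"
        unfolding sum_distrib_left sum.distrib[symmetric] by (intro sum.cong refl) (simp add: algebra_simps)
      also have "\<dots> = (\<Sum>a\<in>X. l a * u a) + sum l X * (\<Sum>d\<in>B. g d * v d) + (\<Sum>a\<in>X. l a * w a)"
        by (simp add: g1 sum.distrib sum_distrib_right)
      finally show ?thesis by (simp add: l1)
    qed
    then show ?thesis .
  qed
  also have "(\<Sum>a\<in>X. l a * of_bool (a \<notin> A)) = (\<Sum>a\<in>X - A. l a)"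
    by (rule sum.mono_neutral_cong_right) (use X in auto)
  also have "\<dots> \<le> e2" using Ae by (simp add: X_def l_def)
  also have "(\<Sum>d\<in>B. g d * of_bool (d \<notin> good)) = (\<Sum>d\<in>{b\<in>B. \<not> (n \<le> fst b \<and> fst b \<le> N - n)}. g d)"
    by (rule sum.mono_neutral_cong_right) (use B in \<open>auto simp: good_def\<close>)
  also have "\<dots> \<le> e1" using bath_boundary_weight[OF b N] Ne by (simp add: B_def g_def)
  also have "(\<Sum>a\<in>X. l a * (\<Sum>y\<in>{y\<in>X. card y < k}. (cmod (f a y))\<^sup>2)) =
     (\<Sum>y\<in>{y\<in>X. card y < k}. \<Sum>a\<in>X. l a * (cmod (f a y))\<^sup>2)"
    unfolding sum_distrib_left by (rule sum.swap)
  \<comment> \<open>Averaged over the eigenvectors with their eigenvalues, the low-energy weight is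
    that of the product state itself, so no control over single eigenvectors is called for.\<close>
  also have "\<dots> = (\<Sum>y\<in>{y\<in>X. card y < k}. bernoulli ((1 + R * cos \<phi>) / 2) n y)"
  proof (rule sum.cong[OF refl])
    fix y
    have "complex_of_real (bernoulli ((1 + R * cos \<phi>) / 2) n y) = of_real (\<Sum>a\<in>X. l a * (cmod (f a y))\<^sup>2)"
      unfolding product_kernel_diag[where c = "R * sin \<phi>", symmetric] product_kernel_eigen
      by (simp add: l_def X_def f_def power2_eq_square abs_mult_self_eq)
    then show "(\<Sum>a\<in>X. l a * (cmod (f a y))\<^sup>2) = bernoulli ((1 + R * cos \<phi>) / 2) n y"
      by (simp only: of_real_eq_iff)
  qed
  also have "\<dots> \<le> e3" using ke by (simp add: X_def)
  finally have "(\<Sum>x\<in>X - near. P x) \<le> e1 + e2 + e3" by simp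
  then show thesis using that W cons P0 P1 unfolding X_def B_def P_def by blast
qed

text \<open>Absorbs the polynomial prefactor of \<open>bath_shell_count\<close> into the
  exponent.\<close>

lemma eventually_linear_le_exp:
  fixes \<eta> :: real assumes "\<eta> > 0"
  shows "\<forall>\<^sub>F n in sequentially. 2 * (real n + 1) \<le> exp (n * \<eta>)"
proof -
  obtain n0 where n0: "real n0 > 8 / \<eta>\<^sup>2" using reals_Archimedean2 by blast
  show ?thesis
  proof (rule eventually_sequentiallyI)
    fix n assume n: "n \<ge> Suc n0"
    hence "8 / \<eta>\<^sup>2 \<le> n" using n0 by linarith
    hence "8 \<le> n * \<eta>\<^sup>2" using assms by (simp add: field_simps)
    hence "real n * 8 \<le> n * (n * \<eta>\<^sup>2)" by (intro mult_left_mono) auto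
    define s where "s = n * \<eta>"
    have "s\<^sup>2 = n * (n * \<eta>\<^sup>2)" by (simp add: s_def power2_eq_square)
    hence "real n * 8 \<le> s\<^sup>2" using \<open>real n * 8 \<le> n * (n * \<eta>\<^sup>2)\<close> by linarith
    moreover have "s \<ge> 0" using assms by (simp add: s_def)
    moreover from this have "1 + s + s\<^sup>2 / 2 \<le> exp s" by (rule exp_lower_Taylor_quadratic)
    moreover have "real n \<ge> 1" using n by simp
    ultimately have "2 * (real n + 1) \<le> exp s" by argo
    then show "2 * (real n + 1) \<le> exp (n * \<eta>)" by (simp add: s_def)
  qed
qed

text \<open>Per copy and on a logarithmic scale, \<open>bath_shell_count\<close> asks for
  \<open>binary_entropy q + 2 * \<beta> * (p - w) < binary_entropy p\<close>, with \<open>q\<close>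
  the larger eigenvalue and \<open>w\<close>, \<open>p\<close> the initial and final excitation
  probabilities. This is \<open>gap\<close> rewritten; its slack \<open>\<Delta>\<close> is spread
  over the finite-size corrections.\<close>

lemma ncopy_protocol:
  fixes \<beta> R \<phi> e \<epsilon> :: real
  assumes b: "\<beta> > 0" and R: "0 \<le> R" "R \<le> 1" and e: "-1 < e" "e < 1" and eps: "\<epsilon> > 0"
    and gap: "binary_entropy ((1 + R) / 2) + \<beta> * (e - R * cos \<phi>) < binary_entropy ((1 + e) / 2)"
  obtains n N W where "n > 0" "unitary_on (Pow {..<n} \<times> bath \<beta> N) W"
    "\<And>z z'. z \<in> Pow {..<n} \<times> bath \<beta> N \<Longrightarrow> z' \<in> Pow {..<n} \<times> bath \<beta> N \<Longrightarrow>
       card (fst z) + fst (snd z) \<noteq> card (fst z') + fst (snd z') \<Longrightarrow> W z z' = 0"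
    "(\<Sum>x\<in>Pow {..<n}. Re (nfinal \<beta> N n (R * cos \<phi>) (R * sin \<phi>) W x x)) = 1"
    "\<bar>(\<Sum>x\<in>Pow {..<n}. Re (nfinal \<beta> N n (R * cos \<phi>) (R * sin \<phi>) W x x) * (2 * card x / n - 1)) - e\<bar> \<le> \<epsilon>"
proof -
  define p where "p = (1 + e) / 2"
  define w where "w = (1 + R * cos \<phi>) / 2"
  define q where "q = (1 + R) / 2"
  define \<Delta> where "\<Delta> = binary_entropy p - binary_entropy q - 2 * \<beta> * (p - w)"
  have D: "\<Delta> > 0" using gap by (simp add: \<Delta>_def p_def q_def w_def field_simps)
  \<comment> \<open>The window of width \<open>\<delta>\<close> shifts the mean energy by at most
    \<open>2 * \<delta> \<le> \<epsilon> / 4\<close> and the exponent by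
    \<open>4 * \<beta> * \<delta> \<le> \<Delta> / 4\<close>.\<close>
  define \<delta> where "\<delta> = min (\<epsilon> / 8) (\<Delta> / (16 * \<beta>))"
  have d: "\<delta> > 0" "\<delta> \<le> \<epsilon> / 8" "4 * \<beta> * \<delta> \<le> \<Delta> / 4"
  proof -
    show "\<delta> > 0" "\<delta> \<le> \<epsilon> / 8" using b D eps by (auto simp: \<delta>_def)
    have "\<delta> \<le> \<Delta> / (16 * \<beta>)" by (simp add: \<delta>_def)
    then show "4 * \<beta> * \<delta> \<le> \<Delta> / 4" using b by (simp add: field_simps)
  qed
  have p: "0 < p" "p < 1" using e by (auto simp: p_def)
  have q: "0 \<le> q" "q \<le> 1" using R by (auto simp: q_def)
  have "\<bar>R * cos \<phi>\<bar> \<le> 1 * 1"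
    unfolding abs_mult using R by (intro mult_mono) auto
  hence w: "0 \<le> w" "w \<le> 1" by (auto simp: w_def)
  \<comment> \<open>Three losses of \<open>e1\<close>, each weighted by the largest energy error 2,
    cost \<open>\<epsilon> / 2\<close>.\<close>
  define e1 where "e1 = \<epsilon> / 12"
  have e1: "e1 > 0" using eps by (simp add: e1_def)
  have D8: "\<Delta> / 8 > 0" using D by simp
  have "\<forall>\<^sub>F n in sequentially. n > 0 \<and>
     (\<exists>T\<subseteq>Pow {..<n}. card T \<le> exp (n * (binary_entropy q + \<Delta> / 8)) \<and> (\<Sum>x\<in>Pow {..<n} - T. bernoulli q n x) \<le> e1) \<and>
     card {x\<in>Pow {..<n}. \<bar>real (card x) - n * p\<bar> < \<delta> * n} \<ge> exp (n * (binary_entropy p - \<Delta> / 8)) \<and>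
     (\<Sum>x\<in>{x\<in>Pow {..<n}. \<bar>real (card x) - n * w\<bar> \<ge> \<delta> * n}. bernoulli w n x) \<le> e1 \<and>
     2 * (real n + 1) \<le> exp (n * (\<Delta> / 8))"
    by (intro eventually_conj eventually_gt_at_top eventually_typical_upper[OF q D8 e1]
        eventually_typical_lower[OF p D8 d(1)] eventually_bernoulli_Chebyshev[OF w d(1) e1]
        eventually_linear_le_exp[OF D8])
  then obtain n T where n: "n > 0" and T: "T \<subseteq> Pow {..<n}" "card T \<le> exp (n * (binary_entropy q + \<Delta> / 8))"
      "(\<Sum>x\<in>Pow {..<n} - T. bernoulli q n x) \<le> e1"
    and near: "card {x\<in>Pow {..<n}. \<bar>real (card x) - n * p\<bar> < \<delta> * n} \<ge> exp (n * (binary_entropy p - \<Delta> / 8))"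
    and wn: "(\<Sum>x\<in>{x\<in>Pow {..<n}. \<bar>real (card x) - n * w\<bar> \<ge> \<delta> * n}. bernoulli w n x) \<le> e1"
    and poly: "2 * (real n + 1) \<le> exp (n * (\<Delta> / 8))"
    using eventually_happens'[OF sequentially_bot] by blast
  define Y where "Y = {x\<in>Pow {..<n}. \<bar>real (card x) - n * p\<bar> < \<delta> * n}"
  define K where "K = (p + \<delta>) * n"
  \<comment> \<open>Rounded up, so that fewer than \<open>k\<close> quanta means less than
    \<open>(w - \<delta>) * n\<close>, inside the Chebyshev tail of the input energy.\<close>
  define k where "k = nat \<lceil>(w - \<delta>) * n\<rceil>"
  have k: "real k \<ge> (w - \<delta>) * n" unfolding k_def by linarith
  have kk: "real c \<le> n * w - \<delta> * n" if "c < k" for c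
  proof -
    have "real c < (w - \<delta>) * n" using that unfolding k_def by linarith
    then show ?thesis by (simp add: algebra_simps)
  qed
  have count: "real (card T) * (2 * (n + 1)) * exp (2 * \<beta> * (K - k)) \<le> card Y"
  proof -
    have "K - k \<le> n * (p - w + 2 * \<delta>)" using k by (simp add: K_def algebra_simps)
    hence "2 * \<beta> * (K - k) \<le> 2 * \<beta> * (n * (p - w + 2 * \<delta>))" using b by (intro mult_left_mono) auto
    hence "exp (2 * \<beta> * (K - k)) \<le> exp (n * (2 * \<beta> * (p - w) + 4 * \<beta> * \<delta>))"
      by (simp add: algebra_simps)
    hence "real (card T) * (2 * (n + 1)) * exp (2 * \<beta> * (K - k)) \<le>
       exp (n * (binary_entropy q + \<Delta> / 8)) * exp (n * (\<Delta> / 8)) * exp (n * (2 * \<beta> * (p - w) + 4 * \<beta> * \<delta>))"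
      using T(2) poly by (intro mult_mono) auto
    also have "\<dots> = exp (n * (binary_entropy q + \<Delta> / 4 + 2 * \<beta> * (p - w) + 4 * \<beta> * \<delta>))"
      by (simp add: exp_add[symmetric] algebra_simps)
    \<comment> \<open>The corrections use up \<open>5 * \<Delta> / 8\<close>: two eighths for the
      eigenvector count and the prefactor, a quarter for the window, one eighth for the lower bound
      on \<open>card Y\<close>.\<close>
    also have "\<dots> \<le> exp (n * (binary_entropy p - \<Delta> / 8))"
    proof -
      have "binary_entropy q + \<Delta> / 4 + 2 * \<beta> * (p - w) + 4 * \<beta> * \<delta> \<le> binary_entropy p - \<Delta> / 8"
      proof -
        have "binary_entropy p = binary_entropy q + 2 * \<beta> * (p - w) + \<Delta>" by (simp add: \<Delta>_def)
        then show ?thesis using d(3) D by linarith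
      qed
      then show ?thesis by (simp add: mult_left_mono)
    qed
    also have "\<dots> \<le> card Y" using near by (simp add: Y_def)
    finally show ?thesis .
  qed
  obtain N0 where N0: "real N0 > 4 * n / e1" using reals_Archimedean2 by blast
  define N where "N = N0 + 2 * n"
  have "4 * n / e1 \<le> real N + 1" using N0 by (simp add: N_def)
  hence Ne: "4 * n / (N + 1) \<le> e1" using e1 by (simp add: field_simps)
  have ke: "(\<Sum>x\<in>{x\<in>Pow {..<n}. card x < k}. bernoulli w n x) \<le> e1"
  proof -
    have "(\<Sum>x\<in>{x\<in>Pow {..<n}. card x < k}. bernoulli w n x) \<le>
       (\<Sum>x\<in>{x\<in>Pow {..<n}. \<bar>real (card x) - n * w\<bar> \<ge> \<delta> * n}. bernoulli w n x)"
      using bernoulli_nonneg[OF w] kk by (intro sum_mono2) fastforce+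
    then show ?thesis using wn by linarith
  qed
  have YK: "real (card x) \<le> K" if "x \<in> Y" for x
    using that by (auto simp: Y_def K_def algebra_simps)
  have YP: "Y \<subseteq> Pow {..<n}" by (auto simp: Y_def)
  have NN: "2 * n \<le> N" by (simp add: N_def)
  from nfinal_concentration[OF b R T(1) YP count YK NN Ne T(3)[unfolded q_def] ke[unfolded w_def]]
  obtain W where W: "unitary_on (Pow {..<n} \<times> bath \<beta> N) W"
    "\<And>z z'. z \<in> Pow {..<n} \<times> bath \<beta> N \<Longrightarrow> z' \<in> Pow {..<n} \<times> bath \<beta> N \<Longrightarrow>
       card (fst z) + fst (snd z) \<noteq> card (fst z') + fst (snd z') \<Longrightarrow> W z z' = 0"
    and P: "\<And>x. Re (nfinal \<beta> N n (R * cos \<phi>) (R * sin \<phi>) W x x) \<ge> 0"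
    "(\<Sum>x\<in>Pow {..<n}. Re (nfinal \<beta> N n (R * cos \<phi>) (R * sin \<phi>) W x x)) = 1"
    "(\<Sum>x\<in>Pow {..<n} - Y. Re (nfinal \<beta> N n (R * cos \<phi>) (R * sin \<phi>) W x x)) \<le> e1 + e1 + e1"
    by blast
  define F where "F x = Re (nfinal \<beta> N n (R * cos \<phi>) (R * sin \<phi>) W x x)" for x
  define h where "h x = 2 * real (card x) / n - 1 - e" for x :: "nat set"
  have h2: "\<bar>h x\<bar> \<le> 2" if "x \<in> Pow {..<n} - Y" for x
  proof -
    have "card x \<le> n" using card_mono[of "{..<n}" x] that by auto
    hence "0 \<le> real (card x) / n" "real (card x) / n \<le> 1" using n by auto
    moreover have "h x = 2 * (real (card x) / n) - 1 - e" by (simp add: h_def)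
    ultimately show ?thesis using e by linarith
  qed
  have hd: "\<bar>h x\<bar> \<le> 2 * \<delta>" if "x \<in> Y" for x
  proof -
    define t where "t = (real (card x) - n * p) / n"
    have "h x = 2 * t" using n by (simp add: t_def h_def p_def field_simps)
    moreover have "\<bar>t\<bar> \<le> \<delta>" using that n
      by (simp add: t_def Y_def abs_divide divide_le_eq)
    ultimately show ?thesis by simp
  qed
  have "\<bar>(\<Sum>x\<in>Pow {..<n}. F x * (2 * card x / n - 1)) - e\<bar> = \<bar>\<Sum>x\<in>Pow {..<n}. F x * h x\<bar>"
    using P(2) by (simp add: h_def F_def right_diff_distrib sum_subtractf flip: sum_distrib_right)
  also have "\<dots> \<le> (\<Sum>x\<in>Pow {..<n}. F x * \<bar>h x\<bar>)"
    by (rule order_trans[OF sum_abs]) (simp add: abs_mult F_def P(1))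
  also have "\<dots> \<le> 2 * \<delta> + 2 * (e1 + e1 + e1)"
    by (rule sum_weights_bound[of _ Y]) (use P YP hd h2 d in \<open>auto simp: F_def\<close>)
  also have "\<dots> \<le> \<epsilon>" using d(2) eps by (simp add: e1_def)
  finally show thesis using that[OF n W P(2)] by (simp add: F_def)
qed

subsection \<open>Encoding kernels as matrices\<close>

lemma mat_adjoint_index [simp]:
  fixes A :: "complex mat"
  assumes "i < dim_col A" "j < dim_row A"
  shows "mat_adjoint A $$ (i, j) = cnj (A $$ (j, i))"
  using assms by (simp add: mat_adjoint_def mat_of_rows_def)

lemma mat_adjoint_dim [simp]:
  "dim_row (mat_adjoint A) = dim_col A" "dim_col (mat_adjoint A) = dim_row A"
  by (simp_all add: mat_adjoint_def)

lemma index_mult_mat_sum: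
  assumes "i < dim_row A" "j < dim_col B" "dim_col A = dim_row B"
  shows "(A * B) $$ (i, j) = (\<Sum>k<dim_row B. A $$ (i, k) * B $$ (k, j))"
  using assms by (simp add: scalar_prod_def atLeast0LessThan)

section \<open>Diagonal matrices and their Gibbs states\<close>

definition diagm :: "nat \<Rightarrow> (nat \<Rightarrow> complex) \<Rightarrow> complex mat" where
  "diagm n d = mat n n (\<lambda>(i, j). if i = j then d i else 0)"

lemma diagm_dim [simp]: "dim_row (diagm n d) = n" "dim_col (diagm n d) = n"
  by (simp_all add: diagm_def)

lemma diagm_carrier [simp]: "diagm n d \<in> carrier_mat n n" by (simp add: diagm_def)

lemma diagm_index [simp]: "i < n \<Longrightarrow> j < n \<Longrightarrow> diagm n d $$ (i, j) = (if i = j then d i else 0)"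
  by (simp add: diagm_def)

lemma mult_diagm_index:
  assumes "i < dim_row A" "j < n" "dim_col A = n"
  shows "(A * diagm n d) $$ (i, j) = A $$ (i, j) * d j"
proof -
  have "(A * diagm n d) $$ (i, j) = (\<Sum>k<n. A $$ (i, k) * diagm n d $$ (k, j))"
    using assms by (subst index_mult_mat_sum) auto
  also have "\<dots> = (\<Sum>k<n. if k = j then A $$ (i, j) * d j else 0)"
    using assms by (intro sum.cong) auto
  finally show ?thesis using assms by simp
qed

lemma diagm_mult_index:
  assumes "i < n" "j < dim_col A" "dim_row A = n"
  shows "(diagm n d * A) $$ (i, j) = d i * A $$ (i, j)"
proof -
  have "(diagm n d * A) $$ (i, j) = (\<Sum>k<n. diagm n d $$ (i, k) * A $$ (k, j))"
    using assms by (subst index_mult_mat_sum) auto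
  also have "\<dots> = (\<Sum>k<n. if k = i then d i * A $$ (i, j) else 0)"
    using assms by (intro sum.cong) auto
  finally show ?thesis using assms by simp
qed

lemma diagm_mult: "diagm n d * diagm n e = diagm n (\<lambda>i. d i * e i)"
  by (rule eq_matI) (auto simp: mult_diagm_index simp del: index_mult_mat(1))

lemma diagm_one: "1\<^sub>m n = diagm n (\<lambda>_. 1)"
  by (rule eq_matI) auto

lemma diagm_pow: "diagm n d ^\<^sub>m k = diagm n (\<lambda>i. d i ^ k)"
  by (induction k) (simp_all add: diagm_one diagm_mult mult.commute)

lemma diagm_smult: "c \<cdot>\<^sub>m diagm n d = diagm n (\<lambda>i. c * d i)"
  by (rule eq_matI) auto

lemma exp_complex_sums: "(\<lambda>k. z ^ k / fact k) sums exp (z :: complex)"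
  using exp_converges[of z] by (simp add: scaleR_conv_of_real field_simps)

lemma mexp_diagm: "mexp (diagm n d) = diagm n (\<lambda>i. exp (d i))"
  by (rule eq_matI) (auto simp: mexp_def diagm_pow exp_complex_sums[THEN sums_unique, symmetric])

lemma mtrace_diagm: "mtrace (diagm n d) = (\<Sum>i<n. d i)"
  by (simp add: mtrace_def)

lemma gibbs_diagm:
  "gibbs \<beta> (diagm n (\<lambda>i. of_real (h i))) =
   diagm n (\<lambda>i. of_real (exp (- (\<beta> * h i)) / (\<Sum>k<n. exp (- (\<beta> * h k)))))"
  unfolding gibbs_def diagm_smult mexp_diagm mtrace_diagm
  by (rule arg_cong[of _ _ "diagm n"]) (simp flip: of_real_exp of_real_mult of_real_minus of_real_sum)

lemma hermitian_diagm: "hermitian n (diagm n (\<lambda>i. of_real (h i)))"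
  unfolding hermitian_def by (auto intro!: eq_matI)

section \<open>Tensor indices and the passage from kernels to matrices\<close>

lemma kron_dim [simp]: "dim_row (kron A B) = dim_row A * dim_row B" "dim_col (kron A B) = dim_col A * dim_col B"
  by (simp_all add: kron_def)

lemma kron_index [simp]:
  "i < dim_row A * dim_row B \<Longrightarrow> j < dim_col A * dim_col B \<Longrightarrow>
   kron A B $$ (i, j) = A $$ (i div dim_row B, j div dim_col B) * B $$ (i mod dim_row B, j mod dim_col B)"
  by (simp add: kron_def)

lemma sum_lessThan_mult:
  fixes b :: nat
  shows "(\<Sum>i<a * b. f i) = (\<Sum>i<a. \<Sum>j<b. f (i * b + j))"
proof -
  have "(\<Sum>i<a * b. f i) = (\<Sum>i<a. sum f {i * b..<i * b + b})" by (rule sum.nat_group[symmetric])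
  also have "\<dots> = (\<Sum>i<a. \<Sum>j<b. f (i * b + j))"
  proof (rule sum.cong[OF refl])
    fix i
    show "sum f {i * b..<i * b + b} = (\<Sum>j<b. f (i * b + j))"
      using sum.shift_bounds_nat_ivl[of f 0 "i * b" b] by (simp add: atLeast0LessThan add.commute)
  qed
  finally show ?thesis .
qed

lemma div_less_mult: "i < a * b \<Longrightarrow> i div b < (a :: nat)"
  by (simp add: less_mult_imp_div_less)

lemma mod_less_mult: "i < a * b \<Longrightarrow> i mod b < (b :: nat)"
  by (cases "b = 0") auto

lemma mult_add_less: "i < a \<Longrightarrow> j < b \<Longrightarrow> i * b + j < a * (b :: nat)"
  using mult_le_mono1[of "Suc i" a b] by simp

text \<open>Mixed-radix digits of a global index, in the tensor order of the model. Index 0 of the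
  qubit becomes \<open>True\<close> because the first eigenvalue of \<open>pauliZ\<close> is +1, the
  excited level.\<close>

definition decode :: "(nat \<Rightarrow> 'm) \<Rightarrow> (nat \<Rightarrow> 'e) \<Rightarrow> nat \<Rightarrow> nat \<Rightarrow> nat \<Rightarrow> bool \<times> 'm \<times> 'e" where
  "decode fM fE dM dE i = (i div dE div dM = 0, fM (i div dE mod dM), fE (i mod dE))"

lemma decode_encode:
  "k < dE \<Longrightarrow> m < dM \<Longrightarrow> decode fM fE dM dE ((s * dM + m) * dE + k) = (s = 0, fM m, fE k)"
  by (simp add: decode_def)

lemma decode_inj:
  assumes "inj_on fM {..<dM}" "inj_on fE {..<dE}" "i < 2 * dM * dE" "j < 2 * dM * dE"
    "decode fM fE dM dE i = decode fM fE dM dE j"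
  shows "i = j"
proof -
  have lt: "i div dE < 2 * dM" "j div dE < 2 * dM" "i mod dE < dE" "j mod dE < dE"
    using assms(3,4) by (auto intro: div_less_mult mod_less_mult)
  have lt2: "i div dE div dM < 2" "j div dE div dM < 2" "i div dE mod dM < dM" "j div dE mod dM < dM"
    using lt by (auto intro: div_less_mult mod_less_mult)
  have "i mod dE = j mod dE" "i div dE mod dM = j div dE mod dM"
    using assms(1,2,5) lt lt2 by (auto simp: decode_def inj_on_def)
  moreover have "i div dE div dM = j div dE div dM"
    using assms(5) lt2 by (auto simp: decode_def)
  ultimately show ?thesis by (metis div_mod_decomp)
qed

lemma unitary_onD:
  "unitary_on J w \<Longrightarrow> x \<in> J \<Longrightarrow> y \<in> J \<Longrightarrow> (\<Sum>z\<in>J. w x z * cnj (w y z)) = of_bool (x = y)"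
  unfolding unitary_on_def by blast

lemma sum_decode:
  fixes F :: "bool \<times> 'm \<times> 'e \<Rightarrow> complex"
  assumes M: "bij_betw fM {..<dM} M" and B: "bij_betw fE {..<dE} B"
  shows "(\<Sum>i<2 * dM * dE. F (decode fM fE dM dE i)) = (\<Sum>z\<in>UNIV \<times> M \<times> B. F z)"
proof -
  have "(\<Sum>i<2 * dM * dE. F (decode fM fE dM dE i)) = (\<Sum>s<(2 :: nat). \<Sum>m<dM. \<Sum>k<dE. F (s = 0, fM m, fE k))"
    unfolding sum_lessThan_mult by (intro sum.cong refl) (simp add: decode_encode)
  also have "\<dots> = (\<Sum>m<dM. \<Sum>k<dE. F (True, fM m, fE k)) + (\<Sum>m<dM. \<Sum>k<dE. F (False, fM m, fE k))"
    by (simp add: numeral_2_eq_2)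
  also have "\<dots> = (\<Sum>s\<in>UNIV. \<Sum>m<dM. \<Sum>k<dE. F (s, fM m, fE k))"
    by (simp add: UNIV_bool add.commute)
  also have "\<dots> = (\<Sum>s\<in>UNIV. \<Sum>m\<in>M. \<Sum>k\<in>B. F (s, m, k))"
  proof (rule sum.cong[OF refl])
    fix s
    have "(\<Sum>m<dM. \<Sum>k<dE. F (s, fM m, fE k)) = (\<Sum>m<dM. \<Sum>k\<in>B. F (s, fM m, k))"
      by (intro sum.cong refl sum.reindex_bij_betw[OF B])
    also have "\<dots> = (\<Sum>m\<in>M. \<Sum>k\<in>B. F (s, m, k))"
      by (rule sum.reindex_bij_betw[OF M])
    finally show "(\<Sum>m<dM. \<Sum>k<dE. F (s, fM m, fE k)) = (\<Sum>m\<in>M. \<Sum>k\<in>B. F (s, m, k))" .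
  qed
  finally show ?thesis by (simp add: sum.cartesian_product)
qed

definition qubit_matrix :: "(bool \<Rightarrow> bool \<Rightarrow> complex) \<Rightarrow> complex mat" where
  "qubit_matrix \<rho> = mat 2 2 (\<lambda>(i, j). \<rho> (i = 0) (j = 0))"

lemma pauliZ_diagm: "pauliZ = diagm 2 (\<lambda>i. of_real (if i = 0 then 1 else - 1))"
  by (rule eq_matI) (auto simp: pauliZ_def mat_of_rows_list_def numeral_2_eq_2 less_Suc_eq)

definition final_kernel where
  "final_kernel J u R0 z z' = (\<Sum>z1\<in>J. \<Sum>z2\<in>J. u z z1 * R0 z1 z2 * cnj (u z' z2))"

text \<open>Enumerations of \<open>M\<close> and \<open>B\<close> translate the kernels into
  matrices with diagonal Hamiltonians, for which commutation with the total Hamiltonian follows from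
  the vanishing of all entries between different energies. The memory state itself may carry
  coherences.\<close>

lemma heats_intro:
  fixes M :: "'m set" and B :: "'e set" and \<rho> :: "bool \<Rightarrow> bool \<Rightarrow> complex"
    and \<rho>M :: "'m \<Rightarrow> 'm \<Rightarrow> complex" and hM :: "'m \<Rightarrow> real" and hB :: "'e \<Rightarrow> real"
  assumes M: "finite M" "M \<noteq> {}" and B: "finite B" "B \<noteq> {}"
    and herm: "\<And>m m'. m \<in> M \<Longrightarrow> m' \<in> M \<Longrightarrow> cnj (\<rho>M m m') = \<rho>M m' m"
    and psd: "\<And>v. 0 \<le> Re (\<Sum>m\<in>M. \<Sum>m'\<in>M. cnj (v m) * \<rho>M m m' * v m')"
    and tr: "(\<Sum>m\<in>M. \<rho>M m m) = 1"
    and u: "unitary_on (UNIV \<times> M \<times> B) u"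
    and cons: "\<And>s m b s' m' b'. m \<in> M \<Longrightarrow> m' \<in> M \<Longrightarrow> b \<in> B \<Longrightarrow> b' \<in> B \<Longrightarrow>
        (if s then 1 else - 1) + hM m + hB b \<noteq> (if s' then 1 else - 1) + hM m' + hB b' \<Longrightarrow> u (s, m, b) (s', m', b') = 0"
    and \<gamma>: "\<And>b. \<gamma> b = exp (- (\<beta> * hB b)) / (\<Sum>b\<in>B. exp (- (\<beta> * hB b)))"
    and fin: "fin = final_kernel (UNIV \<times> M \<times> B) u
        (\<lambda>(s, m, b) (s', m', b'). \<rho> s s' * \<rho>M m m' * (if b = b' then of_real (\<gamma> b) else 0))"
    and marg: "\<And>m m'. m \<in> M \<Longrightarrow> m' \<in> M \<Longrightarrow> (\<Sum>s\<in>UNIV. \<Sum>b\<in>B. fin (s, m, b) (s, m', b)) = \<rho>M m m'"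
  shows "(\<Sum>b\<in>B. hB b * (Re (\<Sum>s\<in>UNIV. \<Sum>m\<in>M. fin (s, m, b) (s, m, b)) - \<gamma> b)) \<in> heats \<beta> pauliZ (qubit_matrix \<rho>)"
proof -
  define dM where "dM = card M"
  define dE where "dE = card B"
  have pos: "dM > 0" "dE > 0" using M B by (auto simp: dM_def dE_def card_gt_0_iff)
  obtain fM where fM: "bij_betw fM {..<dM} M"
    using ex_bij_betw_nat_finite[OF M(1)] by (auto simp: dM_def atLeast0LessThan)
  obtain fE where fE: "bij_betw fE {..<dE} B"
    using ex_bij_betw_nat_finite[OF B(1)] by (auto simp: dE_def atLeast0LessThan)
  have fM_in: "fM m \<in> M" if "m < dM" for m using fM that by (auto simp: bij_betw_def)
  have fE_in: "fE m \<in> B" if "m < dE" for m using fE that by (auto simp: bij_betw_def)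
  note injM = bij_betw_imp_inj_on[OF fM] and injE = bij_betw_imp_inj_on[OF fE]
  define D where "D = 2 * dM * dE"
  define d where "d = decode fM fE dM dE"
  define J where "J = (UNIV :: bool set) \<times> M \<times> B"
  have lt: "i div dE < 2 * dM" "i mod dE < dE" "i div dE div dM < 2" "i div dE mod dM < dM" if "i < D" for i
  proof -
    show a: "i div dE < 2 * dM" "i mod dE < dE" using that pos by (auto simp: D_def intro: div_less_mult)
    show "i div dE div dM < 2" "i div dE mod dM < dM" using a pos by (auto intro: div_less_mult)
  qed
  have d_in: "d i \<in> J" if "i < D" for i
    using lt[OF that] fM_in fE_in by (simp add: d_def decode_def J_def)
  have d_inj: "d i = d j \<longleftrightarrow> i = j" if "i < D" "j < D" for i j
    using decode_inj[OF injM injE] that by (auto simp: d_def D_def)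
  have sum_d: "(\<Sum>i<D. F (d i)) = (\<Sum>z\<in>J. F z)" for F :: "bool \<times> 'm \<times> 'e \<Rightarrow> complex"
    unfolding D_def d_def J_def by (rule sum_decode[OF fM fE])
  define U where "U = mat D D (\<lambda>(i, j). u (d i) (d j))"
  define HM where "HM = diagm dM (\<lambda>i. of_real (hM (fM i)))"
  define HE where "HE = diagm dE (\<lambda>i. of_real (hB (fE i)))"
  define RM where "RM = mat dM dM (\<lambda>(i, j). \<rho>M (fM i) (fM j))"
  define en where "en z = (case z of (s, m, b) \<Rightarrow> (if s then 1 else - 1) + hM m + hB b)" for z :: "bool \<times> 'm \<times> 'e"
  have U: "U \<in> carrier_mat D D" by (simp add: U_def)
  have UU: "U * mat_adjoint U = 1\<^sub>m D"
  proof (rule eq_matI)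
    fix i j assume "i < dim_row (1\<^sub>m D :: complex mat)" "j < dim_col (1\<^sub>m D :: complex mat)"
    hence ij: "i < D" "j < D" by auto
    have "(U * mat_adjoint U) $$ (i, j) = (\<Sum>k<D. u (d i) (d k) * cnj (u (d j) (d k)))"
      using ij by (subst index_mult_mat_sum) (auto simp: U_def)
    also have "\<dots> = (\<Sum>z\<in>J. u (d i) z * cnj (u (d j) z))" by (rule sum_d)
    also have "\<dots> = of_bool (d i = d j)" 
      by (rule unitary_onD[OF u[folded J_def] d_in[OF ij(1)] d_in[OF ij(2)]])
    finally show "(U * mat_adjoint U) $$ (i, j) = 1\<^sub>m D $$ (i, j)" using ij by (simp add: d_inj)
  qed (auto simp: U_def)
  have UU': "mat_adjoint U * U = 1\<^sub>m D"
  proof (rule mat_mult_left_right_inverse[OF U _ UU])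
    show "mat_adjoint U \<in> carrier_mat D D" using U by (intro carrier_matI) auto
  qed
  have unitary: "unitary (2 * dM * dE) U"
    using U UU UU' by (simp add: unitary_def D_def)
  define Htot where "Htot = kron (kron pauliZ (1\<^sub>m dM)) (1\<^sub>m dE) + kron (kron (1\<^sub>m 2) HM) (1\<^sub>m dE)
                  + kron (kron (1\<^sub>m 2) (1\<^sub>m dM)) HE"
  have eqD: "i = j \<longleftrightarrow> i div dE div dM = j div dE div dM \<and> i div dE mod dM = j div dE mod dM \<and> i mod dE = j mod dE"
    for i j
  proof
    assume a: "i div dE div dM = j div dE div dM \<and> i div dE mod dM = j div dE mod dM \<and> i mod dE = j mod dE"
    have dm: "k = l" if "k div c = l div c" "k mod c = l mod c" for k l c :: nat
      using that div_mult_mod_eq[of k c] div_mult_mod_eq[of l c] by metis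
    have "i div dE = j div dE" by (rule dm[of _ dM]) (use a in blast)+
    then show "i = j" by (rule dm[of _ dE]) (use a in blast)
  qed simp
  have Htot: "Htot = diagm D (\<lambda>i. of_real (en (d i)))"
  proof (rule eq_matI)
    fix i j assume "i < dim_row (diagm D (\<lambda>i. of_real (en (d i))))" "j < dim_col (diagm D (\<lambda>i. of_real (en (d i))))"
    hence ij: "i < D" "j < D" by auto
    show "Htot $$ (i, j) = diagm D (\<lambda>i. of_real (en (d i))) $$ (i, j)"
      using ij lt[OF ij(1)] lt[OF ij(2)] eqD[of i j]
      by (auto simp: Htot_def HM_def HE_def pauliZ_diagm D_def[symmetric] en_def d_def decode_def)
  qed (auto simp: Htot_def HM_def HE_def pauliZ_diagm D_def)
  have comm: "U * Htot = Htot * U"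
  proof (rule eq_matI)
    fix i j assume "i < dim_row (Htot * U)" "j < dim_col (Htot * U)"
    hence ij: "i < D" "j < D" by (auto simp: Htot U_def)
    have "(U * Htot) $$ (i, j) = u (d i) (d j) * of_real (en (d j))"
      unfolding Htot using ij by (simp add: mult_diagm_index U_def del: index_mult_mat(1))
    also have "\<dots> = of_real (en (d i)) * u (d i) (d j)"
      using cons d_in[OF ij(1)] d_in[OF ij(2)] unfolding J_def
      by (cases "d i"; cases "d j"; cases "en (d i) = en (d j)") (auto simp: en_def)
    also have "\<dots> = (Htot * U) $$ (i, j)"
      unfolding Htot using ij by (simp add: diagm_mult_index U_def del: index_mult_mat(1))
    finally show "(U * Htot) $$ (i, j) = (Htot * U) $$ (i, j)" .
  qed (auto simp: Htot U_def)
  have dens: "density dM RM"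
    unfolding density_def
  proof (intro conjI allI)
    show "hermitian dM RM" unfolding hermitian_def RM_def
      by (auto intro!: eq_matI simp: herm fM_in)
    show "mtrace RM = 1" using tr sum.reindex_bij_betw[OF fM, of "\<lambda>m. \<rho>M m m"]
      by (simp add: mtrace_def RM_def)
    fix v :: "nat \<Rightarrow> complex"
    define v' where "v' m = v (the_inv_into {..<dM} fM m)" for m
    have v': "v i = v' (fM i)" if "i < dM" for i
      using that injM by (simp add: v'_def the_inv_into_f_f)
    have "(\<Sum>i<dM. \<Sum>j<dM. cnj (v i) * RM $$ (i, j) * v j) =
          (\<Sum>i<dM. \<Sum>j<dM. cnj (v' (fM i)) * \<rho>M (fM i) (fM j) * v' (fM j))"
      by (intro sum.cong refl) (simp add: RM_def v')
    also have "\<dots> = (\<Sum>i<dM. \<Sum>m'\<in>M. cnj (v' (fM i)) * \<rho>M (fM i) m' * v' m')"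
      by (intro sum.cong refl sum.reindex_bij_betw[OF fM])
    also have "\<dots> = (\<Sum>m\<in>M. \<Sum>m'\<in>M. cnj (v' m) * \<rho>M m m' * v' m')"
      by (rule sum.reindex_bij_betw[OF fM])
    finally show "0 \<le> Re (\<Sum>i<dM. \<Sum>j<dM. cnj (v i) * RM $$ (i, j) * v j)" using psd[of v'] by simp
  qed
  define g where "g i = complex_of_real (\<gamma> (fE i))" for i
  have gibbs: "gibbs \<beta> HE = diagm dE g"
    unfolding HE_def gibbs_diagm using sum.reindex_bij_betw[OF fE, of "\<lambda>b. exp (- (\<beta> * hB b))"]
    by (intro arg_cong[of _ _ "diagm dE"] ext) (simp add: g_def \<gamma>)
  define R0 where "R0 = (\<lambda>(s, m, b) (s', m', b'). \<rho> s s' * \<rho>M m m' * (if b = b' then of_real (\<gamma> b) else 0))"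
  define K where "K = kron (kron (qubit_matrix \<rho>) RM) (diagm dE g)"
  have KD: "dim_row K = D" "dim_col K = D" by (auto simp: K_def qubit_matrix_def RM_def D_def)
  have K: "K $$ (i, j) = R0 (d i) (d j)" if "i < D" "j < D" for i j
  proof -
    have "fE (i mod dE) = fE (j mod dE) \<longleftrightarrow> i mod dE = j mod dE"
      using lt[OF that(1)] lt[OF that(2)] injE by (auto simp: inj_on_def)
    then show ?thesis using that lt[OF that(1)] lt[OF that(2)]
      by (simp add: K_def qubit_matrix_def RM_def D_def[symmetric] R0_def d_def decode_def g_def)
  qed
  define \<eta> where "\<eta> = U * K * mat_adjoint U"
  have \<eta>: "\<eta> $$ (i, j) = fin (d i) (d j)" if ij: "i < D" "j < D" for i j
  proof -
    have "\<eta> $$ (i, j) = (\<Sum>l<D. (\<Sum>k<D. u (d i) (d k) * R0 (d k) (d l)) * cnj (u (d j) (d l)))"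
      unfolding \<eta>_def using ij KD
      by (subst index_mult_mat_sum) (auto simp: U_def K index_mult_mat_sum simp del: index_mult_mat(1) intro!: sum.cong)
    also have "\<dots> = (\<Sum>l<D. \<Sum>k<D. u (d i) (d k) * R0 (d k) (d l) * cnj (u (d j) (d l)))"
      by (simp add: sum_distrib_right)
    also have "\<dots> = (\<Sum>k<D. \<Sum>l<D. u (d i) (d k) * R0 (d k) (d l) * cnj (u (d j) (d l)))"
      by (rule sum.swap)
    also have "\<dots> = (\<Sum>k<D. \<Sum>z2\<in>J. u (d i) (d k) * R0 (d k) z2 * cnj (u (d j) z2))"
      by (intro sum.cong refl sum_d)
    also have "\<dots> = (\<Sum>z1\<in>J. \<Sum>z2\<in>J. u (d i) z1 * R0 z1 z2 * cnj (u (d j) z2))"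
      by (rule sum_d)
    finally show ?thesis by (simp add: fin final_kernel_def J_def R0_def)
  qed
  have enc: "(s * dM + m) * dE + k < D" "d ((s * dM + m) * dE + k) = (s = 0, fM m, fE k)"
    if "s < 2" "m < dM" "k < dE" for s m k
    using that by (auto simp: D_def d_def decode_encode intro!: mult_add_less)
  have bool_sum: "(\<Sum>s<2. F (s = (0 :: nat))) = (\<Sum>s\<in>UNIV. F s)" for F :: "bool \<Rightarrow> complex"
    by (simp add: numeral_2_eq_2 UNIV_bool add.commute)
  have M_marg: "ptrace_first 2 dM (ptrace_second (2 * dM) dE \<eta>) = RM"
  proof (rule eq_matI)
    fix i j assume "i < dim_row RM" "j < dim_col RM"
    hence ij: "i < dM" "j < dM" by (auto simp: RM_def)
    have "ptrace_first 2 dM (ptrace_second (2 * dM) dE \<eta>) $$ (i, j) =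
       (\<Sum>s<(2 :: nat). \<Sum>k<dE. \<eta> $$ ((s * dM + i) * dE + k, (s * dM + j) * dE + k))"
      using ij by (auto simp: ptrace_first_def ptrace_second_def mult_add_less intro!: sum.cong)
    also have "\<dots> = (\<Sum>s<(2 :: nat). \<Sum>k<dE. fin (s = 0, fM i, fE k) (s = 0, fM j, fE k))"
      by (intro sum.cong refl) (use ij in \<open>simp add: \<eta> enc\<close>)
    also have "\<dots> = (\<Sum>s\<in>UNIV. \<Sum>b\<in>B. fin (s, fM i, b) (s, fM j, b))"
      unfolding bool_sum[of "\<lambda>s. \<Sum>k<dE. fin (s, fM i, fE k) (s, fM j, fE k)"]
      by (intro sum.cong refl sum.reindex_bij_betw[OF fE])
    also have "\<dots> = \<rho>M (fM i) (fM j)" using ij by (intro marg fM_in)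
    finally show "ptrace_first 2 dM (ptrace_second (2 * dM) dE \<eta>) $$ (i, j) = RM $$ (i, j)"
      using ij by (simp add: RM_def)
  qed (auto simp: ptrace_first_def RM_def)
  have E_marg: "ptrace_first (2 * dM) dE \<eta> $$ (k, k) = (\<Sum>s\<in>UNIV. \<Sum>m\<in>M. fin (s, m, fE k) (s, m, fE k))"
    if k: "k < dE" for k
  proof -
    have "ptrace_first (2 * dM) dE \<eta> $$ (k, k) = (\<Sum>s<(2 :: nat). \<Sum>m<dM. \<eta> $$ ((s * dM + m) * dE + k, (s * dM + m) * dE + k))"
      using k by (simp add: ptrace_first_def sum_lessThan_mult)
    also have "\<dots> = (\<Sum>s<(2 :: nat). \<Sum>m<dM. fin (s = 0, fM m, fE k) (s = 0, fM m, fE k))"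
      by (intro sum.cong refl) (use k in \<open>simp add: \<eta> enc\<close>)
    also have "\<dots> = (\<Sum>s\<in>UNIV. \<Sum>m\<in>M. fin (s, m, fE k) (s, m, fE k))"
      unfolding bool_sum[of "\<lambda>s. \<Sum>m<dM. fin (s, fM m, fE k) (s, fM m, fE k)"]
      by (intro sum.cong refl sum.reindex_bij_betw[OF fM])
    finally show ?thesis .
  qed
  have dimE: "dim_row (ptrace_first (2 * dM) dE \<eta>) = dE" "dim_col (ptrace_first (2 * dM) dE \<eta>) = dE"
    by (auto simp: ptrace_first_def)
  have "mtrace (HE * (ptrace_first (2 * dM) dE \<eta> - diagm dE g)) =
     (\<Sum>k<dE. of_real (hB (fE k)) * ((\<Sum>s\<in>UNIV. \<Sum>m\<in>M. fin (s, m, fE k) (s, m, fE k)) - of_real (\<gamma> (fE k))))"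
    unfolding mtrace_def HE_def using dimE
    by (simp add: diagm_mult_index E_marg g_def del: index_mult_mat(1))
  also have "\<dots> = (\<Sum>b\<in>B. of_real (hB b) * ((\<Sum>s\<in>UNIV. \<Sum>m\<in>M. fin (s, m, b) (s, m, b)) - of_real (\<gamma> b)))"
    by (rule sum.reindex_bij_betw[OF fE])
  finally have Q: "Re (mtrace (HE * (ptrace_first (2 * dM) dE \<eta> - diagm dE g))) =
     (\<Sum>b\<in>B. hB b * (Re (\<Sum>s\<in>UNIV. \<Sum>m\<in>M. fin (s, m, b) (s, m, b)) - \<gamma> b))"
    by simp
  show ?thesis
    unfolding heats_def mem_Collect_eq Let_def
    by (intro exI[of _ dM] exI[of _ dE] exI[of _ HM] exI[of _ HE] exI[of _ RM] exI[of _ U])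
      (use pos unitary comm dens M_marg Q in \<open>simp add: gibbs hermitian_diagm HM_def[symmetric] HE_def[symmetric]
         Htot_def[symmetric] K_def[symmetric] \<eta>_def[symmetric]\<close>; simp add: HM_def HE_def hermitian_diagm)
qed

subsection \<open>A catalyst from a protocol on many copies\<close>

text \<open>Positive semidefinite kernels presented as finite sums of rank-one kernels. Generating
  the cone this way makes sums, Schur products and congruences short inductions; hermiticity and
  positivity of the memory state are read off at the end.\<close>

inductive gram :: "('a \<Rightarrow> 'a \<Rightarrow> complex) \<Rightarrow> bool" where
  gram_zero: "gram (\<lambda>x y. 0)"
| gram_step: "gram f \<Longrightarrow> gram (\<lambda>x y. f x y + v x * cnj (v y))"

lemma gram_rank1: "gram (\<lambda>x y. v x * cnj (v y))"
  using gram_step[OF gram_zero, of v] by simp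

lemma gram_add: "gram g \<Longrightarrow> gram f \<Longrightarrow> gram (\<lambda>x y. f x y + g x y)"
proof (induction rule: gram.induct)
  case (gram_step g v)
  then show ?case using gram.gram_step[of "\<lambda>x y. f x y + g x y" v] by (simp add: add.assoc)
qed simp

lemma gram_sum: "(\<And>s. s \<in> S \<Longrightarrow> gram (f s)) \<Longrightarrow> gram (\<lambda>x y. \<Sum>s\<in>S. f s x y)"
proof (induction S rule: infinite_finite_induct)
  case (insert s S)
  then show ?case using gram_add[of "\<lambda>x y. \<Sum>s\<in>S. f s x y" "f s"] by simp
qed (auto intro: gram_zero)

lemma gram_comp: "gram f \<Longrightarrow> gram (\<lambda>x y. f (h x) (h y))"
proof (induction rule: gram.induct)
  case (gram_step f v)
  then show ?case using gram.gram_step[of "\<lambda>x y. f (h x) (h y)" "\<lambda>x. v (h x)"] by simp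
qed (rule gram_zero)

lemma gram_mult_rank1: "gram f \<Longrightarrow> gram (\<lambda>x y. f x y * (w x * cnj (w y)))"
proof (induction rule: gram.induct)
  case (gram_step f v)
  then show ?case using gram.gram_step[of "\<lambda>x y. f x y * (w x * cnj (w y))" "\<lambda>x. v x * w x"]
    by (simp add: algebra_simps)
qed (simp add: gram_zero)

text \<open>Schur product theorem, by expanding one factor into rank-one terms. It serves for tensor
  products, whose kernels are entrywise products of pulled-back kernels.\<close>

lemma gram_mult: "gram g \<Longrightarrow> gram f \<Longrightarrow> gram (\<lambda>x y. f x y * g x y)"
proof (induction rule: gram.induct)
  case (gram_step g v)
  then show ?case using gram_add[OF gram_mult_rank1[of f v], of "\<lambda>x y. f x y * g x y"]
    by (simp add: algebra_simps)
qed (simp add: gram_zero)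

lemma gram_scale: "r \<ge> 0 \<Longrightarrow> gram f \<Longrightarrow> gram (\<lambda>x y. f x y * of_real r)"
proof -
  assume r: "r \<ge> 0" and f: "gram f"
  have "complex_of_real (sqrt r) * cnj (of_real (sqrt r)) = of_real r"
    using r unfolding complex_cnj_complex_of_real of_real_mult[symmetric] by simp
  then show ?thesis using gram_mult_rank1[OF f, of "\<lambda>_. of_real (sqrt r)"] by simp
qed

lemma gram_prod: "(\<And>s. s \<in> S \<Longrightarrow> gram (f s)) \<Longrightarrow> gram (\<lambda>x y. \<Prod>s\<in>S. f s x y)"
proof (induction S rule: infinite_finite_induct)
  case (insert s S)
  then show ?case using gram_mult[of "\<lambda>x y. \<Prod>s\<in>S. f s x y" "f s"] by simp
qed (use gram_rank1[of "\<lambda>_. 1"] in auto)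

text \<open>With \<open>a\<close> a block of a unitary this is one Kraus term of a channel, so it
  carries positivity through the n-copy protocol.\<close>

lemma gram_congruence:
  "gram f \<Longrightarrow> gram (\<lambda>x x'. \<Sum>y\<in>Y. \<Sum>y'\<in>Y. a x y * f y y' * cnj (a x' y'))"
proof (induction rule: gram.induct)
  case (gram_step f v)
  have "(\<Sum>y\<in>Y. \<Sum>y'\<in>Y. a x y * (f y y' + v y * cnj (v y')) * cnj (a x' y')) =
    (\<Sum>y\<in>Y. \<Sum>y'\<in>Y. a x y * f y y' * cnj (a x' y')) + (\<Sum>y\<in>Y. a x y * v y) * cnj (\<Sum>y\<in>Y. a x' y * v y)" for x x'
    unfolding cnj_sum sum_product sum.distrib[symmetric] by (intro sum.cong refl) (simp add: algebra_simps)
  then show ?case using gram.gram_step[OF gram_step.IH, of "\<lambda>x. \<Sum>y\<in>Y. a x y * v y"] by simp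
qed (simp add: gram_zero)

lemma gram_hermitian: "gram f \<Longrightarrow> cnj (f x y) = f y x"
  by (induction rule: gram.induct) auto

lemma gram_psd: "gram f \<Longrightarrow> 0 \<le> Re (\<Sum>x\<in>X. \<Sum>y\<in>X. cnj (v x) * f x y * v y)"
proof (induction rule: gram.induct)
  case (gram_step f w)
  have "(\<Sum>x\<in>X. \<Sum>y\<in>X. cnj (v x) * (f x y + w x * cnj (w y)) * v y) =
    (\<Sum>x\<in>X. \<Sum>y\<in>X. cnj (v x) * f x y * v y) + (\<Sum>x\<in>X. cnj (v x) * w x) * cnj (\<Sum>x\<in>X. cnj (v x) * w x)"
    unfolding cnj_sum sum_product sum.distrib[symmetric] by (intro sum.cong refl) (simp add: algebra_simps)
  also have "(\<Sum>x\<in>X. cnj (v x) * w x) * cnj (\<Sum>x\<in>X. cnj (v x) * w x) =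
     of_real ((cmod (\<Sum>x\<in>X. cnj (v x) * w x))\<^sup>2)"
    by (simp only: of_real_cmod_power2 mult.commute)
  finally show ?case using gram_step.IH by simp
qed simp

lemma unitary_on_transport:
  assumes f: "bij_betw f J I" and w: "unitary_on I w"
  shows "unitary_on J (\<lambda>x y. w (f x) (f y))"
proof -
  have inj: "f x = f y \<longleftrightarrow> x = y" if "x \<in> J" "y \<in> J" for x y
    using f that by (auto simp: bij_betw_def inj_on_def)
  have f_in: "f x \<in> I" if "x \<in> J" for x using f that by (auto simp: bij_betw_def)
  show ?thesis unfolding unitary_on_def
  proof (intro conjI ballI)
    fix x y assume xy: "x \<in> J" "y \<in> J"
    have "(\<Sum>z\<in>J. w (f x) (f z) * cnj (w (f y) (f z))) = (\<Sum>z\<in>I. w (f x) z * cnj (w (f y) z))"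
      by (rule sum.reindex_bij_betw[OF f])
    then show "(\<Sum>z\<in>J. w (f x) (f z) * cnj (w (f y) (f z))) = of_bool (x = y)"
      using w f_in xy inj by (simp add: unitary_on_def)
    have "(\<Sum>z\<in>J. cnj (w (f z) (f x)) * w (f z) (f y)) = (\<Sum>z\<in>I. cnj (w z (f x)) * w z (f y))"
      by (rule sum.reindex_bij_betw[OF f])
    then show "(\<Sum>z\<in>J. cnj (w (f z) (f x)) * w (f z) (f y)) = of_bool (x = y)"
      using w f_in xy inj by (simp add: unitary_on_def)
  qed
qed

lemma unitary_on_permute_rows:
  assumes f: "bij_betw f J J" and w: "unitary_on J w"
  shows "unitary_on J (\<lambda>x y. w (f x) y)"
proof -
  have inj: "f x = f y \<longleftrightarrow> x = y" if "x \<in> J" "y \<in> J" for x y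
    using f that by (auto simp: bij_betw_def inj_on_def)
  have f_in: "f x \<in> J" if "x \<in> J" for x using f that by (auto simp: bij_betw_def)
  show ?thesis unfolding unitary_on_def
  proof (intro conjI ballI)
    fix x y assume xy: "x \<in> J" "y \<in> J"
    show "(\<Sum>z\<in>J. w (f x) z * cnj (w (f y) z)) = of_bool (x = y)"
      using w f_in xy inj by (simp add: unitary_on_def)
    have "(\<Sum>z\<in>J. cnj (w (f z) x) * w (f z) y) = (\<Sum>z\<in>J. cnj (w z x) * w z y)"
      by (rule sum.reindex_bij_betw[OF f])
    then show "(\<Sum>z\<in>J. cnj (w (f z) x) * w (f z) y) = of_bool (x = y)"
      using w xy by (simp add: unitary_on_def)
  qed
qed

lemma final_kernel_transport:
  assumes f: "bij_betw f J I"
  shows "final_kernel J (\<lambda>x y. w (f x) (f y)) (\<lambda>x y. R (f x) (f y)) z z' = final_kernel I w R (f z) (f z')"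
proof -
  have "final_kernel J (\<lambda>x y. w (f x) (f y)) (\<lambda>x y. R (f x) (f y)) z z' =
     (\<Sum>z1\<in>J. \<Sum>z2\<in>I. w (f z) (f z1) * R (f z1) z2 * cnj (w (f z') z2))"
    unfolding final_kernel_def by (intro sum.cong refl sum.reindex_bij_betw[OF f])
  also have "\<dots> = final_kernel I w R (f z) (f z')"
    unfolding final_kernel_def by (rule sum.reindex_bij_betw[OF f])
  finally show ?thesis .
qed

text \<open>Since \<open>w\<close> links only points of equal energy, the energy of the output may
  be replaced by that of the input; column orthonormality then removes \<open>w\<close>. A constant
  \<open>en\<close> gives preservation of the trace.\<close>

lemma final_kernel_energy:
  assumes J: "finite J" and w: "unitary_on J w"
    and cons: "\<And>z z'. z \<in> J \<Longrightarrow> z' \<in> J \<Longrightarrow> en z \<noteq> en z' \<Longrightarrow> w z z' = 0"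
  shows "(\<Sum>z\<in>J. of_real (en z) * final_kernel J w R z z) = (\<Sum>z\<in>J. of_real (en z) * R z z)"
proof -
  have "(\<Sum>z\<in>J. of_real (en z) * final_kernel J w R z z) =
     (\<Sum>z\<in>J. \<Sum>z1\<in>J. \<Sum>z2\<in>J. of_real (en z1) * R z1 z2 * (cnj (w z z2) * w z z1))"
    unfolding final_kernel_def sum_distrib_left
  proof (intro sum.cong refl)
    fix z z1 z2 assume z: "z \<in> J" "z1 \<in> J"
    show "of_real (en z) * (w z z1 * R z1 z2 * cnj (w z z2)) = of_real (en z1) * R z1 z2 * (cnj (w z z2) * w z z1)"
      using cons[OF z] by (cases "en z = en z1") (auto simp: mult_ac)
  qed
  also have "\<dots> = (\<Sum>z1\<in>J. \<Sum>z2\<in>J. \<Sum>z\<in>J. of_real (en z1) * R z1 z2 * (cnj (w z z2) * w z z1))"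
    by (rule sum_rotate[symmetric])
  also have "\<dots> = (\<Sum>z1\<in>J. \<Sum>z2\<in>J. of_real (en z1) * R z1 z2 * of_bool (z2 = z1))"
    unfolding sum_distrib_left[symmetric] using w by (simp add: unitary_on_def)
  also have "\<dots> = (\<Sum>z\<in>J. of_real (en z) * R z z)" using J by simp
  finally show ?thesis .
qed

text \<open>Setting bit \<open>k\<close> of a string to \<open>s\<close>: with clock reading \<open>k\<close> the system is the
  \<open>k\<close>-th qubit of the string, the other qubits belong to the memory.\<close>

definition set_bit :: "nat \<Rightarrow> nat set \<Rightarrow> bool \<Rightarrow> nat set" where
  "set_bit k y s = (if s then insert k y else y)"

lemma sum_set_bit:
  fixes f :: "nat set \<Rightarrow> complex"
  assumes "k < n"
  shows "(\<Sum>x\<in>Pow {..<n}. f x) = (\<Sum>y\<in>Pow ({..<n} - {k}). \<Sum>s\<in>UNIV. f (set_bit k y s))"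
proof -
  have "{..<n} = insert k ({..<n} - {k})" using assms by auto
  then have "(\<Sum>x\<in>Pow {..<n}. f x) = (\<Sum>x\<in>Pow (insert k ({..<n} - {k})). f x)" by simp
  also have "\<dots> = (\<Sum>y\<in>Pow ({..<n} - {k}). f y + f (insert k y))" by (rule sum_Pow_insert) auto
  finally show ?thesis by (simp add: set_bit_def UNIV_bool)
qed

lemma gram_qubit_kernel:
  assumes "0 \<le> R" "R \<le> 1"
  shows "gram (qubit_kernel (R * cos \<phi>) (R * sin \<phi>))"
proof -
  have eq: "qubit_kernel (R * cos \<phi>) (R * sin \<phi>) = (\<lambda>s s'.
     (of_real (qubit_eigenvector \<phi> s True) * cnj (of_real (qubit_eigenvector \<phi> s' True))) * of_real ((1 + R) / 2) +
     (of_real (qubit_eigenvector \<phi> s False) * cnj (of_real (qubit_eigenvector \<phi> s' False))) * of_real ((1 - R) / 2))"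
    by (intro ext) (simp add: qubit_kernel_eigen mult_ac)
  show ?thesis unfolding eq using assms by (intro gram_add gram_scale gram_rank1) auto
qed

lemma qubit_kernel_trace: "qubit_kernel E c True True + qubit_kernel E c False False = 1"
  by (simp add: qubit_kernel_def field_simps)

section \<open>The cyclic family of string states held by the memory\<close>

locale ncopy =
  fixes \<beta> E c :: real and n N :: nat
    and W :: "nat set \<times> (nat \<times> nat) \<Rightarrow> nat set \<times> (nat \<times> nat) \<Rightarrow> complex"
  assumes b: "\<beta> > 0" and n: "n > 0" and qubit_kernel: "gram (qubit_kernel E c)"
    and W: "unitary_on (Pow {..<n} \<times> bath \<beta> N) W"
    and cons: "\<And>z z'. z \<in> Pow {..<n} \<times> bath \<beta> N \<Longrightarrow> z' \<in> Pow {..<n} \<times> bath \<beta> N \<Longrightarrow>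
       card (fst z) + fst (snd z) \<noteq> card (fst z') + fst (snd z') \<Longrightarrow> W z z' = 0"
begin

definition X where "X = Pow {..<n}"
definition B where "B = bath \<beta> N"
definition \<Xi> where "\<Xi> = nfinal \<beta> N n E c W"

text \<open>The state of the string when the clock shows \<open>k\<close>: fresh copies of the input below \<open>k\<close>,
  the reduced output of the \<open>n\<close>-copy protocol from \<open>k\<close> on.\<close>

definition stage :: "nat \<Rightarrow> nat set \<Rightarrow> nat set \<Rightarrow> complex" where
  "stage k x x' = product_kernel k E c x x' * (\<Sum>z\<in>Pow {..<k}. \<Xi> (z \<union> (x \<inter> {k..})) (z \<union> (x' \<inter> {k..})))"

text \<open>What remains for the memory at clock reading \<open>k\<close> once qubit
  \<open>k\<close> is handed over as the system.\<close>

definition mem :: "nat \<Rightarrow> nat set \<Rightarrow> nat set \<Rightarrow> complex" where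
  "mem k y y' = (\<Sum>s\<in>UNIV. stage k (set_bit k y s) (set_bit k y' s))"

definition M where "M = (SIGMA k:{..<n}. Pow ({..<n} - {k}))"

definition R1 where
  "R1 = (\<lambda>(y, d) (y', d'). product_kernel n E c y y' * (if d = d' then of_real (bath_weight \<beta> N d) else 0))"

lemma finX [simp]: "finite X" and finB [simp]: "finite B" and finM [simp]: "finite M"
  by (auto simp: X_def B_def M_def)

lemma nfinal_kernel: "\<Xi> x x' = (\<Sum>b\<in>B. final_kernel (X \<times> B) W R1 (x, b) (x', b))"
proof -
  have "final_kernel (X \<times> B) W R1 (x, b) (x', b) = (\<Sum>d\<in>B. \<Sum>y\<in>X. \<Sum>y'\<in>X.
     W (x, b) (y, d) * (product_kernel n E c y y' * of_real (bath_weight \<beta> N d)) * cnj (W (x', b) (y', d)))" for b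
  proof -
    have "final_kernel (X \<times> B) W R1 (x, b) (x', b) = (\<Sum>y\<in>X. \<Sum>d\<in>B. \<Sum>y'\<in>X. \<Sum>d'\<in>B. if d' = d then
     W (x, b) (y, d) * (product_kernel n E c y y' * of_real (bath_weight \<beta> N d)) * cnj (W (x', b) (y', d)) else 0)"
      unfolding final_kernel_def sum.cartesian_product' R1_def
      by (intro sum.cong refl) auto
    also have "\<dots> = (\<Sum>y\<in>X. \<Sum>d\<in>B. \<Sum>y'\<in>X.
      W (x, b) (y, d) * (product_kernel n E c y y' * of_real (bath_weight \<beta> N d)) * cnj (W (x', b) (y', d)))"
      by (intro sum.cong refl) simp
    finally show ?thesis by (simp only: sum.swap[of _ B X])
  qed
  then show ?thesis by (simp add: \<Xi>_def nfinal_def X_def B_def)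
qed

lemma \<Xi>_trace: "(\<Sum>x\<in>X. \<Xi> x x) = 1"
proof -
  have "(\<Sum>x\<in>X. \<Xi> x x) = (\<Sum>z\<in>X \<times> B. of_real 1 * final_kernel (X \<times> B) W R1 z z)"
    by (simp add: nfinal_kernel sum.cartesian_product')
  also have "\<dots> = (\<Sum>z\<in>X \<times> B. of_real 1 * R1 z z)"
    using W by (intro final_kernel_energy) (auto simp: X_def B_def)
  also have "\<dots> = (\<Sum>y\<in>X. \<Sum>d\<in>B. of_real (bernoulli ((1 + E) / 2) n y * bath_weight \<beta> N d))"
    by (simp add: sum.cartesian_product' R1_def product_kernel_diag)
  also have "\<dots> = of_real (sum (bernoulli ((1 + E) / 2) n) X * sum (bath_weight \<beta> N) B)"
    by (simp add: sum_product)
  also have "\<dots> = 1" unfolding X_def B_def sum_bernoulli sum_bath_weight[OF b] by simp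
  finally show ?thesis .
qed

lemma gram_product_kernel: "gram (product_kernel k E c)"
  unfolding product_kernel_def by (intro gram_prod gram_comp[OF qubit_kernel, where h = "\<lambda>x. _ \<in> x"])

lemma gram_\<Xi>: "gram \<Xi>"
proof -
  have "gram (\<lambda>x x'. \<Sum>b\<in>B. \<Sum>d\<in>B. \<Sum>y\<in>X. \<Sum>y'\<in>X.
     W (x, b) (y, d) * (product_kernel n E c y y' * of_real (bath_weight \<beta> N d)) * cnj (W (x', b) (y', d)))"
    by (intro gram_sum gram_congruence gram_scale bath_weight_nonneg gram_product_kernel)
  also have "(\<lambda>x x'. \<Sum>b\<in>B. \<Sum>d\<in>B. \<Sum>y\<in>X. \<Sum>y'\<in>X.
     W (x, b) (y, d) * (product_kernel n E c y y' * of_real (bath_weight \<beta> N d)) * cnj (W (x', b) (y', d))) = \<Xi>"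
    by (simp add: \<Xi>_def nfinal_def X_def B_def fun_eq_iff)
  finally show ?thesis .
qed

lemma gram_stage: "gram (stage k)"
  unfolding stage_def
  by (intro gram_mult gram_sum gram_product_kernel gram_comp[OF gram_\<Xi>, where h = "\<lambda>x. _ \<union> (x \<inter> {k..})"])

lemma gram_mem: "gram (mem k)"
  unfolding mem_def by (intro gram_sum gram_comp[OF gram_stage, where h = "\<lambda>y. set_bit k y _"])

lemma stage_0: "stage 0 x x' = \<Xi> x x'"
  by (simp add: stage_def product_kernel_def)

text \<open>With every position fresh, the output of the previous run is entirely traced out and the
  full input of the next run is ready.\<close>

lemma stage_n:
  assumes "x \<in> X" "x' \<in> X" shows "stage n x x' = product_kernel n E c x x'"
proof -
  have "x \<inter> {n..} = {}" "x' \<inter> {n..} = {}" using assms by (auto simp: X_def)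
  then show ?thesis using \<Xi>_trace by (simp add: stage_def X_def)
qed

text \<open>Tracing out qubit \<open>k\<close> of stage \<open>k\<close> extends by one position the
  block already summed over in \<open>\<Xi>\<close>, and a fresh input then fills the gap. This
  identity closes the cycle that keeps the memory marginal unchanged.\<close>

lemma stage_Suc:
  assumes k: "k \<notin> y" "k \<notin> y'"
  shows "stage (Suc k) (set_bit k y s) (set_bit k y' s') = qubit_kernel E c s s' * mem k y y'"
proof -
  have product_kernel: "product_kernel k E c (set_bit k y s) (set_bit k y' s') = product_kernel k E c y y'" for s s'
    unfolding product_kernel_def by (intro prod.cong) (auto simp: set_bit_def)
  have int: "set_bit k v s \<inter> {Suc k..} = v \<inter> {Suc k..}"
    "set_bit k v True \<inter> {k..} = insert k (v \<inter> {Suc k..})" for v s by (auto simp: set_bit_def)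
  have int': "set_bit k v False \<inter> {k..} = v \<inter> {Suc k..}" if "k \<notin> v" for v
    using that by (auto simp: set_bit_def Suc_le_eq order.order_iff_strict)
  have "product_kernel (Suc k) E c (set_bit k y s) (set_bit k y' s') = product_kernel k E c y y' * qubit_kernel E c s s'"
    unfolding product_kernel[of s s', symmetric] using k by (auto simp: product_kernel_def set_bit_def)
  moreover have "(\<Sum>z\<in>Pow {..<Suc k}. \<Xi> (z \<union> (set_bit k y s \<inter> {Suc k..})) (z \<union> (set_bit k y' s' \<inter> {Suc k..}))) =
     (\<Sum>s\<in>UNIV. \<Sum>z\<in>Pow {..<k}. \<Xi> (z \<union> (set_bit k y s \<inter> {k..})) (z \<union> (set_bit k y' s \<inter> {k..})))"
    unfolding int lessThan_Suc UNIV_bool using k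
    by (subst sum_Pow_insert) (auto simp: int int' sum.distrib)
  ultimately show ?thesis
    by (simp add: stage_def mem_def product_kernel sum_distrib_left mult_ac)
qed

lemma sum_mem_diag: "k < n \<Longrightarrow> (\<Sum>y\<in>Pow ({..<n} - {k}). mem k y y) = (\<Sum>x\<in>X. stage k x x)"
  unfolding X_def by (simp add: sum_set_bit mem_def)

lemma stage_trace: "k \<le> n \<Longrightarrow> (\<Sum>x\<in>X. stage k x x) = 1"
proof (induction k)
  case 0
  then show ?case by (simp add: stage_0 \<Xi>_trace)
next
  case (Suc k)
  hence k: "k < n" by simp
  have "(\<Sum>x\<in>X. stage (Suc k) x x) = (\<Sum>y\<in>Pow ({..<n} - {k}). \<Sum>s\<in>UNIV. qubit_kernel E c s s * mem k y y)"
    unfolding X_def sum_set_bit[OF k] by (intro sum.cong refl stage_Suc) auto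
  also have "\<dots> = (\<Sum>y\<in>Pow ({..<n} - {k}). mem k y y)"
    using qubit_kernel_trace[of E c] by (intro sum.cong refl) (simp add: UNIV_bool add.commute flip: distrib_right)
  also have "\<dots> = 1" using Suc by (simp add: sum_mem_diag)
  finally show ?case .
qed

end

section \<open>The clocked step, its marginals and its heat\<close>

lemma final_kernel_cong:
  assumes "\<And>x y. x \<in> J \<Longrightarrow> y \<in> J \<Longrightarrow> R x y = R' x y"
  shows "final_kernel J w R = final_kernel J w R'"
  unfolding final_kernel_def using assms by (intro ext sum.cong refl) simp

context ncopy
begin

text \<open>Kernels take the output first, so the advance of the clock is described by where an
  output reading came from, modulo \<open>n\<close>.\<close>

definition clock_pred :: "nat \<Rightarrow> nat" where "clock_pred k = (if k = 0 then n - 1 else k - 1)"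

definition I where "I = {..<n} \<times> (X \<times> B)"

definition \<Phi> :: "bool \<times> (nat \<times> nat set) \<times> (nat \<times> nat) \<Rightarrow> nat \<times> (nat set \<times> (nat \<times> nat))" where
  "\<Phi> = (\<lambda>(s, (k, y), e). (k, (set_bit k y s, e)))"

definition step where
  "step j = (if j = n - 1 then W else (\<lambda>v v'. of_bool (v = v')))"

text \<open>Advance the clock, applying the \<open>n\<close>-copy protocol exactly when the clock wraps around.\<close>

definition catalytic_step where
  "catalytic_step z z' = (if clock_pred (fst z) = fst z' then step (fst z') (snd z) (snd z') else 0)"

text \<open>Joint state before the step, in regrouped coordinates: the clock is uniformly random,
  and the index is \<open>Suc k\<close> because the system already fills position \<open>k\<close>
  with a fresh copy.\<close>

definition catalytic_state where
  "catalytic_state = (\<lambda>(k, (x, b)) (k', (x', b')). if k = k' then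
     stage (Suc k) x x' / of_nat n * (if b = b' then of_real (bath_weight \<beta> N b) else 0) else 0)"

lemma clock_pred_bij: "bij_betw clock_pred {..<n} {..<n}"
proof (rule bij_betw_byWitness[where f' = "\<lambda>k. if k = n - 1 then 0 else Suc k"])
  show "\<forall>a\<in>{..<n}. (if clock_pred a = n - 1 then 0 else Suc (clock_pred a)) = a" using n by (auto simp: clock_pred_def)
qed (use n in \<open>auto simp: clock_pred_def\<close>)

lemma clock_pred_less: "k < n \<Longrightarrow> clock_pred k < n" using n by (auto simp: clock_pred_def)

lemma clock_pred_eq: "k < n \<Longrightarrow> k' < n \<Longrightarrow> clock_pred k = clock_pred k' \<longleftrightarrow> k = k'"
  using bij_betw_imp_inj_on[OF clock_pred_bij] by (auto simp: inj_on_def)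

lemma finI [simp]: "finite I" by (simp add: I_def)

lemma unitary_step: "unitary_on (X \<times> B) (step j)"
  unfolding step_def using W unitary_on_id[of "X \<times> B"] by (auto simp: X_def B_def)

text \<open>A direct sum over input clock readings, followed by a permutation of the output
  readings.\<close>

lemma unitary_catalytic_step: "unitary_on I catalytic_step"
proof -
  define D where "D z z' = (if fst z = fst z' then step (fst z) (snd z) (snd z') else 0)"
    for z z' :: "nat \<times> (nat set \<times> (nat \<times> nat))"
  have "unitary_on I D"
    unfolding D_def
  proof (rule unitary_on_direct_sum[where t = fst and w = "\<lambda>\<tau> z z'. step \<tau> (snd z) (snd z')"])
    fix \<tau> assume "\<tau> \<in> fst ` I"
    hence "\<tau> < n" by (auto simp: I_def simp del: fst_image_times)
    hence "bij_betw snd {z\<in>I. fst z = \<tau>} (X \<times> B)"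
      by (intro bij_betw_byWitness[where f' = "\<lambda>v. (\<tau>, v)"]) (auto simp: I_def)
    then show "unitary_on {z\<in>I. fst z = \<tau>} (\<lambda>z z'. step \<tau> (snd z) (snd z'))"
      by (rule unitary_on_transport[OF _ unitary_step])
  qed simp
  moreover have "bij_betw (map_prod clock_pred id) I I"
    unfolding I_def by (intro bij_betw_map_prod clock_pred_bij bij_betw_id)
  ultimately have "unitary_on I (\<lambda>x y. D (map_prod clock_pred id x) y)" by (rule unitary_on_permute_rows[rotated])
  moreover have "(\<lambda>x y. D (map_prod clock_pred id x) y) = catalytic_step"
    by (auto simp: fun_eq_iff D_def catalytic_step_def)
  ultimately show ?thesis by simp
qed

lemma \<Phi>_bij: "bij_betw \<Phi> (UNIV \<times> M \<times> B) I"
proof (rule bij_betw_byWitness[where f' = "\<lambda>(k, (x, e)). (k \<in> x, (k, x - {k}), e)"])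
  show "\<forall>a\<in>UNIV \<times> M \<times> B. (\<lambda>(k, (x, e)). (k \<in> x, (k, x - {k}), e)) (\<Phi> a) = a"
    by (auto simp: \<Phi>_def M_def set_bit_def)
  show "\<forall>a'\<in>I. \<Phi> ((\<lambda>(k, (x, e)). (k \<in> x, (k, x - {k}), e)) a') = a'"
    by (auto simp: \<Phi>_def I_def set_bit_def)
  show "\<Phi> ` (UNIV \<times> M \<times> B) \<subseteq> I"
    by (auto simp: \<Phi>_def M_def I_def X_def set_bit_def split: if_splits)
  show "(\<lambda>(k, (x, e)). (k \<in> x, (k, x - {k}), e)) ` I \<subseteq> UNIV \<times> M \<times> B"
    by (auto simp: M_def I_def X_def)
qed

lemma final_catalytic_step:
  assumes k: "k < n" "k' < n"
  shows "final_kernel I catalytic_step catalytic_state (k, v) (k', v') =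
    (\<Sum>v1\<in>X \<times> B. \<Sum>v2\<in>X \<times> B. step (clock_pred k) v v1 * catalytic_state (clock_pred k, v1) (clock_pred k', v2) * cnj (step (clock_pred k') v' v2))"
proof -
  have red: "(\<Sum>z\<in>I. if clock_pred j = fst z then F (fst z) (snd z) else 0) = (\<Sum>v1\<in>X \<times> B. F (clock_pred j) v1)"
    if "j < n" for j and F :: "nat \<Rightarrow> nat set \<times> (nat \<times> nat) \<Rightarrow> complex"
  proof -
    have "(\<Sum>z\<in>I. if clock_pred j = fst z then F (fst z) (snd z) else 0) =
       (\<Sum>i<n. if i = clock_pred j then \<Sum>v1\<in>X \<times> B. F i v1 else 0)"
      unfolding I_def sum.cartesian_product' by (intro sum.cong refl) auto
    then show ?thesis using clock_pred_less[OF that] by simp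
  qed
  have "final_kernel I catalytic_step catalytic_state (k, v) (k', v') =
     (\<Sum>z1\<in>I. if clock_pred k = fst z1 then \<Sum>z2\<in>I. if clock_pred k' = fst z2 then
       step (fst z1) v (snd z1) * catalytic_state (fst z1, snd z1) (fst z2, snd z2) * cnj (step (fst z2) v' (snd z2)) else 0 else 0)"
    unfolding final_kernel_def by (intro sum.cong refl) (auto simp: catalytic_step_def intro!: sum.cong)
  also have "\<dots> = (\<Sum>v1\<in>X \<times> B. \<Sum>v2\<in>X \<times> B. step (clock_pred k) v v1 * catalytic_state (clock_pred k, v1) (clock_pred k', v2) * cnj (step (clock_pred k') v' v2))"
    unfolding red[OF k(1), where F = "\<lambda>j w1. \<Sum>z2\<in>I. if clock_pred k' = fst z2 then
       step j v w1 * catalytic_state (j, w1) (fst z2, snd z2) * cnj (step (fst z2) v' (snd z2)) else 0"]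
    by (intro sum.cong refl red[OF k(2), where F = "\<lambda>j w2. step (clock_pred k) v _ * catalytic_state (clock_pred k, _) (j, w2) * cnj (step j v' w2)"])
  finally show ?thesis .
qed

text \<open>The initial state is diagonal in the clock and the clock is merely permuted, so
  coherences between readings never appear.\<close>

lemma final_catalytic_step_off: "k < n \<Longrightarrow> k' < n \<Longrightarrow> k \<noteq> k' \<Longrightarrow> final_kernel I catalytic_step catalytic_state (k, v) (k', v') = 0"
  unfolding final_catalytic_step by (intro sum.neutral) (auto simp: catalytic_state_def clock_pred_eq)

lemma final_catalytic_step_0:
  assumes "v \<in> X \<times> B" "v' \<in> X \<times> B"
  shows "final_kernel I catalytic_step catalytic_state (0, v) (0, v') = final_kernel (X \<times> B) W R1 v v' / of_nat n"
proof -
  have S: "Suc (n - 1) = n" using n by simp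
  have "final_kernel I catalytic_step catalytic_state (0, v) (0, v') =
    (\<Sum>v1\<in>X \<times> B. \<Sum>v2\<in>X \<times> B. (W v v1 * R1 v1 v2 * cnj (W v' v2)) / of_nat n)"
    unfolding final_catalytic_step[OF n n]
    by (intro sum.cong refl) (auto simp: clock_pred_def step_def catalytic_state_def R1_def S stage_n)
  then show ?thesis by (simp add: final_kernel_def sum_divide_distrib)
qed

lemma final_catalytic_step_pos:
  assumes "0 < k" "k < n" "(x, b) \<in> X \<times> B" "(x', b') \<in> X \<times> B"
  shows "final_kernel I catalytic_step catalytic_state (k, (x, b)) (k, (x', b')) =
     stage k x x' / of_nat n * (if b = b' then of_real (bath_weight \<beta> N b) else 0)"
proof -
  have pk: "clock_pred k = k - 1" "k - 1 \<noteq> n - 1" "Suc (k - 1) = k" using assms by (auto simp: clock_pred_def)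
  have st: "step (k - 1) = (\<lambda>v v'. of_bool (v = v'))" unfolding step_def using pk(2) by (simp only: if_False)
  have "final_kernel I catalytic_step catalytic_state (k, (x, b)) (k, (x', b')) =
    (\<Sum>v1\<in>X \<times> B. \<Sum>v2\<in>X \<times> B. of_bool ((x, b) = v1) * (of_bool ((x', b') = v2) * catalytic_state (k - 1, v1) (k - 1, v2)))"
    unfolding final_catalytic_step[OF assms(2,2)] pk(1) st by (intro sum.cong refl) (simp add: mult_ac)
  also have "\<dots> = catalytic_state (k - 1, (x, b)) (k - 1, (x', b'))"
    using assms by (simp only: sum_distrib_left[symmetric] sum_of_bool_mult_left finite_cartesian_product finX finB)
  finally show ?thesis using pk by (simp add: catalytic_state_def)
qed

text \<open>Reading \<open>k\<close> inherits stage \<open>k\<close>: for \<open>k > 0\<close>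
  because only the clock has moved, for \<open>k = 0\<close> because the protocol maps stage
  \<open>n\<close> to \<open>\<Xi>\<close>, which is stage 0.\<close>

lemma final_catalytic_step_marginal:
  assumes k: "k < n" and x: "x \<in> X" "x' \<in> X"
  shows "(\<Sum>b\<in>B. final_kernel I catalytic_step catalytic_state (k, (x, b)) (k, (x', b))) = stage k x x' / of_nat n"
proof (cases "k = 0")
  case True
  then show ?thesis using x
    by (simp add: final_catalytic_step_0 stage_0 nfinal_kernel sum_divide_distrib)
next
  case False
  hence "(\<Sum>b\<in>B. final_kernel I catalytic_step catalytic_state (k, (x, b)) (k, (x', b))) =
     (\<Sum>b\<in>B. stage k x x' / of_nat n * of_real (bath_weight \<beta> N b))"
    using k x by (intro sum.cong refl) (subst final_catalytic_step_pos; simp)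
  also have "\<dots> = stage k x x' / of_nat n * of_real (sum (bath_weight \<beta> N) B)"
    unfolding of_real_sum sum_distrib_left ..
  finally show ?thesis by (simp add: B_def sum_bath_weight[OF b])
qed

text \<open>The bath is touched only in the branch of probability \<open>1 / n\<close> where the
  clock wraps around, and keeps its Gibbs weights in the others. This is where the heat gets divided
  by \<open>n\<close>.\<close>

lemma final_catalytic_step_bath:
  assumes "e \<in> B"
  shows "(\<Sum>k<n. \<Sum>x\<in>X. final_kernel I catalytic_step catalytic_state (k, (x, e)) (k, (x, e))) =
     (\<Sum>x\<in>X. final_kernel (X \<times> B) W R1 (x, e) (x, e)) / of_nat n + of_real ((1 - 1 / n) * bath_weight \<beta> N e)"
proof -
  have "(\<Sum>k<n. \<Sum>x\<in>X. final_kernel I catalytic_step catalytic_state (k, (x, e)) (k, (x, e))) =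
    (\<Sum>x\<in>X. final_kernel I catalytic_step catalytic_state (0, (x, e)) (0, (x, e))) +
    (\<Sum>k\<in>{..<n} - {0}. \<Sum>x\<in>X. final_kernel I catalytic_step catalytic_state (k, (x, e)) (k, (x, e)))"
    using n by (intro sum.remove) auto
  also have "(\<Sum>x\<in>X. final_kernel I catalytic_step catalytic_state (0, (x, e)) (0, (x, e))) =
      (\<Sum>x\<in>X. final_kernel (X \<times> B) W R1 (x, e) (x, e)) / of_nat n"
    unfolding sum_divide_distrib using assms by (intro sum.cong refl final_catalytic_step_0) auto
  also have "(\<Sum>k\<in>{..<n} - {0}. \<Sum>x\<in>X. final_kernel I catalytic_step catalytic_state (k, (x, e)) (k, (x, e))) =
      (\<Sum>k\<in>{..<n} - {0}. of_real (bath_weight \<beta> N e) / of_nat n)"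
  proof (rule sum.cong[OF refl])
    fix k assume k: "k \<in> {..<n} - {0}"
    have "(\<Sum>x\<in>X. final_kernel I catalytic_step catalytic_state (k, (x, e)) (k, (x, e))) =
      (\<Sum>x\<in>X. stage k x x / of_nat n * of_real (bath_weight \<beta> N e))"
      using k assms by (intro sum.cong refl) (subst final_catalytic_step_pos; simp)
    also have "\<dots> = (\<Sum>x\<in>X. stage k x x) * (of_real (bath_weight \<beta> N e) / of_nat n)"
      unfolding sum_distrib_right by (intro sum.cong refl) simp
    finally show "(\<Sum>x\<in>X. final_kernel I catalytic_step catalytic_state (k, (x, e)) (k, (x, e))) = of_real (bath_weight \<beta> N e) / of_nat n"
      using k by (simp add: stage_trace)
  qed
  also have "\<dots> = of_real ((1 - 1 / n) * bath_weight \<beta> N e)"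
    using n by (simp add: of_nat_diff field_simps)
  finally show ?thesis .
qed

text \<open>Conservation of \<open>2 * card x + 2 * level\<close> equates the gain of the bath with
  the loss of the string; \<open>n * (1 + E)\<close> is the initial mean of
  \<open>2 * card x\<close>.\<close>

lemma protocol_energy:
  "(\<Sum>b\<in>B. 2 * real (fst b) * (Re (\<Sum>x\<in>X. final_kernel (X \<times> B) W R1 (x, b) (x, b)) - bath_weight \<beta> N b)) =
   n * (1 + E) - (\<Sum>x\<in>X. 2 * real (card x) * Re (\<Xi> x x))"
proof -
  define F where "F x b = Re (final_kernel (X \<times> B) W R1 (x, b) (x, b))" for x b
  define g where "g = bath_weight \<beta> N"
  define l where "l = bernoulli ((1 + E) / 2) n"
  define en where "en z = 2 * real (card (fst z)) + 2 * real (fst (snd z))" for z :: "nat set \<times> (nat \<times> nat)"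
  have "(\<Sum>z\<in>X \<times> B. of_real (en z) * final_kernel (X \<times> B) W R1 z z) = (\<Sum>z\<in>X \<times> B. of_real (en z) * R1 z z)"
  proof (rule final_kernel_energy)
    show "unitary_on (X \<times> B) W" using W by (simp add: X_def B_def)
    show "W z z' = 0" if "z \<in> X \<times> B" "z' \<in> X \<times> B" "en z \<noteq> en z'" for z z'
      using cons[of z z'] that by (auto simp: X_def B_def en_def)
  qed simp
  hence "Re (\<Sum>z\<in>X \<times> B. of_real (en z) * final_kernel (X \<times> B) W R1 z z) = Re (\<Sum>z\<in>X \<times> B. of_real (en z) * R1 z z)"
    by simp
  hence eq: "(\<Sum>x\<in>X. \<Sum>b\<in>B. (2 * real (card x) + 2 * real (fst b)) * F x b) =
     (\<Sum>x\<in>X. \<Sum>b\<in>B. (2 * real (card x) + 2 * real (fst b)) * (l x * g b))"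
    unfolding Re_sum by (simp add: sum.cartesian_product' en_def F_def R1_def product_kernel_diag l_def g_def)
  have l1: "sum l X = 1" unfolding l_def X_def by (rule sum_bernoulli)
  have g1: "sum g B = 1" unfolding g_def B_def by (rule sum_bath_weight[OF b])
  have lm: "(\<Sum>x\<in>X. 2 * real (card x) * l x) = n * (1 + E)"
  proof -
    have "0 = (\<Sum>x\<in>X. l x * (real (card x) - n * ((1 + E) / 2)))"
      unfolding l_def X_def by (rule bernoulli_mean[symmetric])
    also have "\<dots> = (\<Sum>x\<in>X. l x * real (card x)) - sum l X * (n * ((1 + E) / 2))"
      by (simp only: right_diff_distrib sum_subtractf sum_distrib_right)
    finally have "(\<Sum>x\<in>X. l x * real (card x)) = n * (1 + E) / 2" by (simp add: l1)
    then have "2 * (\<Sum>x\<in>X. l x * real (card x)) = n * (1 + E)" by simp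
    then show ?thesis by (simp add: sum_distrib_left mult_ac)
  qed
  have "(\<Sum>x\<in>X. \<Sum>b\<in>B. (2 * real (card x) + 2 * real (fst b)) * F x b) =
     (\<Sum>x\<in>X. \<Sum>b\<in>B. 2 * real (card x) * F x b) + (\<Sum>x\<in>X. \<Sum>b\<in>B. 2 * real (fst b) * F x b)"
    by (simp add: distrib_right sum.distrib)
  also have "(\<Sum>x\<in>X. \<Sum>b\<in>B. 2 * real (fst b) * F x b) = (\<Sum>b\<in>B. \<Sum>x\<in>X. 2 * real (fst b) * F x b)"
    by (rule sum.swap)
  finally have 1: "(\<Sum>x\<in>X. \<Sum>b\<in>B. (2 * real (card x) + 2 * real (fst b)) * F x b) =
     (\<Sum>x\<in>X. 2 * real (card x) * (\<Sum>b\<in>B. F x b)) + (\<Sum>b\<in>B. 2 * real (fst b) * (\<Sum>x\<in>X. F x b))"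
    by (simp only: sum_distrib_left)
  have "(\<Sum>x\<in>X. \<Sum>b\<in>B. (2 * real (card x) + 2 * real (fst b)) * (l x * g b)) =
     (\<Sum>x\<in>X. 2 * real (card x) * l x * sum g B) + (\<Sum>x\<in>X. l x * (\<Sum>b\<in>B. 2 * real (fst b) * g b))"
    unfolding sum_distrib_left sum.distrib[symmetric] by (intro sum.cong refl) (simp add: algebra_simps)
  also have "\<dots> = n * (1 + E) + (\<Sum>b\<in>B. 2 * real (fst b) * g b)"
    by (simp add: g1 lm l1 flip: sum_distrib_right)
  finally have 2: "(\<Sum>x\<in>X. \<Sum>b\<in>B. (2 * real (card x) + 2 * real (fst b)) * (l x * g b)) =
    n * (1 + E) + (\<Sum>b\<in>B. 2 * real (fst b) * g b)" .
  have X: "Re (\<Xi> x x) = (\<Sum>b\<in>B. F x b)" for x by (simp add: nfinal_kernel F_def)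
  show ?thesis
    using eq unfolding 1 2 X by (simp add: F_def g_def right_diff_distrib sum_subtractf)
qed

lemma card_set_bit: "y \<in> Pow ({..<n} - {k}) \<Longrightarrow> card (set_bit k y s) = card y + of_bool s"
proof -
  assume y: "y \<in> Pow ({..<n} - {k})"
  hence "finite y" "k \<notin> y" using finite_subset[of y "{..<n} - {k}"] by auto
  then show ?thesis by (simp add: set_bit_def)
qed

lemma catalytic_step_heat:
  "E - (\<Sum>x\<in>Pow {..<n}. Re (\<Xi> x x) * (2 * card x / n - 1)) \<in> heats \<beta> pauliZ (qubit_matrix (qubit_kernel E c))"
proof -
  \<comment> \<open>The clock carries no energy, so advancing it is free.\<close>
  define hM where "hM = (\<lambda>(k :: nat, y :: nat set). 2 * real (card y))"
  define hB where "hB = (\<lambda>b :: nat \<times> nat. 2 * real (fst b))"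
  define \<rho>M where "\<rho>M = (\<lambda>(k, y) (k', y'). if k = k' then mem k y y' / of_nat n else 0)"
  define u where "u z z' = catalytic_step (\<Phi> z) (\<Phi> z')" for z z'
  define fin where "fin = final_kernel (UNIV \<times> M \<times> B) u
        (\<lambda>(s, m, b) (s', m', b'). qubit_kernel E c s s' * \<rho>M m m' * (if b = b' then of_real (bath_weight \<beta> N b) else 0))"
  have Rc: "(\<lambda>(s, m, b) (s', m', b'). qubit_kernel E c s s' * \<rho>M m m' * (if b = b' then of_real (bath_weight \<beta> N b) else 0)) z z'
     = catalytic_state (\<Phi> z) (\<Phi> z')" if "z \<in> UNIV \<times> M \<times> B" "z' \<in> UNIV \<times> M \<times> B" for z z'
  proof -
    obtain s k y b where z: "z = (s, (k, y), b)" by (cases z) auto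
    obtain s' k' y' b' where z': "z' = (s', (k', y'), b')" by (cases z') auto
    have "k \<notin> y" "k' \<notin> y'" using that by (auto simp: z z' M_def)
    then show ?thesis by (auto simp: z z' catalytic_state_def \<Phi>_def \<rho>M_def stage_Suc)
  qed
  have fin: "fin z z' = final_kernel I catalytic_step catalytic_state (\<Phi> z) (\<Phi> z')" for z z'
  proof -
    have "fin = final_kernel (UNIV \<times> M \<times> B) u (\<lambda>z z'. catalytic_state (\<Phi> z) (\<Phi> z'))"
      unfolding fin_def by (rule final_kernel_cong) (rule Rc)
    then show ?thesis unfolding u_def by (simp only: final_kernel_transport[OF \<Phi>_bij])
  qed
  have M_ne: "M \<noteq> {}" and B_ne: "B \<noteq> {}"
  proof -
    have "(0, {}) \<in> M" using n by (simp add: M_def)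
    then show "M \<noteq> {}" by blast
    show "B \<noteq> {}" using sum_bath_weight[OF b, of N] by (auto simp: B_def)
  qed
  have sumM: "(\<Sum>m\<in>M. f m) = (\<Sum>k<n. \<Sum>y\<in>Pow ({..<n} - {k}). f (k, y))" for f :: "nat \<times> nat set \<Rightarrow> complex"
    unfolding M_def by (simp add: sum.Sigma)
  have set_bit_in: "set_bit k y s \<in> X" if "k < n" "y \<in> Pow ({..<n} - {k})" for k y s
    using that by (auto simp: set_bit_def X_def)
  have bath: "(\<Sum>s\<in>UNIV. \<Sum>m\<in>M. fin (s, m, b) (s, m, b)) =
      (\<Sum>x\<in>X. final_kernel (X \<times> B) W R1 (x, b) (x, b)) / of_nat n + of_real ((1 - 1 / n) * bath_weight \<beta> N b)"
    if "b \<in> B" for b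
  proof -
    have "(\<Sum>s\<in>UNIV. \<Sum>m\<in>M. fin (s, m, b) (s, m, b)) = (\<Sum>m\<in>M. \<Sum>s\<in>UNIV. fin (s, m, b) (s, m, b))"
      by (rule sum.swap)
    also have "\<dots> = (\<Sum>k<n. \<Sum>y\<in>Pow ({..<n} - {k}). \<Sum>s\<in>UNIV.
        final_kernel I catalytic_step catalytic_state (k, (set_bit k y s, b)) (k, (set_bit k y s, b)))"
      unfolding sumM fin \<Phi>_def by simp
    also have "\<dots> = (\<Sum>k<n. \<Sum>x\<in>X. final_kernel I catalytic_step catalytic_state (k, (x, b)) (k, (x, b)))"
      unfolding X_def by (intro sum.cong refl sum_set_bit[symmetric]) simp
    finally show ?thesis unfolding final_catalytic_step_bath[OF that] .
  qed
  have "(\<Sum>b\<in>B. hB b * (Re (\<Sum>s\<in>UNIV. \<Sum>m\<in>M. fin (s, m, b) (s, m, b)) - bath_weight \<beta> N b))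
     \<in> heats \<beta> pauliZ (qubit_matrix (qubit_kernel E c))"
  proof (rule heats_intro[OF finM M_ne finB B_ne, where \<rho>M = \<rho>M and hM = hM and u = u and \<gamma> = "bath_weight \<beta> N" and fin = fin and \<rho> = "qubit_kernel E c" and hB = hB])
    have herm: "cnj (mem k y y') = mem k y' y" for k y y' by (rule gram_hermitian[OF gram_mem])
    show "cnj (\<rho>M m m') = \<rho>M m' m" for m m'
      by (cases m; cases m') (auto simp: \<rho>M_def herm)
    show "0 \<le> Re (\<Sum>m\<in>M. \<Sum>m'\<in>M. cnj (v m) * \<rho>M m m' * v m')" for v
    proof -
      have "(\<Sum>m\<in>M. \<Sum>m'\<in>M. cnj (v m) * \<rho>M m m' * v m') =
        (\<Sum>k<n. \<Sum>y\<in>Pow ({..<n} - {k}). \<Sum>k'<n. if k' = k then \<Sum>y'\<in>Pow ({..<n} - {k}).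
           (cnj (v (k, y)) * mem k y y' * v (k, y')) / of_nat n else 0)"
        unfolding sumM by (intro sum.cong refl) (auto simp: \<rho>M_def intro!: sum.cong sum.neutral)
      also have "\<dots> = (\<Sum>k<n. (\<Sum>y\<in>Pow ({..<n} - {k}). \<Sum>y'\<in>Pow ({..<n} - {k}).
           cnj (v (k, y)) * mem k y y' * v (k, y')) / of_nat n)"
        by (simp add: sum_divide_distrib)
      finally have eq: "(\<Sum>m\<in>M. \<Sum>m'\<in>M. cnj (v m) * \<rho>M m m' * v m') = \<dots>" .
      have "0 \<le> (\<Sum>k<n. Re (\<Sum>y\<in>Pow ({..<n} - {k}). \<Sum>y'\<in>Pow ({..<n} - {k}).
           cnj (v (k, y)) * mem k y y' * v (k, y')) / n)"
        by (intro sum_nonneg divide_nonneg_nonneg gram_psd[OF gram_mem]) simp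
      then show ?thesis unfolding eq Re_sum Re_divide_of_nat .
    qed
    show "(\<Sum>m\<in>M. \<rho>M m m) = 1"
    proof -
      have "(\<Sum>m\<in>M. \<rho>M m m) = (\<Sum>k<n. (\<Sum>y\<in>Pow ({..<n} - {k}). mem k y y) / of_nat n)"
        unfolding sumM by (simp add: \<rho>M_def sum_divide_distrib)
      also have "\<dots> = (\<Sum>k<n. 1 / of_nat n)"
        by (intro sum.cong refl) (simp add: sum_mem_diag stage_trace del: Pow_iff)
      also have "\<dots> = 1" using n by simp
      finally show ?thesis .
    qed
    show "unitary_on (UNIV \<times> M \<times> B) u"
      unfolding u_def by (rule unitary_on_transport[OF \<Phi>_bij unitary_catalytic_step])
    show "u (s, m, b) (s', m', b') = 0"
      if "m \<in> M" "m' \<in> M" "b \<in> B" "b' \<in> B"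
        "(if s then 1 else - 1) + hM m + hB b \<noteq> (if s' then 1 else - 1) + hM m' + hB b'" for s m b s' m' b'
    proof -
      obtain k y k' y' where m: "m = (k, y)" "m' = (k', y')" by (cases m; cases m') auto
      have k: "k < n" "k' < n" "y \<in> Pow ({..<n} - {k})" "y' \<in> Pow ({..<n} - {k'})" using that by (auto simp: m M_def)
      \<comment> \<open>The system levels -1 and 1 are 0 and 2 shifted by one, so the total energy
        is twice the number of quanta minus 1, whichever qubit plays the system.\<close>
      have "(if s then 1 else - 1) + hM m + hB b = 2 * real (card (set_bit k y s) + fst b) - 1"
        "(if s' then 1 else - 1) + hM m' + hB b' = 2 * real (card (set_bit k' y' s') + fst b') - 1"
        by (simp_all add: m hM_def hB_def card_set_bit[OF k(3)] card_set_bit[OF k(4)])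
      hence ne: "card (set_bit k y s) + fst b \<noteq> card (set_bit k' y' s') + fst b'" using that(5) by auto
      hence "W (set_bit k y s, b) (set_bit k' y' s', b') = 0"
        using cons[of "(set_bit k y s, b)" "(set_bit k' y' s', b')"] that k set_bit_in by (auto simp: X_def B_def)
      then show ?thesis using ne by (auto simp: u_def catalytic_step_def \<Phi>_def m step_def)
    qed
    show "bath_weight \<beta> N b = exp (- (\<beta> * hB b)) / (\<Sum>b\<in>B. exp (- (\<beta> * hB b)))" for b
      by (simp add: bath_weight_def B_def hB_def)
    show "fin = final_kernel (UNIV \<times> M \<times> B) u
        (\<lambda>(s, m, b) (s', m', b'). qubit_kernel E c s s' * \<rho>M m m' * (if b = b' then of_real (bath_weight \<beta> N b) else 0))"
      by (rule fin_def)
    show "(\<Sum>s\<in>UNIV. \<Sum>b\<in>B. fin (s, m, b) (s, m', b)) = \<rho>M m m'" if "m \<in> M" "m' \<in> M" for m m'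
    proof -
      obtain k y k' y' where m: "m = (k, y)" "m' = (k', y')" by (cases m; cases m') auto
      have k: "k < n" "k' < n" "y \<in> Pow ({..<n} - {k})" "y' \<in> Pow ({..<n} - {k'})" using that by (auto simp: m M_def)
      show ?thesis
      proof (cases "k = k'")
        case True
        have "(\<Sum>s\<in>UNIV. \<Sum>b\<in>B. fin (s, m, b) (s, m', b)) =
          (\<Sum>s\<in>UNIV. \<Sum>b\<in>B. final_kernel I catalytic_step catalytic_state (k, (set_bit k y s, b)) (k, (set_bit k y' s, b)))"
          unfolding fin m True by (simp add: \<Phi>_def)
        also have "\<dots> = (\<Sum>s\<in>UNIV. stage k (set_bit k y s) (set_bit k y' s) / of_nat n)"
          using k True by (intro sum.cong refl final_catalytic_step_marginal set_bit_in) auto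
        finally show ?thesis using True by (simp add: m \<rho>M_def mem_def sum_divide_distrib)
      next
        case False
        then show ?thesis using k by (simp add: fin m \<Phi>_def final_catalytic_step_off \<rho>M_def)
      qed
    qed
  qed
  also have "(\<Sum>b\<in>B. hB b * (Re (\<Sum>s\<in>UNIV. \<Sum>m\<in>M. fin (s, m, b) (s, m, b)) - bath_weight \<beta> N b)) =
    (\<Sum>b\<in>B. 2 * real (fst b) * (Re (\<Sum>x\<in>X. final_kernel (X \<times> B) W R1 (x, b) (x, b)) - bath_weight \<beta> N b)) / n"
    unfolding sum_divide_distrib
  proof (rule sum.cong[OF refl])
    fix b assume bB: "b \<in> B"
    show "hB b * (Re (\<Sum>s\<in>UNIV. \<Sum>m\<in>M. fin (s, m, b) (s, m, b)) - bath_weight \<beta> N b) =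
       2 * real (fst b) * (Re (\<Sum>x\<in>X. final_kernel (X \<times> B) W R1 (x, b) (x, b)) - bath_weight \<beta> N b) / n"
      unfolding bath[OF bB] plus_complex.sel Re_complex_of_real Re_divide_of_nat hB_def
      using n by (simp add: field_simps)
  qed
  also have "\<dots> = (1 + E) - (\<Sum>x\<in>X. 2 * real (card x) * Re (\<Xi> x x)) / n"
    unfolding protocol_energy using n by (simp add: diff_divide_distrib)
  also have "\<dots> = E - (\<Sum>x\<in>Pow {..<n}. Re (\<Xi> x x) * (2 * card x / n - 1))"
  proof -
    have "(\<Sum>x\<in>X. Re (\<Xi> x x)) = 1" using arg_cong[OF \<Xi>_trace, of Re] by simp
    then have "(\<Sum>x\<in>X. Re (\<Xi> x x) * (2 * card x / n - 1)) = (\<Sum>x\<in>X. 2 * real (card x) * Re (\<Xi> x x)) / n - 1"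
      by (simp add: right_diff_distrib sum_subtractf sum_divide_distrib mult_ac)
    then show ?thesis by (simp add: X_def)
  qed
  finally show ?thesis .
qed

end

text \<open>The one-copy heat is the initial energy minus the mean final energy density of the
  n-copy string, and the protocol brings that density within \<open>\<epsilon>\<close> of
  \<open>e\<close>.\<close>

theorem heats_achievable:
  fixes \<beta> R \<phi> e \<epsilon> :: real
  assumes b: "\<beta> > 0" and R: "0 \<le> R" "R \<le> 1" and e: "-1 < e" "e < 1" and eps: "\<epsilon> > 0"
    and gap: "binary_entropy ((1 + R) / 2) + \<beta> * (e - R * cos \<phi>) < binary_entropy ((1 + e) / 2)"
  shows "\<exists>Q\<in>heats \<beta> pauliZ (qubit_matrix (qubit_kernel (R * cos \<phi>) (R * sin \<phi>))). \<bar>Q - (R * cos \<phi> - e)\<bar> \<le> \<epsilon>"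
proof -
  show ?thesis
  proof (rule ncopy_protocol[OF b R e eps gap])
    fix n N W
    assume n: "n > 0" and W: "unitary_on (Pow {..<n} \<times> bath \<beta> N) W"
      and cons: "\<And>z z'. z \<in> Pow {..<n} \<times> bath \<beta> N \<Longrightarrow> z' \<in> Pow {..<n} \<times> bath \<beta> N \<Longrightarrow>
         card (fst z) + fst (snd z) \<noteq> card (fst z') + fst (snd z') \<Longrightarrow> W z z' = 0"
      and fin: "\<bar>(\<Sum>x\<in>Pow {..<n}. Re (nfinal \<beta> N n (R * cos \<phi>) (R * sin \<phi>) W x x) * (2 * card x / n - 1)) - e\<bar> \<le> \<epsilon>"
    interpret ncopy \<beta> "R * cos \<phi>" "R * sin \<phi>" n N W
      using b n gram_qubit_kernel[OF R] W cons by unfold_locales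
    show ?thesis
    proof (rule bexI[OF _ catalytic_step_heat[unfolded \<Xi>_def]])
      show "\<bar>R * cos \<phi> - (\<Sum>x\<in>Pow {..<n}. Re (nfinal \<beta> N n (R * cos \<phi>) (R * sin \<phi>) W x x) *
         (2 * card x / n - 1)) - (R * cos \<phi> - e)\<bar> \<le> \<epsilon>"
        using fin by linarith
    qed
  qed
qed

subsection \<open>Conjugation and partial traces\<close>

lemma mat_adjoint_carrier [simp]: "A \<in> carrier_mat n m \<Longrightarrow> mat_adjoint A \<in> carrier_mat m (n :: nat)"
  for A :: "complex mat"
  by (intro carrier_matI) auto

lemma mat_adjoint_adjoint [simp]: "mat_adjoint (mat_adjoint A) = (A :: complex mat)"
  by (rule eq_matI) auto

lemma square_mult_carrier [simp]:
  "A \<in> carrier_mat n n \<Longrightarrow> B \<in> carrier_mat n n \<Longrightarrow> A * B \<in> carrier_mat n n"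
  by (rule mult_carrier_mat)

lemma square_mult_assoc:
  "A \<in> carrier_mat n n \<Longrightarrow> B \<in> carrier_mat n n \<Longrightarrow> C \<in> carrier_mat n n \<Longrightarrow> A * B * C = A * (B * C)"
  by (rule assoc_mult_mat)

lemma mat_adjoint_mult:
  fixes A B :: "complex mat"
  assumes "A \<in> carrier_mat n m" "B \<in> carrier_mat m k"
  shows "mat_adjoint (A * B) = mat_adjoint B * mat_adjoint A"
  using assms by (intro eq_matI) (auto simp: index_mult_mat_sum mult.commute simp del: index_mult_mat(1))

lemma mat_adjoint_one [simp]: "mat_adjoint (1\<^sub>m n :: complex mat) = 1\<^sub>m n"
  by (rule eq_matI) auto

lemma mtrace_mult_commute:
  assumes "A \<in> carrier_mat n m" "B \<in> carrier_mat m n"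
  shows "mtrace (A * B) = mtrace (B * A)"
proof -
  have "mtrace (A * B) = (\<Sum>i<n. \<Sum>k<m. A $$ (i, k) * B $$ (k, i))"
    using assms unfolding mtrace_def by (intro sum.cong) (auto simp: index_mult_mat_sum simp del: index_mult_mat(1))
  also have "\<dots> = (\<Sum>k<m. \<Sum>i<n. B $$ (k, i) * A $$ (i, k))"
    by (subst sum.swap) (simp add: mult.commute)
  also have "\<dots> = mtrace (B * A)"
    using assms unfolding mtrace_def by (intro sum.cong) (auto simp: index_mult_mat_sum simp del: index_mult_mat(1))
  finally show ?thesis .
qed

lemma mtrace_add: "A \<in> carrier_mat n n \<Longrightarrow> B \<in> carrier_mat n n \<Longrightarrow> mtrace (A + B) = mtrace A + mtrace B"
  by (simp add: mtrace_def sum.distrib)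

lemma mtrace_minus: "A \<in> carrier_mat n n \<Longrightarrow> B \<in> carrier_mat n n \<Longrightarrow> mtrace (A - B) = mtrace A - mtrace B"
  by (simp add: mtrace_def sum_subtractf)

lemma unitaryD:
  assumes "unitary n U"
  shows "U \<in> carrier_mat n n" "mat_adjoint U \<in> carrier_mat n n" "U * mat_adjoint U = 1\<^sub>m n" "mat_adjoint U * U = 1\<^sub>m n"
  using assms by (auto simp: unitary_def)

lemma unitary_adjoint: "unitary n U \<Longrightarrow> unitary n (mat_adjoint U)"
  by (simp add: unitary_def)

lemma unitary_one: "unitary n (1\<^sub>m n)" by (simp add: unitary_def)

lemma unitary_mult:
  assumes "unitary n U" "unitary n V"
  shows "unitary n (U * V)"
proof -
  note u = unitaryD[OF assms(1)] and v = unitaryD[OF assms(2)]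
  have "U * V * (mat_adjoint V * mat_adjoint U) = U * (V * mat_adjoint V) * mat_adjoint U"
    using u(1,2) v(1,2) by (simp add: square_mult_assoc[where n = n])
  moreover have "mat_adjoint V * mat_adjoint U * (U * V) = mat_adjoint V * (mat_adjoint U * U) * V"
    using u(1,2) v(1,2) by (simp add: square_mult_assoc[where n = n])
  ultimately show ?thesis using u v by (simp add: unitary_def mat_adjoint_mult[OF u(1) v(1)])
qed

section \<open>Unitary conjugation\<close>

definition uconj :: "complex mat \<Rightarrow> complex mat \<Rightarrow> complex mat" where
  "uconj V X = V * X * mat_adjoint V"

lemma uconj_carrier [simp]: "V \<in> carrier_mat n n \<Longrightarrow> X \<in> carrier_mat n n \<Longrightarrow> uconj V X \<in> carrier_mat n n"
  by (simp add: uconj_def)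

lemma uconj_mult:
  assumes V: "unitary n V" and X: "X \<in> carrier_mat n n" and Y: "Y \<in> carrier_mat n n"
  shows "uconj V X * uconj V Y = uconj V (X * Y)"
proof -
  note v = unitaryD[OF V]
  have "uconj V X * uconj V Y = V * X * ((mat_adjoint V * V) * (Y * mat_adjoint V))"
    unfolding uconj_def using v(1,2) X Y
    by (simp add: square_mult_assoc[where n = n])
  also have "\<dots> = uconj V (X * Y)"
    unfolding uconj_def v(4) using v(1,2) X Y
    by (simp add: square_mult_assoc[where n = n])
  finally show ?thesis .
qed

lemma uconj_add:
  assumes "V \<in> carrier_mat n n" "X \<in> carrier_mat n n" "Y \<in> carrier_mat n n"
  shows "uconj V (X + Y) = uconj V X + uconj V Y"
  unfolding uconj_def using assms
  by (simp add: mult_add_distrib_mat[where nr = n and n = n and nc = n] add_mult_distrib_mat[where nr = n and n = n and nc = n])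

lemma uconj_minus:
  assumes "V \<in> carrier_mat n n" "X \<in> carrier_mat n n" "Y \<in> carrier_mat n n"
  shows "uconj V (X - Y) = uconj V X - uconj V Y"
  unfolding uconj_def using assms
  by (simp add: mult_minus_distrib_mat[where nr = n and n = n and nc = n] minus_mult_distrib_mat[where nr = n and n = n and nc = n])

lemma uconj_adjoint:
  assumes "V \<in> carrier_mat n n" "X \<in> carrier_mat n n"
  shows "mat_adjoint (uconj V X) = uconj V (mat_adjoint X)"
  unfolding uconj_def using assms
  by (simp add: mat_adjoint_mult[where n = n and m = n and k = n] square_mult_assoc[where n = n])

lemma uconj_one: "unitary n V \<Longrightarrow> uconj V (1\<^sub>m n) = 1\<^sub>m n"
  using unitaryD[of n V] by (simp add: uconj_def)

lemma uconj_uconj: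
  assumes "V \<in> carrier_mat n n" "W \<in> carrier_mat n n" "X \<in> carrier_mat n n"
  shows "uconj V (uconj W X) = uconj (V * W) X"
  unfolding uconj_def using assms
  by (simp add: mat_adjoint_mult[where n = n and m = n and k = n] square_mult_assoc[where n = n])

lemma one_uconj: "X \<in> carrier_mat n n \<Longrightarrow> uconj (1\<^sub>m n) X = X"
  by (simp add: uconj_def)

lemma uconj_inverse:
  assumes V: "unitary n V" and X: "X \<in> carrier_mat n n"
  shows "uconj V (uconj (mat_adjoint V) X) = X" "uconj (mat_adjoint V) (uconj V X) = X"
  using unitaryD[OF V] X by (simp_all add: uconj_uconj[where n = n] one_uconj)

lemma mtrace_uconj:
  assumes V: "unitary n V" and X: "X \<in> carrier_mat n n"
  shows "mtrace (uconj V X) = mtrace X"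
proof -
  note v = unitaryD[OF V]
  have "mtrace (uconj V X) = mtrace (mat_adjoint V * (V * X))"
    unfolding uconj_def using v X by (intro mtrace_mult_commute[where n = n and m = n]) auto
  also have "mat_adjoint V * (V * X) = (mat_adjoint V * V) * X"
    using v(1,2) X by (simp add: square_mult_assoc[where n = n])
  finally show ?thesis using v X by simp
qed

lemma unitary_uconj:
  assumes "unitary n V" "unitary n U" shows "unitary n (uconj V U)"
  unfolding uconj_def by (intro unitary_mult unitary_adjoint assms)

lemma uconj_index:
  assumes "V \<in> carrier_mat n n" "X \<in> carrier_mat n n" "i < n" "j < n"
  shows "uconj V X $$ (i, j) = (\<Sum>p<n. \<Sum>q<n. V $$ (i, p) * X $$ (p, q) * cnj (V $$ (j, q)))"
proof -
  have "uconj V X $$ (i, j) = (\<Sum>q<n. (\<Sum>p<n. V $$ (i, p) * X $$ (p, q)) * cnj (V $$ (j, q)))"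
    unfolding uconj_def using assms
    by (auto simp: index_mult_mat_sum simp del: index_mult_mat(1) intro!: sum.cong)
  also have "\<dots> = (\<Sum>q<n. \<Sum>p<n. V $$ (i, p) * X $$ (p, q) * cnj (V $$ (j, q)))"
    by (simp add: sum_distrib_right)
  also have "\<dots> = (\<Sum>p<n. \<Sum>q<n. V $$ (i, p) * X $$ (p, q) * cnj (V $$ (j, q)))"
    by (rule sum.swap)
  finally show ?thesis .
qed

section \<open>Tensor products and partial traces under local unitaries\<close>

lemma kron_carrier [simp]: "A \<in> carrier_mat a a \<Longrightarrow> B \<in> carrier_mat b b \<Longrightarrow> kron A B \<in> carrier_mat (a * b) (a * b)"
  by (intro carrier_matI) auto

lemma kron_encode:
  assumes "A \<in> carrier_mat a a" "B \<in> carrier_mat b b" "i < a" "j < b" "k < a" "l < b"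
  shows "kron A B $$ (i * b + j, k * b + l) = A $$ (i, k) * B $$ (j, l)"
  using assms by (simp add: mult_add_less)

lemma kron_mult:
  assumes A: "A \<in> carrier_mat a a" and B: "B \<in> carrier_mat b b" and C: "C \<in> carrier_mat a a" and D: "D \<in> carrier_mat b b"
  shows "kron A B * kron C D = kron (A * C) (B * D)"
proof (rule eq_matI)
  fix i j assume "i < dim_row (kron (A * C) (B * D))" "j < dim_col (kron (A * C) (B * D))"
  hence ij: "i < a * b" "j < a * b" using assms by auto
  have d: "i div b < a" "i mod b < b" "j div b < a" "j mod b < b"
    using ij by (auto intro: div_less_mult mod_less_mult)
  have "(kron A B * kron C D) $$ (i, j) = (\<Sum>k<a * b. kron A B $$ (i, k) * kron C D $$ (k, j))"
    using ij assms by (subst index_mult_mat_sum) auto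
  also have "\<dots> = (\<Sum>p<a. \<Sum>q<b. (A $$ (i div b, p) * C $$ (p, j div b)) * (B $$ (i mod b, q) * D $$ (q, j mod b)))"
    unfolding sum_lessThan_mult using ij assms
    by (intro sum.cong refl) (simp add: mult_add_less mult_ac)
  also have "\<dots> = (A * C) $$ (i div b, j div b) * (B * D) $$ (i mod b, j mod b)"
    using d assms by (simp add: index_mult_mat_sum sum_product del: index_mult_mat(1))
  also have "\<dots> = kron (A * C) (B * D) $$ (i, j)" using ij assms by simp
  finally show "(kron A B * kron C D) $$ (i, j) = kron (A * C) (B * D) $$ (i, j)" .
qed (use assms in auto)

lemma kron_adjoint:
  assumes A: "A \<in> carrier_mat a a" and B: "B \<in> carrier_mat b b"
  shows "mat_adjoint (kron A B) = kron (mat_adjoint A) (mat_adjoint B)"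
  by (rule eq_matI) (use assms in \<open>auto simp: div_less_mult mod_less_mult\<close>)

lemma kron_one: "kron (1\<^sub>m a) (1\<^sub>m b) = 1\<^sub>m (a * b)"
proof (rule eq_matI)
  fix i j assume "i < dim_row (1\<^sub>m (a * b))" "j < dim_col (1\<^sub>m (a * b))"
  hence ij: "i < a * b" "j < a * b" by auto
  have "i = j" if "i div b = j div b" "i mod b = j mod b"
    using that div_mult_mod_eq[of i b] div_mult_mod_eq[of j b] by metis
  then show "kron (1\<^sub>m a) (1\<^sub>m b) $$ (i, j) = 1\<^sub>m (a * b) $$ (i, j)"
    using ij by (auto simp: div_less_mult mod_less_mult)
qed auto

lemma unitary_kron:
  assumes "unitary a A" "unitary b B" shows "unitary (a * b) (kron A B)"
proof -
  note A = unitaryD[OF assms(1)] and B = unitaryD[OF assms(2)]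
  show ?thesis
    unfolding unitary_def kron_adjoint[OF A(1) B(1)] kron_mult[OF A(1) B(1) A(2) B(2)]
      kron_mult[OF A(2) B(2) A(1) B(1)] A(3,4) B(3,4) kron_one
    by (intro conjI refl kron_carrier A B)
qed

lemma uconj_kron:
  assumes "A \<in> carrier_mat a a" "B \<in> carrier_mat b b" "C \<in> carrier_mat a a" "D \<in> carrier_mat b b"
  shows "uconj (kron A B) (kron C D) = kron (uconj A C) (uconj B D)"
  unfolding uconj_def kron_adjoint[OF assms(1,2)] kron_mult[OF assms]
  by (intro kron_mult) (use assms in auto)

lemma unitary_columns:
  assumes "unitary n A" "p < n" "q < n"
  shows "(\<Sum>k<n. A $$ (k, p) * cnj (A $$ (k, q))) = of_bool (p = q)"
proof -
  note u = unitaryD[OF assms(1)]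
  have "(mat_adjoint A * A) $$ (q, p) = (\<Sum>k<n. A $$ (k, p) * cnj (A $$ (k, q)))"
    using u(1) assms(2,3) by (auto simp: index_mult_mat_sum mult.commute simp del: index_mult_mat(1))
  then show ?thesis using u(4) assms by auto
qed

lemma uconj_kron_index:
  assumes A: "A \<in> carrier_mat a a" and B: "B \<in> carrier_mat b b" and X: "X \<in> carrier_mat (a * b) (a * b)"
    and i: "i < a" "j < b" "k < a" "l < b"
  shows "uconj (kron A B) X $$ (i * b + j, k * b + l) =
    (\<Sum>p1<a. \<Sum>p2<b. \<Sum>q1<a. \<Sum>q2<b. A $$ (i, p1) * cnj (A $$ (k, q1)) *
       (B $$ (j, p2) * X $$ (p1 * b + p2, q1 * b + q2) * cnj (B $$ (l, q2))))"
  unfolding uconj_index[OF kron_carrier[OF A B] X mult_add_less[OF i(1,2)] mult_add_less[OF i(3,4)]] sum_lessThan_mult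
proof (intro sum.cong refl)
  fix p1 p2 q1 q2 assume "p1 \<in> {..<a}" "p2 \<in> {..<b}" "q1 \<in> {..<a}" "q2 \<in> {..<b}"
  hence r: "p1 < a" "p2 < b" "q1 < a" "q2 < b" by auto
  show "kron A B $$ (i * b + j, p1 * b + p2) * X $$ (p1 * b + p2, q1 * b + q2) * cnj (kron A B $$ (k * b + l, q1 * b + q2)) =
    A $$ (i, p1) * cnj (A $$ (k, q1)) * (B $$ (j, p2) * X $$ (p1 * b + p2, q1 * b + q2) * cnj (B $$ (l, q2)))"
    unfolding kron_encode[OF A B i(1,2) r(1,2)] kron_encode[OF A B i(3,4) r(3,4)] by simp
qed

lemma ptrace_carrier [simp]:
  "ptrace_first a b X \<in> carrier_mat b b" "ptrace_second a b X \<in> carrier_mat a a"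
  by (auto simp: ptrace_first_def ptrace_second_def)

text \<open>Once the first factor is traced out, orthonormality of the columns of \<open>A\<close>
  collapses its two summation indices to one.\<close>

lemma ptrace_first_uconj:
  assumes A: "unitary a A" and B: "B \<in> carrier_mat b b" and X: "X \<in> carrier_mat (a * b) (a * b)"
  shows "ptrace_first a b (uconj (kron A B) X) = uconj B (ptrace_first a b X)"
proof (rule eq_matI)
  fix j l assume "j < dim_row (uconj B (ptrace_first a b X))" "l < dim_col (uconj B (ptrace_first a b X))"
  hence jl: "j < b" "l < b" using B by (auto simp: uconj_def)
  define G where "G p1 p2 q1 q2 = B $$ (j, p2) * X $$ (p1 * b + p2, q1 * b + q2) * cnj (B $$ (l, q2))" for p1 p2 q1 q2
  have "ptrace_first a b (uconj (kron A B) X) $$ (j, l) = (\<Sum>k<a. uconj (kron A B) X $$ (k * b + j, k * b + l))"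
    using jl by (simp add: ptrace_first_def)
  also have "\<dots> = (\<Sum>k<a. \<Sum>p1<a. \<Sum>p2<b. \<Sum>q1<a. \<Sum>q2<b. A $$ (k, p1) * cnj (A $$ (k, q1)) * G p1 p2 q1 q2)"
    unfolding G_def by (intro sum.cong refl uconj_kron_index[OF unitaryD(1)[OF A] B X]) (use jl in auto)
  also have "\<dots> = (\<Sum>k<a. \<Sum>p1<a. \<Sum>q1<a. A $$ (k, p1) * cnj (A $$ (k, q1)) * (\<Sum>p2<b. \<Sum>q2<b. G p1 p2 q1 q2))"
  proof (rule sum.cong[OF refl], rule sum.cong[OF refl])
    fix k p1
    have "(\<Sum>p2<b. \<Sum>q1<a. \<Sum>q2<b. A $$ (k, p1) * cnj (A $$ (k, q1)) * G p1 p2 q1 q2) =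
      (\<Sum>q1<a. \<Sum>p2<b. \<Sum>q2<b. A $$ (k, p1) * cnj (A $$ (k, q1)) * G p1 p2 q1 q2)" by (rule sum.swap)
    then show "(\<Sum>p2<b. \<Sum>q1<a. \<Sum>q2<b. A $$ (k, p1) * cnj (A $$ (k, q1)) * G p1 p2 q1 q2) =
      (\<Sum>q1<a. A $$ (k, p1) * cnj (A $$ (k, q1)) * (\<Sum>p2<b. \<Sum>q2<b. G p1 p2 q1 q2))"
      by (simp only: sum_distrib_left)
  qed
  also have "\<dots> = (\<Sum>p1<a. \<Sum>q1<a. \<Sum>k<a. A $$ (k, p1) * cnj (A $$ (k, q1)) * (\<Sum>p2<b. \<Sum>q2<b. G p1 p2 q1 q2))"
    by (rule sum_rotate[symmetric])
  also have "\<dots> = (\<Sum>p1<a. \<Sum>q1<a. of_bool (p1 = q1) * (\<Sum>p2<b. \<Sum>q2<b. G p1 p2 q1 q2))"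
    unfolding sum_distrib_right[symmetric] by (intro sum.cong refl) (simp add: unitary_columns[OF A])
  also have "\<dots> = (\<Sum>p1<a. \<Sum>p2<b. \<Sum>q2<b. G p1 p2 p1 q2)"
    by (rule sum.cong[OF refl]) simp
  also have "\<dots> = (\<Sum>p2<b. \<Sum>q2<b. \<Sum>p1<a. G p1 p2 p1 q2)"
    by (rule sum_rotate[symmetric])
  also have "\<dots> = uconj B (ptrace_first a b X) $$ (j, l)"
    unfolding uconj_index[OF B ptrace_carrier(1) jl] G_def
    by (intro sum.cong refl) (simp add: ptrace_first_def sum_distrib_left sum_distrib_right)
  finally show "ptrace_first a b (uconj (kron A B) X) $$ (j, l) = uconj B (ptrace_first a b X) $$ (j, l)" .
qed (use B in \<open>auto simp: uconj_def ptrace_first_def\<close>)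

lemma ptrace_second_uconj:
  assumes A: "A \<in> carrier_mat a a" and B: "unitary b B" and X: "X \<in> carrier_mat (a * b) (a * b)"
  shows "ptrace_second a b (uconj (kron A B) X) = uconj A (ptrace_second a b X)"
proof (rule eq_matI)
  fix i k assume "i < dim_row (uconj A (ptrace_second a b X))" "k < dim_col (uconj A (ptrace_second a b X))"
  hence ik: "i < a" "k < a" using A by (auto simp: uconj_def)
  define G where "G p1 p2 q1 q2 = A $$ (i, p1) * X $$ (p1 * b + p2, q1 * b + q2) * cnj (A $$ (k, q1))" for p1 p2 q1 q2
  have "ptrace_second a b (uconj (kron A B) X) $$ (i, k) = (\<Sum>j<b. uconj (kron A B) X $$ (i * b + j, k * b + j))"
    using ik by (simp add: ptrace_second_def)
  also have "\<dots> = (\<Sum>j<b. \<Sum>p1<a. \<Sum>p2<b. \<Sum>q1<a. \<Sum>q2<b. B $$ (j, p2) * cnj (B $$ (j, q2)) * G p1 p2 q1 q2)"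
  proof (rule sum.cong[OF refl])
    fix j assume "j \<in> {..<b}"
    hence j: "j < b" by simp
    show "uconj (kron A B) X $$ (i * b + j, k * b + j) =
      (\<Sum>p1<a. \<Sum>p2<b. \<Sum>q1<a. \<Sum>q2<b. B $$ (j, p2) * cnj (B $$ (j, q2)) * G p1 p2 q1 q2)"
      unfolding uconj_kron_index[OF A unitaryD(1)[OF B] X ik(1) j ik(2) j] G_def
      by (intro sum.cong refl) simp
  qed
  also have "\<dots> = (\<Sum>j<b. \<Sum>p2<b. \<Sum>q2<b. B $$ (j, p2) * cnj (B $$ (j, q2)) * (\<Sum>p1<a. \<Sum>q1<a. G p1 p2 q1 q2))"
  proof (rule sum.cong[OF refl])
    fix j
    have "(\<Sum>p1<a. \<Sum>p2<b. \<Sum>q1<a. \<Sum>q2<b. B $$ (j, p2) * cnj (B $$ (j, q2)) * G p1 p2 q1 q2) =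
      (\<Sum>p2<b. \<Sum>p1<a. \<Sum>q1<a. \<Sum>q2<b. B $$ (j, p2) * cnj (B $$ (j, q2)) * G p1 p2 q1 q2)" by (rule sum.swap)
    also have "\<dots> = (\<Sum>p2<b. \<Sum>q2<b. \<Sum>p1<a. \<Sum>q1<a. B $$ (j, p2) * cnj (B $$ (j, q2)) * G p1 p2 q1 q2)"
      by (intro sum.cong refl sum_rotate)
    finally show "(\<Sum>p1<a. \<Sum>p2<b. \<Sum>q1<a. \<Sum>q2<b. B $$ (j, p2) * cnj (B $$ (j, q2)) * G p1 p2 q1 q2) =
      (\<Sum>p2<b. \<Sum>q2<b. B $$ (j, p2) * cnj (B $$ (j, q2)) * (\<Sum>p1<a. \<Sum>q1<a. G p1 p2 q1 q2))"
      by (simp add: sum_distrib_left)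
  qed
  also have "\<dots> = (\<Sum>p2<b. \<Sum>q2<b. \<Sum>j<b. B $$ (j, p2) * cnj (B $$ (j, q2)) * (\<Sum>p1<a. \<Sum>q1<a. G p1 p2 q1 q2))"
    by (rule sum_rotate[symmetric])
  also have "\<dots> = (\<Sum>p2<b. \<Sum>q2<b. of_bool (p2 = q2) * (\<Sum>p1<a. \<Sum>q1<a. G p1 p2 q1 q2))"
    unfolding sum_distrib_right[symmetric] by (intro sum.cong refl) (simp add: unitary_columns[OF B])
  also have "\<dots> = (\<Sum>p2<b. \<Sum>p1<a. \<Sum>q1<a. G p1 p2 q1 p2)"
    by (rule sum.cong[OF refl]) simp
  also have "\<dots> = (\<Sum>p1<a. \<Sum>q1<a. \<Sum>p2<b. G p1 p2 q1 p2)"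
    by (rule sum_rotate[symmetric])
  also have "\<dots> = uconj A (ptrace_second a b X) $$ (i, k)"
    unfolding uconj_index[OF A ptrace_carrier(2) ik] G_def
    by (intro sum.cong refl) (simp add: ptrace_second_def sum_distrib_left sum_distrib_right)
  finally show "ptrace_second a b (uconj (kron A B) X) $$ (i, k) = uconj A (ptrace_second a b X) $$ (i, k)" .
qed (use A in \<open>auto simp: uconj_def ptrace_second_def\<close>)

lemma mtrace_mult:
  assumes "A \<in> carrier_mat n n" "B \<in> carrier_mat n n"
  shows "mtrace (A * B) = (\<Sum>i<n. \<Sum>k<n. A $$ (i, k) * B $$ (k, i))"
  using assms unfolding mtrace_def by (intro sum.cong) (auto simp: index_mult_mat_sum simp del: index_mult_mat(1))

lemma mtrace_kron_mult:
  assumes A: "A \<in> carrier_mat a a" and B: "B \<in> carrier_mat b b" and X: "X \<in> carrier_mat (a * b) (a * b)"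
  shows "mtrace (kron A B * X) =
    (\<Sum>i<a. \<Sum>j<b. \<Sum>k<a. \<Sum>l<b. A $$ (i, k) * B $$ (j, l) * X $$ (k * b + l, i * b + j))"
  unfolding mtrace_mult[OF kron_carrier[OF A B] X] sum_lessThan_mult
  by (intro sum.cong refl) (simp add: kron_encode[OF A B])

lemma mtrace_kron_one_mult:
  assumes A: "A \<in> carrier_mat a a" and X: "X \<in> carrier_mat (a * b) (a * b)"
  shows "mtrace (kron A (1\<^sub>m b) * X) = mtrace (A * ptrace_second a b X)"
proof -
  have "mtrace (kron A (1\<^sub>m b) * X) =
    (\<Sum>i<a. \<Sum>j<b. \<Sum>k<a. \<Sum>l<b. of_bool (j = l) * (A $$ (i, k) * X $$ (k * b + l, i * b + j)))"
    unfolding mtrace_kron_mult[OF A one_carrier_mat X] by (intro sum.cong refl) auto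
  also have "\<dots> = (\<Sum>i<a. \<Sum>j<b. \<Sum>k<a. A $$ (i, k) * X $$ (k * b + j, i * b + j))"
    by (intro sum.cong refl) simp
  also have "\<dots> = (\<Sum>i<a. \<Sum>k<a. \<Sum>j<b. A $$ (i, k) * X $$ (k * b + j, i * b + j))"
    by (intro sum.cong refl sum.swap)
  also have "\<dots> = mtrace (A * ptrace_second a b X)"
    unfolding mtrace_mult[OF A ptrace_carrier(2)]
    by (intro sum.cong refl) (simp add: ptrace_second_def sum_distrib_left)
  finally show ?thesis .
qed

lemma mtrace_one_kron_mult:
  assumes B: "B \<in> carrier_mat b b" and X: "X \<in> carrier_mat (a * b) (a * b)"
  shows "mtrace (kron (1\<^sub>m a) B * X) = mtrace (B * ptrace_first a b X)"
proof -
  have "mtrace (kron (1\<^sub>m a) B * X) =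
    (\<Sum>i<a. \<Sum>j<b. \<Sum>k<a. of_bool (i = k) * (\<Sum>l<b. B $$ (j, l) * X $$ (k * b + l, i * b + j)))"
    unfolding mtrace_kron_mult[OF one_carrier_mat B X] sum_distrib_left by (intro sum.cong refl) auto
  also have "\<dots> = (\<Sum>i<a. \<Sum>j<b. \<Sum>l<b. B $$ (j, l) * X $$ (i * b + l, i * b + j))"
    by (rule sum.cong[OF refl], rule sum.cong[OF refl]) simp
  also have "\<dots> = (\<Sum>j<b. \<Sum>l<b. \<Sum>i<a. B $$ (j, l) * X $$ (i * b + l, i * b + j))"
    by (rule sum_rotate[symmetric])
  also have "\<dots> = mtrace (B * ptrace_first a b X)"
    unfolding mtrace_mult[OF B ptrace_carrier(1)]
    by (intro sum.cong refl) (simp add: ptrace_first_def sum_distrib_left)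
  finally show ?thesis .
qed

lemma ptrace_kron:
  assumes A: "A \<in> carrier_mat a a" and B: "B \<in> carrier_mat b b"
  shows "ptrace_first a b (kron A B) = mtrace A \<cdot>\<^sub>m B" "ptrace_second a b (kron A B) = mtrace B \<cdot>\<^sub>m A"
proof -
  show "ptrace_first a b (kron A B) = mtrace A \<cdot>\<^sub>m B"
  proof (rule eq_matI)
    fix i j assume "i < dim_row (mtrace A \<cdot>\<^sub>m B)" "j < dim_col (mtrace A \<cdot>\<^sub>m B)"
    hence ij: "i < b" "j < b" using B by auto
    have "ptrace_first a b (kron A B) $$ (i, j) = (\<Sum>k<a. kron A B $$ (k * b + i, k * b + j))"
      using ij by (simp add: ptrace_first_def del: kron_index)
    also have "\<dots> = (\<Sum>k<a. A $$ (k, k) * B $$ (i, j))"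
      by (intro sum.cong refl kron_encode[OF A B]) (use ij in auto)
    also have "\<dots> = (mtrace A \<cdot>\<^sub>m B) $$ (i, j)" using ij A B by (simp add: mtrace_def sum_distrib_right)
    finally show "ptrace_first a b (kron A B) $$ (i, j) = (mtrace A \<cdot>\<^sub>m B) $$ (i, j)" .
  qed (use B in \<open>auto simp: ptrace_first_def\<close>)
  show "ptrace_second a b (kron A B) = mtrace B \<cdot>\<^sub>m A"
  proof (rule eq_matI)
    fix i j assume "i < dim_row (mtrace B \<cdot>\<^sub>m A)" "j < dim_col (mtrace B \<cdot>\<^sub>m A)"
    hence ij: "i < a" "j < a" using A by auto
    have "ptrace_second a b (kron A B) $$ (i, j) = (\<Sum>k<b. kron A B $$ (i * b + k, j * b + k))"
      using ij by (simp add: ptrace_second_def del: kron_index)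
    also have "\<dots> = (\<Sum>k<b. A $$ (i, j) * B $$ (k, k))"
      by (intro sum.cong refl kron_encode[OF A B]) (use ij in auto)
    also have "\<dots> = (mtrace B \<cdot>\<^sub>m A) $$ (i, j)"
      using ij A B by (simp add: mtrace_def sum_distrib_left mult.commute)
    finally show "ptrace_second a b (kron A B) $$ (i, j) = (mtrace B \<cdot>\<^sub>m A) $$ (i, j)" .
  qed (use A in \<open>auto simp: ptrace_second_def\<close>)
qed

subsection \<open>Spectral theorem and Gibbs states\<close>

lemma unitary_on_adjoint: "unitary_on J w \<Longrightarrow> unitary_on J (\<lambda>x y. cnj (w y x))"
  unfolding unitary_on_def by (auto simp: mult.commute)

text \<open>The set is enumerated in order to borrow a nonempty spectrum from matrices.\<close>

lemma eigenvector_on_exists: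
  fixes F :: "'a \<Rightarrow> 'a \<Rightarrow> complex"
  assumes J: "finite J" "J \<noteq> {}"
  shows "\<exists>v k. (\<exists>x\<in>J. v x \<noteq> 0) \<and> (\<forall>x\<in>J. (\<Sum>z\<in>J. F x z * v z) = k * v x)"
proof -
  define n where "n = card J"
  obtain f where f: "bij_betw f {..<n} J"
    using ex_bij_betw_nat_finite[OF J(1)] by (auto simp: n_def atLeast0LessThan)
  define A where "A = mat n n (\<lambda>(i, j). F (f i) (f j))"
  have A: "A \<in> carrier_mat n n" by (simp add: A_def)
  have "n > 0" using J by (simp add: n_def card_gt_0_iff)
  then obtain k where "eigenvalue A k"
    using spectrum_non_empty[OF A] by (auto simp: spectrum_def)
  then obtain v where v: "v \<in> carrier_vec n" "v \<noteq> 0\<^sub>v n" "A *\<^sub>v v = k \<cdot>\<^sub>v v"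
    using A by (auto simp: eigenvalue_def eigenvector_def)
  define g where "g = the_inv_into {..<n} f"
  have gf: "g (f i) = i" if "i < n" for i
    using that bij_betw_imp_inj_on[OF f] by (simp add: g_def the_inv_into_f_f)
  have surj: "\<exists>i<n. x = f i" if "x \<in> J" for x
    using bij_betw_imp_surj_on[OF f] that by auto
  define w where "w x = v $ g x" for x
  have "\<exists>i<n. v $ i \<noteq> 0"
  proof (rule ccontr)
    assume "\<not> (\<exists>i<n. v $ i \<noteq> 0)"
    hence "v = 0\<^sub>v n" using v(1) by (intro eq_vecI) auto
    then show False using v(2) by simp
  qed
  then obtain i where "i < n" "v $ i \<noteq> 0" by blast
  hence "f i \<in> J" "w (f i) \<noteq> 0" using f by (auto simp: w_def gf bij_betw_def)
  moreover have "(\<Sum>z\<in>J. F x z * w z) = k * w x" if x: "x \<in> J" for x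
  proof -
    obtain i where i: "i < n" "x = f i" using surj[OF x] by blast
    have "(\<Sum>z\<in>J. F x z * w z) = (\<Sum>j<n. F x (f j) * w (f j))"
      by (rule sum.reindex_bij_betw[OF f, symmetric])
    also have "\<dots> = (A *\<^sub>v v) $ i"
      using i v(1) A by (simp add: scalar_prod_def A_def w_def gf atLeast0LessThan)
    also have "\<dots> = k * w x" using i v(1) by (simp add: v(3) w_def gf)
    finally show ?thesis .
  qed
  ultimately show ?thesis by blast
qed

text \<open>Deflation: a reflection \<open>h\<close> turns an eigenvector into a multiple of the
  basis vector \<open>g\<close>. The conjugated kernel has \<open>g\<close> as eigenvector, so by
  hermiticity both row and column \<open>g\<close> split off, and induction on
  \<open>J - {g}\<close> handles the rest.\<close>

lemma spectral_on:
  fixes F :: "'a \<Rightarrow> 'a \<Rightarrow> complex"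
  assumes "finite J" "\<And>x y. x \<in> J \<Longrightarrow> y \<in> J \<Longrightarrow> cnj (F x y) = F y x"
  shows "\<exists>w d. unitary_on J w \<and>
     (\<forall>x\<in>J. \<forall>y\<in>J. F x y = (\<Sum>z\<in>J. w x z * complex_of_real (d z) * cnj (w y z)))"
  using assms
proof (induction J arbitrary: F rule: finite_psubset_induct)
  case (psubset J)
  show ?case
  proof (cases "J = {}")
    case True
    then show ?thesis by (auto simp: unitary_on_def)
  next
    case False
    then obtain g where g: "g \<in> J" by blast
    note J = psubset.hyps
    from eigenvector_on_exists[OF J False] obtain v k where
      v: "\<exists>x\<in>J. v x \<noteq> 0" "\<And>x. x \<in> J \<Longrightarrow> (\<Sum>z\<in>J. F x z * v z) = k * v x" by blast
    from unitary_on_aligns[OF J g] obtain h where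
      h: "unitary_on J h" "\<And>x. x \<in> J - {g} \<Longrightarrow> kernel_apply J h v x = 0" by blast
    have h1: "(\<Sum>z\<in>J. h x z * cnj (h y z)) = of_bool (x = y)" "(\<Sum>z\<in>J. cnj (h z x) * h z y) = of_bool (x = y)"
      if "x \<in> J" "y \<in> J" for x y using h(1) that by (auto simp: unitary_on_def)
    define \<alpha> where "\<alpha> = kernel_apply J h v g"
    \<comment> \<open>Inverting \<open>h\<close> shows the eigenvector to be a multiple of the
      conjugated row \<open>g\<close> of \<open>h\<close>, so that this row can replace it.\<close>
    have vq: "v q = cnj (h g q) * \<alpha>" if q: "q \<in> J" for q
    proof -
      have "v q = (\<Sum>y\<in>J. of_bool (q = y) * v y)" using J q by simp
      also have "\<dots> = (\<Sum>y\<in>J. (\<Sum>x\<in>J. cnj (h x q) * h x y) * v y)"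
        using q by (intro sum.cong refl) (simp add: h1)
      also have "\<dots> = (\<Sum>y\<in>J. \<Sum>x\<in>J. cnj (h x q) * (h x y * v y))"
        by (simp add: sum_distrib_right mult.assoc)
      also have "\<dots> = (\<Sum>x\<in>J. \<Sum>y\<in>J. cnj (h x q) * (h x y * v y))" by (rule sum.swap)
      also have "\<dots> = (\<Sum>x\<in>J. cnj (h x q) * kernel_apply J h v x)" by (simp add: kernel_apply_def sum_distrib_left)
      also have "\<dots> = (\<Sum>x\<in>J. if x = g then cnj (h g q) * \<alpha> else 0)"
        using h(2) by (intro sum.cong refl) (auto simp: \<alpha>_def)
      finally show ?thesis using J g by simp
    qed
    have \<alpha>: "\<alpha> \<noteq> 0" using v(1) vq by force
    have ev: "(\<Sum>q\<in>J. F p q * cnj (h g q)) = k * cnj (h g p)" if "p \<in> J" for p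
    proof -
      have "(\<Sum>q\<in>J. F p q * cnj (h g q)) * \<alpha> = (\<Sum>q\<in>J. F p q * v q)"
        unfolding sum_distrib_right by (intro sum.cong refl) (simp add: vq)
      also have "\<dots> = k * cnj (h g p) * \<alpha>" using v(2)[OF that] vq[OF that] by simp
      finally show ?thesis using \<alpha> by simp
    qed
    define F' where "F' x y = (\<Sum>p\<in>J. \<Sum>q\<in>J. h x p * F p q * cnj (h y q))" for x y
    have F'g: "F' x g = k * of_bool (x = g)" if "x \<in> J" for x
    proof -
      have "F' x g = (\<Sum>p\<in>J. h x p * (\<Sum>q\<in>J. F p q * cnj (h g q)))"
        by (simp add: F'_def sum_distrib_left mult.assoc)
      also have "\<dots> = (\<Sum>p\<in>J. k * (h x p * cnj (h g p)))"
        by (intro sum.cong refl) (simp add: ev)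
      also have "\<dots> = k * of_bool (x = g)" unfolding sum_distrib_left[symmetric] using that g by (simp add: h1)
      finally show ?thesis .
    qed
    have F'h: "cnj (F' x y) = F' y x" for x y
    proof -
      have "cnj (F' x y) = (\<Sum>p\<in>J. \<Sum>q\<in>J. h y q * F q p * cnj (h x p))"
        unfolding F'_def cnj_sum by (intro sum.cong refl) (simp add: psubset.prems mult_ac)
      also have "\<dots> = (\<Sum>q\<in>J. \<Sum>p\<in>J. h y q * F q p * cnj (h x p))" by (rule sum.swap)
      finally show ?thesis by (simp add: F'_def)
    qed
    \<comment> \<open>The eigenvalue is a diagonal entry of a hermitian kernel, hence real.\<close>
    have kr: "k = of_real (Re k)"
      using F'h[of g g] F'g[OF g] by (simp add: complex_eq_iff)
    have gF': "F' g x = k * of_bool (x = g)" if "x \<in> J" for x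
    proof -
      have "cnj k = k" by (subst (1 2) kr) simp
      then show ?thesis unfolding F'h[of x g, symmetric] F'g[OF that] by simp
    qed
    have "J - {g} \<subset> J" using g by blast
    from psubset.IH[OF this, of F'] F'h obtain w d where
      w: "unitary_on (J - {g}) w"
      "\<And>x y. x \<in> J - {g} \<Longrightarrow> y \<in> J - {g} \<Longrightarrow> F' x y = (\<Sum>z\<in>J - {g}. w x z * complex_of_real (d z) * cnj (w y z))"
      by blast
    define w2 where "w2 x y = (if (x = g) = (y = g) then (if x = g then (\<lambda>x y. of_bool (x = y)) else w) x y else 0)" for x y
    define d2 where "d2 z = (if z = g then Re k else d z)" for z
    have sets: "{x \<in> J. x = g} = {g}" "{x\<in>J. x \<noteq> g} = J - {g}" using g by auto
    have "unitary_on {x\<in>J. (x = g) = \<tau>} (if \<tau> then (\<lambda>x y. of_bool (x = y)) else w)" for \<tau>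
      using w(1) sets unitary_on_id[of "{g}"] by (cases \<tau>) auto
    from unitary_on_direct_sum[OF J, of "\<lambda>x. x = g", OF this]
    have w2: "unitary_on J w2" unfolding w2_def .
    have F'2: "F' x y = (\<Sum>z\<in>J. w2 x z * of_real (d2 z) * cnj (w2 y z))" if "x \<in> J" "y \<in> J" for x y
    proof -
      have "(\<Sum>z\<in>J. w2 x z * of_real (d2 z) * cnj (w2 y z)) =
         w2 x g * of_real (d2 g) * cnj (w2 y g) + (\<Sum>z\<in>J - {g}. w2 x z * of_real (d2 z) * cnj (w2 y z))"
        using J g by (rule sum.remove)
      also have "\<dots> = F' x y"
      proof (cases "x = g \<or> y = g")
        case True
        have "(\<Sum>z\<in>J - {g}. w2 x z * of_real (d2 z) * cnj (w2 y z)) = 0"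
          using True by (intro sum.neutral) (auto simp: w2_def)
        moreover have "w2 x g * of_real (d2 g) * cnj (w2 y g) = k * of_bool (x = g \<and> y = g)"
          by (simp add: w2_def d2_def kr[symmetric])
        ultimately show ?thesis using True that F'g gF' by auto
      next
        case False
        then have "(\<Sum>z\<in>J - {g}. w2 x z * of_real (d2 z) * cnj (w2 y z)) = F' x y"
          using that by (subst w(2)) (auto simp: w2_def d2_def intro!: sum.cong)
        then show ?thesis using False by (simp add: w2_def)
      qed
      finally show ?thesis by simp
    qed
    define W where "W x z = (\<Sum>p\<in>J. cnj (h p x) * w2 p z)" for x z
    have "unitary_on J W"
      unfolding W_def by (rule unitary_on_mult[OF J unitary_on_adjoint[OF h(1)] w2])
    moreover have "F x y = (\<Sum>z\<in>J. W x z * of_real (d2 z) * cnj (W y z))" if xy: "x \<in> J" "y \<in> J" for x y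
    proof -
      have "(\<Sum>z\<in>J. W x z * of_real (d2 z) * cnj (W y z)) =
         (\<Sum>z\<in>J. \<Sum>p\<in>J. \<Sum>q\<in>J. cnj (h p x) * h q y * (w2 p z * of_real (d2 z) * cnj (w2 q z)))"
      proof (rule sum.cong[OF refl])
        fix z
        have "W x z * of_real (d2 z) * cnj (W y z) = (W x z * cnj (W y z)) * of_real (d2 z)" by simp
        also have "\<dots> = (\<Sum>p\<in>J. \<Sum>q\<in>J. (cnj (h p x) * w2 p z) * (h q y * cnj (w2 q z)) * of_real (d2 z))"
          unfolding W_def cnj_sum sum_product by (simp add: sum_distrib_right)
        finally show "W x z * of_real (d2 z) * cnj (W y z) =
          (\<Sum>p\<in>J. \<Sum>q\<in>J. cnj (h p x) * h q y * (w2 p z * of_real (d2 z) * cnj (w2 q z)))"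
          by (simp add: mult_ac)
      qed
      also have "\<dots> = (\<Sum>p\<in>J. \<Sum>q\<in>J. \<Sum>z\<in>J. cnj (h p x) * h q y * (w2 p z * of_real (d2 z) * cnj (w2 q z)))"
        by (rule sum_rotate[symmetric])
      also have "\<dots> = (\<Sum>p\<in>J. \<Sum>q\<in>J. cnj (h p x) * h q y * F' p q)"
        by (intro sum.cong refl) (simp add: F'2 sum_distrib_left)
      also have "\<dots> = (\<Sum>p\<in>J. \<Sum>q\<in>J. \<Sum>a\<in>J. \<Sum>b\<in>J. (cnj (h p x) * h p a) * F a b * (cnj (h q b) * h q y))"
        unfolding F'_def sum_distrib_left by (intro sum.cong refl) (simp add: mult_ac)
      also have "\<dots> = (\<Sum>p\<in>J. \<Sum>a\<in>J. \<Sum>b\<in>J. \<Sum>q\<in>J. (cnj (h p x) * h p a) * F a b * (cnj (h q b) * h q y))"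
        by (intro sum.cong refl sum_rotate[symmetric])
      also have "\<dots> = (\<Sum>p\<in>J. \<Sum>a\<in>J. (cnj (h p x) * h p a) * F a y)"
      proof (rule sum.cong[OF refl], rule sum.cong[OF refl])
        fix p a
        have "(\<Sum>b\<in>J. \<Sum>q\<in>J. (cnj (h p x) * h p a) * F a b * (cnj (h q b) * h q y)) =
          (\<Sum>b\<in>J. (cnj (h p x) * h p a) * F a b * of_bool (b = y))"
          unfolding sum_distrib_left[symmetric] using xy by (intro sum.cong refl) (simp add: h1)
        then show "(\<Sum>b\<in>J. \<Sum>q\<in>J. (cnj (h p x) * h p a) * F a b * (cnj (h q b) * h q y)) =
          (cnj (h p x) * h p a) * F a y" using J xy by simp
      qed
      also have "\<dots> = (\<Sum>a\<in>J. \<Sum>p\<in>J. (cnj (h p x) * h p a) * F a y)" by (rule sum.swap)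
      also have "\<dots> = (\<Sum>a\<in>J. of_bool (x = a) * F a y)"
        unfolding sum_distrib_right[symmetric] using xy by (intro sum.cong refl) (simp add: h1)
      also have "\<dots> = F x y" using J xy by simp
      finally show ?thesis by simp
    qed
    ultimately show ?thesis by blast
  qed
qed

lemma uconj_diagm_index:
  assumes "P \<in> carrier_mat n n" "i < n" "j < n"
  shows "uconj P (diagm n d) $$ (i, j) = (\<Sum>k<n. P $$ (i, k) * d k * cnj (P $$ (j, k)))"
proof -
  have "uconj P (diagm n d) $$ (i, j) = (\<Sum>p<n. \<Sum>q<n. of_bool (p = q) * (P $$ (i, p) * d p * cnj (P $$ (j, q))))"
    unfolding uconj_index[OF assms(1) diagm_carrier assms(2,3)] by (intro sum.cong refl) auto
  then show ?thesis by simp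
qed

lemma spectral_theorem:
  assumes "hermitian n A"
  obtains P d where "unitary n P" "A = uconj P (diagm n (\<lambda>i. complex_of_real (d i)))"
proof -
  have A: "A \<in> carrier_mat n n" "mat_adjoint A = A" using assms by (auto simp: hermitian_def)
  have "cnj (A $$ (i, j)) = A $$ (j, i)" if "i \<in> {..<n}" "j \<in> {..<n}" for i j
    using that A(1) mat_adjoint_index[of j A i] unfolding A(2) by simp
  from spectral_on[of "{..<n}" "\<lambda>i j. A $$ (i, j)", OF finite_lessThan this]
  obtain w d where w: "unitary_on {..<n} w"
    "\<And>i j. i < n \<Longrightarrow> j < n \<Longrightarrow> A $$ (i, j) = (\<Sum>k<n. w i k * complex_of_real (d k) * cnj (w j k))"
    by (auto simp: Ball_def)
  define P where "P = mat n n (\<lambda>(i, j). w i j)"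
  have P: "P \<in> carrier_mat n n" by (simp add: P_def)
  have "unitary n P"
    unfolding unitary_def
  proof (intro conjI P)
    show "P * mat_adjoint P = 1\<^sub>m n"
      by (rule eq_matI) (use w(1) in \<open>auto simp: P_def index_mult_mat_sum unitary_on_def simp del: index_mult_mat(1)\<close>)
    show "mat_adjoint P * P = 1\<^sub>m n"
      by (rule eq_matI) (use w(1) in \<open>auto simp: P_def index_mult_mat_sum unitary_on_def simp del: index_mult_mat(1)\<close>)
  qed
  moreover have "A = uconj P (diagm n (\<lambda>i. complex_of_real (d i)))"
  proof (rule eq_matI)
    have "uconj P (diagm n (\<lambda>i. complex_of_real (d i))) \<in> carrier_mat n n" using P by simp
    then have dims: "dim_row (uconj P (diagm n (\<lambda>i. complex_of_real (d i)))) = n"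
      "dim_col (uconj P (diagm n (\<lambda>i. complex_of_real (d i)))) = n" by auto
    show "dim_row A = dim_row (uconj P (diagm n (\<lambda>i. complex_of_real (d i))))"
      "dim_col A = dim_col (uconj P (diagm n (\<lambda>i. complex_of_real (d i))))" using A(1) dims by auto
    fix i j assume "i < dim_row (uconj P (diagm n (\<lambda>i. complex_of_real (d i))))"
      "j < dim_col (uconj P (diagm n (\<lambda>i. complex_of_real (d i))))"
    hence ij: "i < n" "j < n" using dims by auto
    show "A $$ (i, j) = uconj P (diagm n (\<lambda>i. complex_of_real (d i))) $$ (i, j)"
      unfolding uconj_diagm_index[OF P ij] w(2)[OF ij] using ij by (simp add: P_def)
  qed
  ultimately show thesis by (rule that)
qed

lemma uconj_smult:
  assumes "P \<in> carrier_mat n n" "X \<in> carrier_mat n n"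
  shows "c \<cdot>\<^sub>m uconj P X = uconj P (c \<cdot>\<^sub>m X)"
  unfolding uconj_def using assms
  by (simp add: mult_smult_distrib[where nr = n and n = n and nc = n] mult_smult_assoc_mat[where nr = n and n = n and nc = n])

lemma mexp_uconj:
  assumes P: "unitary n P"
  shows "mexp (uconj P (diagm n d)) = uconj P (diagm n (\<lambda>i. exp (d i)))"
proof -
  note p = unitaryD[OF P]
  have pow: "uconj P (diagm n d) ^\<^sub>m k = uconj P (diagm n (\<lambda>i. d i ^ k))" for k
  proof (induction k)
    case 0
    have "dim_row (uconj P (diagm n d)) = n" using p by (simp add: uconj_def)
    then show ?case using uconj_one[OF P] by (simp add: diagm_one[symmetric])
  next
    case (Suc k)
    then show ?case by (simp add: uconj_mult[OF P] diagm_mult mult.commute)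
  qed
  have dim: "dim_row (uconj P (diagm n e)) = n" "dim_col (uconj P (diagm n e)) = n" for e
    using p by (auto simp: uconj_def)
  show ?thesis
  proof (rule eq_matI)
    fix i j assume "i < dim_row (uconj P (diagm n (\<lambda>i. exp (d i))))" "j < dim_col (uconj P (diagm n (\<lambda>i. exp (d i))))"
    hence ij: "i < n" "j < n" by (auto simp: dim)
    have "(\<lambda>k. (uconj P (diagm n d) ^\<^sub>m k) $$ (i, j) / fact k) =
       (\<lambda>k. \<Sum>p<n. P $$ (i, p) * cnj (P $$ (j, p)) * (d p ^ k / fact k))"
      by (simp add: fun_eq_iff pow uconj_diagm_index[OF p(1) ij] sum_divide_distrib mult_ac)
    moreover have "(\<lambda>k. \<Sum>p<n. P $$ (i, p) * cnj (P $$ (j, p)) * (d p ^ k / fact k)) sums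
        (\<Sum>p<n. P $$ (i, p) * cnj (P $$ (j, p)) * exp (d p))"
      by (intro sums_sum sums_mult exp_complex_sums)
    ultimately have "(\<Sum>k. (uconj P (diagm n d) ^\<^sub>m k) $$ (i, j) / fact k) =
       (\<Sum>p<n. P $$ (i, p) * cnj (P $$ (j, p)) * exp (d p))"
      by (simp only: sums_unique[symmetric])
    then show "mexp (uconj P (diagm n d)) $$ (i, j) = uconj P (diagm n (\<lambda>i. exp (d i))) $$ (i, j)"
      using ij by (simp add: mexp_def dim uconj_diagm_index[OF p(1) ij] mult_ac)
  qed (auto simp: mexp_def dim)
qed

lemma gibbs_uconj_diagm:
  assumes P: "unitary n P"
  shows "gibbs \<beta> (uconj P (diagm n d)) = uconj P (gibbs \<beta> (diagm n d))"
  unfolding gibbs_def uconj_smult[OF unitaryD(1)[OF P] diagm_carrier] diagm_smult mexp_uconj[OF P] mexp_diagm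
    mtrace_uconj[OF P diagm_carrier] ..

text \<open>Diagonalising \<open>H\<close> by \<open>P\<close> makes both sides functions of the
  same eigenvalues in the basis \<open>V * P\<close>.\<close>

lemma gibbs_uconj:
  assumes V: "unitary n V" and H: "hermitian n H"
  shows "gibbs \<beta> (uconj V H) = uconj V (gibbs \<beta> H)" "gibbs \<beta> H \<in> carrier_mat n n"
proof -
  from spectral_theorem[OF H] obtain P d where P: "unitary n P" "H = uconj P (diagm n (\<lambda>i. complex_of_real (d i)))" .
  have g: "gibbs \<beta> (diagm n (\<lambda>i. complex_of_real (d i))) \<in> carrier_mat n n"
    unfolding gibbs_diagm by simp
  have "uconj V H = uconj (V * P) (diagm n (\<lambda>i. complex_of_real (d i)))"
    unfolding P(2) by (rule uconj_uconj[where n = n]) (use unitaryD[OF V] unitaryD[OF P(1)] in auto)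
  then have "gibbs \<beta> (uconj V H) = uconj (V * P) (gibbs \<beta> (diagm n (\<lambda>i. complex_of_real (d i))))"
    using gibbs_uconj_diagm[OF unitary_mult[OF V P(1)]] by simp
  also have "\<dots> = uconj V (uconj P (gibbs \<beta> (diagm n (\<lambda>i. complex_of_real (d i)))))"
    by (rule uconj_uconj[where n = n, symmetric]) (use unitaryD[OF V] unitaryD[OF P(1)] g in auto)
  also have "\<dots> = uconj V (gibbs \<beta> H)" unfolding P(2) gibbs_uconj_diagm[OF P(1)] ..
  finally show "gibbs \<beta> (uconj V H) = uconj V (gibbs \<beta> H)" .
  show "gibbs \<beta> H \<in> carrier_mat n n"
    unfolding P(2) gibbs_uconj_diagm[OF P(1)] using unitaryD[OF P(1)] g by simp
qed

subsection \<open>The second law\<close>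

definition htot :: "complex mat \<Rightarrow> nat \<Rightarrow> nat \<Rightarrow> complex mat \<Rightarrow> complex mat \<Rightarrow> complex mat" where
  "htot Hs dM dE HM HE = kron (kron Hs (1\<^sub>m dM)) (1\<^sub>m dE) + kron (kron (1\<^sub>m 2) HM) (1\<^sub>m dE)
                  + kron (kron (1\<^sub>m 2) (1\<^sub>m dM)) HE"

text \<open>The condition inside \<open>heats\<close> with its witnesses as arguments, so that they
  can be rotated and diagonalised one by one.\<close>

definition protocol where
  "protocol \<beta> Hs \<rho> dM dE HM HE RM U Q \<longleftrightarrow>
      0 < dM \<and> 0 < dE \<and> hermitian dM HM \<and> hermitian dE HE \<and> density dM RM \<and>
      unitary (2 * dM * dE) U \<and> U * htot Hs dM dE HM HE = htot Hs dM dE HM HE * U \<and>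
      ptrace_first 2 dM (ptrace_second (2 * dM) dE (uconj U (kron (kron \<rho> RM) (gibbs \<beta> HE)))) = RM \<and>
      Q = Re (mtrace (HE * (ptrace_first (2 * dM) dE (uconj U (kron (kron \<rho> RM) (gibbs \<beta> HE))) - gibbs \<beta> HE)))"

lemma heats_protocol: "heats \<beta> Hs \<rho> = {Q. \<exists>dM dE HM HE RM U. protocol \<beta> Hs \<rho> dM dE HM HE RM U Q}"
  unfolding heats_def protocol_def htot_def uconj_def Let_def by simp

lemma hermitian_uconj: "V \<in> carrier_mat n n \<Longrightarrow> hermitian n H \<Longrightarrow> hermitian n (uconj V H)"
  by (simp add: hermitian_def uconj_adjoint[where n = n])

lemma density_uconj:
  assumes V: "unitary n V" and R: "density n R"
  shows "density n (uconj V R)"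
proof -
  have h: "hermitian n R" and tr: "mtrace R = 1"
    and psd: "\<And>v :: nat \<Rightarrow> complex. 0 \<le> Re (\<Sum>i<n. \<Sum>j<n. cnj (v i) * R $$ (i, j) * v j)"
    using R by (auto simp: density_def)
  have Rc: "R \<in> carrier_mat n n" using h by (simp add: hermitian_def)
  have "0 \<le> Re (\<Sum>i<n. \<Sum>j<n. cnj (v i) * uconj V R $$ (i, j) * v j)" for v :: "nat \<Rightarrow> complex"
  proof -
    define w where "w p = (\<Sum>j<n. cnj (V $$ (j, p)) * v j)" for p
    have "(\<Sum>i<n. \<Sum>j<n. cnj (v i) * uconj V R $$ (i, j) * v j) =
      (\<Sum>i<n. \<Sum>j<n. \<Sum>p<n. \<Sum>q<n. (V $$ (i, p) * cnj (v i)) * R $$ (p, q) * (cnj (V $$ (j, q)) * v j))"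
      by (intro sum.cong refl) (simp add: uconj_index[OF unitaryD(1)[OF V] Rc] sum_distrib_left sum_distrib_right mult_ac)
    also have "\<dots> = (\<Sum>i<n. \<Sum>p<n. \<Sum>q<n. \<Sum>j<n. (V $$ (i, p) * cnj (v i)) * R $$ (p, q) * (cnj (V $$ (j, q)) * v j))"
      by (intro sum.cong refl sum_rotate[symmetric])
    also have "\<dots> = (\<Sum>p<n. \<Sum>q<n. \<Sum>i<n. \<Sum>j<n. (V $$ (i, p) * cnj (v i)) * R $$ (p, q) * (cnj (V $$ (j, q)) * v j))"
      by (rule sum_rotate[symmetric])
    also have "\<dots> = (\<Sum>p<n. \<Sum>q<n. cnj (w p) * R $$ (p, q) * w q)"
    proof (intro sum.cong refl)
      fix p q
      have "cnj (w p) * R $$ (p, q) * w q = (cnj (w p) * w q) * R $$ (p, q)" by simp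
      also have "\<dots> = (\<Sum>i<n. \<Sum>j<n. (V $$ (i, p) * cnj (v i)) * (cnj (V $$ (j, q)) * v j) * R $$ (p, q))"
        unfolding w_def cnj_sum sum_product by (simp add: sum_distrib_right)
      finally show "(\<Sum>i<n. \<Sum>j<n. (V $$ (i, p) * cnj (v i)) * R $$ (p, q) * (cnj (V $$ (j, q)) * v j)) =
        cnj (w p) * R $$ (p, q) * w q" by (simp add: mult_ac)
    qed
    finally show ?thesis using psd[of w] by simp
  qed
  then show ?thesis
    using hermitian_uconj[OF unitaryD(1)[OF V] h] mtrace_uconj[OF V Rc] tr by (simp add: density_def)
qed

lemma hermitian_carrier: "hermitian n H \<Longrightarrow> H \<in> carrier_mat n n" by (simp add: hermitian_def)

lemma density_carrier: "density n H \<Longrightarrow> H \<in> carrier_mat n n" by (simp add: density_def hermitian_def)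

lemma htot_carrier:
  assumes "Hs \<in> carrier_mat 2 2" "HM \<in> carrier_mat dM dM" "HE \<in> carrier_mat dE dE"
  shows "htot Hs dM dE HM HE \<in> carrier_mat (2 * dM * dE) (2 * dM * dE)"
  unfolding htot_def by (intro add_carrier_mat kron_carrier one_carrier_mat assms)

text \<open>Every ingredient is covariant under a product of local unitaries: the energy terms, the
  Gibbs state and the marginals. The heat is a trace and does not move.\<close>

lemma protocol_rotate:
  assumes p: "protocol \<beta> Hs \<rho> dM dE HM HE RM U Q"
    and Hs: "Hs \<in> carrier_mat 2 2" and \<rho>: "\<rho> \<in> carrier_mat 2 2"
    and VS: "unitary 2 VS" and VM: "unitary dM VM" and VE: "unitary dE VE"
  shows "protocol \<beta> (uconj VS Hs) (uconj VS \<rho>) dM dE (uconj VM HM) (uconj VE HE) (uconj VM RM)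
    (uconj (kron (kron VS VM) VE) U) Q"
proof -
  have pos: "0 < dM" "0 < dE" and HM: "hermitian dM HM" and HE: "hermitian dE HE" and RM: "density dM RM"
    and U: "unitary (2 * dM * dE) U" and comm: "U * htot Hs dM dE HM HE = htot Hs dM dE HM HE * U"
    and marg: "ptrace_first 2 dM (ptrace_second (2 * dM) dE (uconj U (kron (kron \<rho> RM) (gibbs \<beta> HE)))) = RM"
    and Q: "Q = Re (mtrace (HE * (ptrace_first (2 * dM) dE (uconj U (kron (kron \<rho> RM) (gibbs \<beta> HE))) - gibbs \<beta> HE)))"
    using p unfolding protocol_def by blast+
  define D where "D = 2 * dM * dE"
  define V2 where "V2 = kron VS VM"
  define V where "V = kron V2 VE"
  define \<gamma> where "\<gamma> = gibbs \<beta> HE"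
  define K where "K = kron (kron \<rho> RM) \<gamma>"
  define \<eta> where "\<eta> = uconj U K"
  note c = unitaryD(1)[OF VS] unitaryD(1)[OF VM] unitaryD(1)[OF VE] Hs \<rho> hermitian_carrier[OF HM] hermitian_carrier[OF HE]
    density_carrier[OF RM] gibbs_uconj(2)[OF VE HE, of \<beta>, folded \<gamma>_def]
  have V2: "unitary (2 * dM) V2" unfolding V2_def by (rule unitary_kron[OF VS VM])
  have V: "unitary D V" unfolding V_def D_def by (rule unitary_kron[OF V2 VE])
  have Kc: "K \<in> carrier_mat D D" unfolding K_def D_def by (intro kron_carrier c)
  have Uc: "U \<in> carrier_mat D D" and UD: "unitary D U" using U unitaryD by (auto simp: D_def)
  have \<eta>c: "\<eta> \<in> carrier_mat D D" unfolding \<eta>_def using Uc Kc by simp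
  have Hc: "htot Hs dM dE HM HE \<in> carrier_mat D D" unfolding D_def by (rule htot_carrier) (use c in auto)
  have k3: "uconj V (kron (kron A B) C) = kron (kron (uconj VS A) (uconj VM B)) (uconj VE C)"
    if "A \<in> carrier_mat 2 2" "B \<in> carrier_mat dM dM" "C \<in> carrier_mat dE dE" for A B C
  proof -
    have "uconj V (kron (kron A B) C) = kron (uconj V2 (kron A B)) (uconj VE C)"
      unfolding V_def by (rule uconj_kron[OF unitaryD(1)[OF V2] c(3) kron_carrier[OF that(1,2)] that(3)])
    also have "uconj V2 (kron A B) = kron (uconj VS A) (uconj VM B)"
      unfolding V2_def by (rule uconj_kron[OF c(1,2) that(1,2)])
    finally show ?thesis .
  qed
  have H': "htot (uconj VS Hs) dM dE (uconj VM HM) (uconj VE HE) = uconj V (htot Hs dM dE HM HE)"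
  proof -
    have t: "kron (kron Hs (1\<^sub>m dM)) (1\<^sub>m dE) \<in> carrier_mat D D" "kron (kron (1\<^sub>m 2) HM) (1\<^sub>m dE) \<in> carrier_mat D D"
      "kron (kron (1\<^sub>m 2) (1\<^sub>m dM)) HE \<in> carrier_mat D D"
      unfolding D_def by (intro kron_carrier one_carrier_mat c)+
    show ?thesis
      unfolding htot_def uconj_add[OF unitaryD(1)[OF V] add_carrier_mat[OF t(2)] t(3)] uconj_add[OF unitaryD(1)[OF V] t(1,2)]
        k3[OF c(4) one_carrier_mat one_carrier_mat] k3[OF one_carrier_mat c(6) one_carrier_mat]
        k3[OF one_carrier_mat one_carrier_mat c(7)] uconj_one[OF VS] uconj_one[OF VM] uconj_one[OF VE] ..
  qed
  have K': "kron (kron (uconj VS \<rho>) (uconj VM RM)) (gibbs \<beta> (uconj VE HE)) = uconj V K"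
    unfolding gibbs_uconj(1)[OF VE HE] K_def \<gamma>_def[symmetric] by (rule k3[OF c(5,8,9), symmetric])
  have \<eta>': "uconj (uconj V U) (uconj V K) = uconj V \<eta>"
    unfolding \<eta>_def uconj_def[of "uconj V U"] uconj_adjoint[OF unitaryD(1)[OF V] Uc]
      uconj_mult[OF V Uc Kc] uconj_mult[OF V square_mult_carrier[OF Uc Kc] mat_adjoint_carrier[OF Uc]]
    by (simp only: uconj_def[of U])
  have marg': "ptrace_first 2 dM (ptrace_second (2 * dM) dE (uconj V \<eta>)) = uconj VM RM"
  proof -
    have "ptrace_second (2 * dM) dE (uconj V \<eta>) = uconj V2 (ptrace_second (2 * dM) dE \<eta>)"
      unfolding V_def by (rule ptrace_second_uconj[OF unitaryD(1)[OF V2] VE \<eta>c[unfolded D_def]])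
    then show ?thesis
      unfolding V2_def ptrace_first_uconj[OF VS c(2) ptrace_carrier(2)]
      using marg by (simp add: V2_def ptrace_first_uconj[OF VS c(2) ptrace_carrier(2)] \<eta>_def K_def \<gamma>_def)
  qed
  have E': "ptrace_first (2 * dM) dE (uconj V \<eta>) = uconj VE (ptrace_first (2 * dM) dE \<eta>)"
    unfolding V_def by (rule ptrace_first_uconj[OF V2 c(3) \<eta>c[unfolded D_def]])
  have heat: "mtrace (uconj VE HE * (uconj VE (ptrace_first (2 * dM) dE \<eta>) - uconj VE \<gamma>)) =
     mtrace (HE * (ptrace_first (2 * dM) dE \<eta> - \<gamma>))"
    unfolding uconj_minus[OF c(3) ptrace_carrier(1) c(9), symmetric]
      uconj_mult[OF VE c(7) minus_carrier_mat[OF c(9)]]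
    by (rule mtrace_uconj[OF VE]) (use c in auto)
  show ?thesis
    unfolding protocol_def V2_def[symmetric] V_def[symmetric] K' \<eta>' H' marg' E'
  proof (intro conjI pos)
    show "hermitian dM (uconj VM HM)" by (rule hermitian_uconj[OF c(2) HM])
    show "hermitian dE (uconj VE HE)" by (rule hermitian_uconj[OF c(3) HE])
    show "density dM (uconj VM RM)" by (rule density_uconj[OF VM RM])
    show "unitary (2 * dM * dE) (uconj V U)" by (rule unitary_uconj[OF V[unfolded D_def] U])
    show "uconj V U * uconj V (htot Hs dM dE HM HE) = uconj V (htot Hs dM dE HM HE) * uconj V U"
      unfolding uconj_mult[OF V Uc Hc] uconj_mult[OF V Hc Uc] comm ..
    show "Q = Re (mtrace (uconj VE HE * (uconj VE (ptrace_first (2 * dM) dE \<eta>) - gibbs \<beta> (uconj VE HE))))"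
      unfolding gibbs_uconj(1)[OF VE HE] \<gamma>_def[symmetric] heat using Q by (simp add: \<eta>_def K_def \<gamma>_def)
  qed simp
qed

lemma heats_uconj:
  assumes Hs: "Hs \<in> carrier_mat 2 2" and \<rho>: "\<rho> \<in> carrier_mat 2 2" and V: "unitary 2 V"
  shows "heats \<beta> (uconj V Hs) (uconj V \<rho>) = heats \<beta> Hs \<rho>"
proof -
  have sub: "heats \<beta> Hs \<rho> \<subseteq> heats \<beta> (uconj V Hs) (uconj V \<rho>)"
    if "Hs \<in> carrier_mat 2 2" "\<rho> \<in> carrier_mat 2 2" "unitary 2 V" for Hs \<rho> V
  proof
    fix Q assume "Q \<in> heats \<beta> Hs \<rho>"
    then obtain dM dE HM HE RM U where "protocol \<beta> Hs \<rho> dM dE HM HE RM U Q"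
      by (auto simp: heats_protocol)
    from protocol_rotate[OF this that unitary_one unitary_one] show "Q \<in> heats \<beta> (uconj V Hs) (uconj V \<rho>)"
      unfolding heats_protocol by blast
  qed
  show ?thesis
    using sub[OF Hs \<rho> V] sub[OF _ _ unitary_adjoint[OF V], of "uconj V Hs" "uconj V \<rho>"]
      unitaryD(1)[OF V] Hs \<rho> by (simp add: uconj_inverse[OF V])
qed

section \<open>Energy balance and entropy inequalities\<close>

lemma mtrace_kron:
  assumes "A \<in> carrier_mat a a" "B \<in> carrier_mat b b"
  shows "mtrace (kron A B) = mtrace A * mtrace B"
proof -
  have "mtrace (kron A B) = (\<Sum>i<a. \<Sum>j<b. kron A B $$ (i * b + j, i * b + j))"
    using assms by (simp add: mtrace_def sum_lessThan_mult del: kron_index)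
  also have "\<dots> = (\<Sum>i<a. \<Sum>j<b. A $$ (i, i) * B $$ (j, j))"
    by (intro sum.cong refl kron_encode[OF assms]) auto
  finally show ?thesis using assms by (simp add: mtrace_def sum_product)
qed

lemma kron_diagm: "kron (diagm a d) (diagm b e) = diagm (a * b) (\<lambda>i. d (i div b) * e (i mod b))"
proof (rule eq_matI)
  fix i j assume "i < dim_row (diagm (a * b) (\<lambda>i. d (i div b) * e (i mod b)))" "j < dim_col (diagm (a * b) (\<lambda>i. d (i div b) * e (i mod b)))"
  hence ij: "i < a * b" "j < a * b" by auto
  have "i = j" if "i div b = j div b" "i mod b = j mod b"
    using that div_mult_mod_eq[of i b] div_mult_mod_eq[of j b] by metis
  then show "kron (diagm a d) (diagm b e) $$ (i, j) = diagm (a * b) (\<lambda>i. d (i div b) * e (i mod b)) $$ (i, j)"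
    using ij by (auto simp: div_less_mult mod_less_mult)
qed auto

lemma mtrace_htot_mult:
  assumes Hs: "Hs \<in> carrier_mat 2 2" and HM: "HM \<in> carrier_mat dM dM" and HE: "HE \<in> carrier_mat dE dE"
    and X: "X \<in> carrier_mat (2 * dM * dE) (2 * dM * dE)"
  shows "mtrace (htot Hs dM dE HM HE * X) =
     mtrace (Hs * ptrace_second 2 dM (ptrace_second (2 * dM) dE X)) +
     mtrace (HM * ptrace_first 2 dM (ptrace_second (2 * dM) dE X)) +
     mtrace (HE * ptrace_first (2 * dM) dE X)"
proof -
  have t: "kron (kron Hs (1\<^sub>m dM)) (1\<^sub>m dE) \<in> carrier_mat (2 * dM * dE) (2 * dM * dE)"
    "kron (kron (1\<^sub>m 2) HM) (1\<^sub>m dE) \<in> carrier_mat (2 * dM * dE) (2 * dM * dE)"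
    "kron (kron (1\<^sub>m 2) (1\<^sub>m dM)) HE \<in> carrier_mat (2 * dM * dE) (2 * dM * dE)"
    by (intro kron_carrier one_carrier_mat assms)+
  have "mtrace (htot Hs dM dE HM HE * X) = mtrace (kron (kron Hs (1\<^sub>m dM)) (1\<^sub>m dE) * X) +
    mtrace (kron (kron (1\<^sub>m 2) HM) (1\<^sub>m dE) * X) + mtrace (kron (kron (1\<^sub>m 2) (1\<^sub>m dM)) HE * X)"
    unfolding htot_def add_mult_distrib_mat[OF add_carrier_mat[OF t(2)] t(3) X] add_mult_distrib_mat[OF t(1,2) X]
      mtrace_add[OF add_carrier_mat[OF square_mult_carrier[OF t(2) X]] square_mult_carrier[OF t(3) X]]
      mtrace_add[OF square_mult_carrier[OF t(1) X] square_mult_carrier[OF t(2) X]] ..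
  also have "mtrace (kron (kron Hs (1\<^sub>m dM)) (1\<^sub>m dE) * X) = mtrace (Hs * ptrace_second 2 dM (ptrace_second (2 * dM) dE X))"
    unfolding mtrace_kron_one_mult[OF kron_carrier[OF Hs one_carrier_mat] X]
    by (rule mtrace_kron_one_mult[OF Hs ptrace_carrier(2)])
  also have "mtrace (kron (kron (1\<^sub>m 2) HM) (1\<^sub>m dE) * X) = mtrace (HM * ptrace_first 2 dM (ptrace_second (2 * dM) dE X))"
    unfolding mtrace_kron_one_mult[OF kron_carrier[OF one_carrier_mat HM] X]
    by (rule mtrace_one_kron_mult[OF HM ptrace_carrier(2)])
  also have "mtrace (kron (kron (1\<^sub>m 2) (1\<^sub>m dM)) HE * X) = mtrace (HE * ptrace_first (2 * dM) dE X)"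
    unfolding kron_one by (rule mtrace_one_kron_mult[OF HE X])
  finally show ?thesis .
qed

text \<open>Eigenvalue form: \<open>p\<close> is the spectrum of a state, \<open>q\<close> a
  reference distribution in a fixed basis, \<open>t\<close> the diagonal of the state in that basis,
  and \<open>T\<close> the doubly stochastic matrix of squared overlaps. It rests termwise on
  \<open>ln x \<le> x - 1\<close>; the linear terms cancel because rows and columns of
  \<open>T\<close> sum to one.\<close>

lemma klein_inequality:
  fixes T :: "'i \<Rightarrow> 'i \<Rightarrow> real"
  assumes J: "finite J" and T: "\<And>i j. i \<in> J \<Longrightarrow> j \<in> J \<Longrightarrow> T i j \<ge> 0"
    and r: "\<And>i. i \<in> J \<Longrightarrow> (\<Sum>j\<in>J. T i j) = 1" and c: "\<And>j. j \<in> J \<Longrightarrow> (\<Sum>i\<in>J. T i j) = 1"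
    and p: "\<And>j. j \<in> J \<Longrightarrow> p j \<ge> 0" "sum p J = 1" and q: "\<And>i. i \<in> J \<Longrightarrow> q i \<ge> 0" "sum q J = 1"
    and t: "\<And>i. i \<in> J \<Longrightarrow> t i = (\<Sum>j\<in>J. T i j * p j)"
    and supp: "\<And>i. i \<in> J \<Longrightarrow> q i = 0 \<Longrightarrow> t i = 0"
  shows "(\<Sum>i\<in>J. t i * ln (q i)) \<le> (\<Sum>j\<in>J. p j * ln (p j))"
proof -
  \<comment> \<open>Where \<open>q i\<close> is 0 the totalised logarithm is not minus infinity. The
    support assumption forces \<open>T i j * p j = 0\<close> there, which keeps the bound
    true.\<close>
  have pt: "T i j * p j * (ln (q i) - ln (p j)) \<le> T i j * (q i - p j)" if ij: "i \<in> J" "j \<in> J" for i j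
  proof (cases "q i = 0")
    case True
    have "\<forall>j\<in>J. T i j * p j = 0"
      using supp[OF ij(1) True] unfolding t[OF ij(1)]
      by (subst (asm) sum_nonneg_eq_0_iff) (use J T p ij in auto)
    then show ?thesis using ij T[OF ij] True by (auto simp: right_diff_distrib)
  next
    case False
    hence qi: "q i > 0" using q(1)[OF ij(1)] by simp
    show ?thesis
    proof (cases "p j = 0")
      case True
      then show ?thesis using qi T[OF ij] by simp
    next
      case False
      hence pj: "p j > 0" using p(1)[OF ij(2)] by simp
      have "ln (q i) - ln (p j) = ln (q i / p j)" using qi pj by (simp add: ln_div)
      also have "\<dots> \<le> q i / p j - 1" using qi pj by (intro ln_le_minus_one) simp
      finally have "p j * (ln (q i) - ln (p j)) \<le> p j * (q i / p j - 1)" using pj by (intro mult_left_mono) auto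
      also have "\<dots> = q i - p j" using pj by (simp add: field_simps)
      finally show ?thesis using mult_left_mono[OF _ T[OF ij]] by (simp add: mult.assoc)
    qed
  qed
  have "(\<Sum>i\<in>J. t i * ln (q i)) - (\<Sum>j\<in>J. p j * ln (p j)) =
     (\<Sum>i\<in>J. \<Sum>j\<in>J. T i j * p j * ln (q i)) - (\<Sum>j\<in>J. \<Sum>i\<in>J. T i j * (p j * ln (p j)))"
  proof -
    have "(\<Sum>i\<in>J. t i * ln (q i)) = (\<Sum>i\<in>J. \<Sum>j\<in>J. T i j * p j * ln (q i))"
      by (intro sum.cong refl) (simp add: t sum_distrib_right)
    moreover have "(\<Sum>j\<in>J. p j * ln (p j)) = (\<Sum>j\<in>J. \<Sum>i\<in>J. T i j * (p j * ln (p j)))"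
      unfolding sum_distrib_right[symmetric] by (intro sum.cong refl) (simp add: c)
    ultimately show ?thesis by simp
  qed
  also have "(\<Sum>j\<in>J. \<Sum>i\<in>J. T i j * (p j * ln (p j))) = (\<Sum>i\<in>J. \<Sum>j\<in>J. T i j * (p j * ln (p j)))"
    by (rule sum.swap)
  also have "(\<Sum>i\<in>J. \<Sum>j\<in>J. T i j * p j * ln (q i)) - (\<Sum>i\<in>J. \<Sum>j\<in>J. T i j * (p j * ln (p j))) =
     (\<Sum>i\<in>J. \<Sum>j\<in>J. T i j * p j * (ln (q i) - ln (p j)))"
    unfolding sum_subtractf[symmetric] by (intro sum.cong refl) (simp add: right_diff_distrib mult.assoc)
  also have "\<dots> \<le> (\<Sum>i\<in>J. \<Sum>j\<in>J. T i j * (q i - p j))" by (intro sum_mono pt)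
  also have "\<dots> = (\<Sum>i\<in>J. \<Sum>j\<in>J. T i j * q i) - (\<Sum>i\<in>J. \<Sum>j\<in>J. T i j * p j)"
    by (simp add: right_diff_distrib sum_subtractf)
  also have "(\<Sum>i\<in>J. \<Sum>j\<in>J. T i j * p j) = (\<Sum>j\<in>J. \<Sum>i\<in>J. T i j * p j)" by (rule sum.swap)
  also have "(\<Sum>i\<in>J. \<Sum>j\<in>J. T i j * q i) - (\<Sum>j\<in>J. \<Sum>i\<in>J. T i j * p j) = 0"
    unfolding sum_distrib_right[symmetric] by (simp add: r c p q)
  finally show ?thesis by simp
qed

lemma one_smult_complex_mat [simp]: "1 \<cdot>\<^sub>m X = (X :: complex mat)"
  by (rule eq_matI) auto

lemma sum_lessThan_2: "(\<Sum>i<(2::nat). f i) = f 0 + f 1"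
  by (simp add: numeral_2_eq_2)

lemma qubit_matrix_eigen:
  fixes \<phi> R :: real
  defines "A \<equiv> mat 2 2 (\<lambda>(i, j). complex_of_real (qubit_eigenvector \<phi> (i = 0) (j = 0)))"
  shows "unitary 2 A" "qubit_matrix (qubit_kernel (R * cos \<phi>) (R * sin \<phi>)) =
    uconj A (diagm 2 (\<lambda>i. of_real (if i = 0 then (1 + R) / 2 else (1 - R) / 2)))"
proof -
  have A: "A \<in> carrier_mat 2 2" by (simp add: A_def)
  have sc: "sin (\<phi>/2) * sin (\<phi>/2) + cos (\<phi>/2) * cos (\<phi>/2) = 1"
    using sin_cos_squared_add[of "\<phi>/2"] by (simp add: power2_eq_square)
  hence sc': "cos (\<phi>/2) * cos (\<phi>/2) + sin (\<phi>/2) * sin (\<phi>/2) = 1" by simp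
  have ent: "(A * mat_adjoint A) $$ (i, j) = of_bool (i = j) \<and> (mat_adjoint A * A) $$ (i, j) = of_bool (i = j)"
    if "i < 2" "j < 2" for i j
  proof -
    have cases: "i = 0 \<or> i = 1" "j = 0 \<or> j = 1" using that by auto
    have "(A * mat_adjoint A) $$ (i, j) = of_real (\<Sum>k<(2 :: nat). qubit_eigenvector \<phi> (i = 0) (k = 0) * qubit_eigenvector \<phi> (j = 0) (k = 0))"
      "(mat_adjoint A * A) $$ (i, j) = of_real (\<Sum>k<(2 :: nat). qubit_eigenvector \<phi> (k = 0) (i = 0) * qubit_eigenvector \<phi> (k = 0) (j = 0))"
      using that A by (simp_all add: index_mult_mat_sum A_def del: index_mult_mat(1))
    then show ?thesis unfolding sum_lessThan_2 using cases sc sc'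
      by (elim disjE) (simp_all add: qubit_eigenvector_def del: of_real_add of_real_mult)
  qed
  show "unitary 2 A"
    unfolding unitary_def by (intro conjI A eq_matI) (use ent A in auto)
  have dims: "dim_row (uconj A (diagm 2 d)) = 2" "dim_col (uconj A (diagm 2 d)) = 2" for d
    using A by (auto simp: uconj_def)
  show "qubit_matrix (qubit_kernel (R * cos \<phi>) (R * sin \<phi>)) =
    uconj A (diagm 2 (\<lambda>i. of_real (if i = 0 then (1 + R) / 2 else (1 - R) / 2)))"
  proof (rule eq_matI)
    fix i j assume "i < dim_row (uconj A (diagm 2 (\<lambda>i. of_real (if i = 0 then (1 + R) / 2 else (1 - R) / 2))))"
      "j < dim_col (uconj A (diagm 2 (\<lambda>i. of_real (if i = 0 then (1 + R) / 2 else (1 - R) / 2))))"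
    hence ij: "i < 2" "j < 2" by (auto simp: dims)
    show "qubit_matrix (qubit_kernel (R * cos \<phi>) (R * sin \<phi>)) $$ (i, j) =
      uconj A (diagm 2 (\<lambda>i. of_real (if i = 0 then (1 + R) / 2 else (1 - R) / 2))) $$ (i, j)"
      unfolding uconj_diagm_index[OF A ij] sum_lessThan_2 using ij
      by (simp add: qubit_matrix_def qubit_kernel_eigen A_def mult_ac)
  qed (auto simp: dims qubit_matrix_def)
qed

text \<open>Local rotations of memory and bath make the memory state and the bath Hamiltonian
  diagonal; the system basis, in which the energy is read, stays put.\<close>

lemma protocol_diagonalize:
  assumes "Q \<in> heats \<beta> Hs \<rho>" and Hs: "Hs \<in> carrier_mat 2 2" and \<rho>: "\<rho> \<in> carrier_mat 2 2"
  obtains dM dE HM U and \<epsilon> \<mu> :: "nat \<Rightarrow> real" where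
    "protocol \<beta> Hs \<rho> dM dE HM (diagm dE (\<lambda>i. of_real (\<epsilon> i))) (diagm dM (\<lambda>i. of_real (\<mu> i))) U Q"
proof -
  from assms(1) obtain dM dE HM HE RM U where p: "protocol \<beta> Hs \<rho> dM dE HM HE RM U Q"
    by (auto simp: heats_protocol)
  hence h: "hermitian dE HE" "hermitian dM RM" by (auto simp: protocol_def density_def)
  obtain PE \<epsilon> where PE: "unitary dE PE" "HE = uconj PE (diagm dE (\<lambda>i. complex_of_real (\<epsilon> i)))"
    using spectral_theorem[OF h(1)] by blast
  obtain PM \<mu> where PM: "unitary dM PM" "RM = uconj PM (diagm dM (\<lambda>i. complex_of_real (\<mu> i)))"
    using spectral_theorem[OF h(2)] by blast
  from protocol_rotate[OF p Hs \<rho> unitary_one unitary_adjoint[OF PM(1)] unitary_adjoint[OF PE(1)]]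
  show thesis
    unfolding one_uconj[OF Hs] one_uconj[OF \<rho>] PE(2) PM(2) uconj_inverse(2)[OF PE(1) diagm_carrier]
      uconj_inverse(2)[OF PM(1) diagm_carrier] by (rule that)
qed

lemma density_diagm:
  assumes "density n (diagm n (\<lambda>i. complex_of_real (\<mu> i)))"
  shows "\<And>i. i < n \<Longrightarrow> \<mu> i \<ge> 0" "(\<Sum>i<n. \<mu> i) = 1"
proof -
  show "\<mu> i \<ge> 0" if i: "i < n" for i
  proof -
    define v where "v j = complex_of_real (of_bool (j = i))" for j
    have "0 \<le> Re (\<Sum>a<n. \<Sum>b<n. cnj (v a) * diagm n (\<lambda>i. complex_of_real (\<mu> i)) $$ (a, b) * v b)"
      using assms by (simp add: density_def)
    also have "(\<Sum>a<n. \<Sum>b<n. cnj (v a) * diagm n (\<lambda>i. complex_of_real (\<mu> i)) $$ (a, b) * v b) =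
      (\<Sum>a<n. \<Sum>b<n. if b = i then (if a = i then of_real (\<mu> i) else 0) else 0)"
      by (intro sum.cong refl) (auto simp: v_def)
    also have "\<dots> = of_real (\<mu> i)" using i by simp
    finally show ?thesis by simp
  qed
  have "complex_of_real (\<Sum>i<n. \<mu> i) = 1" using assms by (simp add: density_def mtrace_diagm)
  then show "(\<Sum>i<n. \<mu> i) = 1" by (simp only: of_real_eq_1_iff)
qed

lemma sum_product3:
  fixes f h u :: "nat \<Rightarrow> real"
  shows "(\<Sum>i<a. \<Sum>j<b. \<Sum>k<c. f i * h j * u k) = (\<Sum>i<a. f i) * (\<Sum>j<b. h j) * (\<Sum>k<c. u k)"
  by (simp only: sum_distrib_left[symmetric] sum_distrib_right[symmetric])

lemma entropy_product:
  fixes l m g :: "nat \<Rightarrow> real"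
  assumes l: "\<And>i. i < a \<Longrightarrow> l i \<ge> 0" "(\<Sum>i<a. l i) = 1" and m: "\<And>i. i < b \<Longrightarrow> m i \<ge> 0" "(\<Sum>i<b. m i) = 1"
    and g: "\<And>i. i < c \<Longrightarrow> g i \<ge> 0" "(\<Sum>i<c. g i) = 1"
  shows "(\<Sum>i<a. \<Sum>j<b. \<Sum>k<c. l i * m j * g k * ln (l i * m j * g k)) =
    (\<Sum>i<a. l i * ln (l i)) + (\<Sum>j<b. m j * ln (m j)) + (\<Sum>k<c. g k * ln (g k))"
proof -
  have pt: "l i * m j * g k * ln (l i * m j * g k) =
     (l i * ln (l i)) * m j * g k + l i * (m j * ln (m j)) * g k + l i * m j * (g k * ln (g k))"
    if "i < a" "j < b" "k < c" for i j k
  proof (cases "l i = 0 \<or> m j = 0 \<or> g k = 0")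
    case False
    hence "l i > 0" "m j > 0" "g k > 0" using that l m g by (auto simp: order_less_le)
    hence "ln (l i * m j * g k) = ln (l i) + ln (m j) + ln (g k)" by (simp add: ln_mult)
    then show ?thesis by (simp add: algebra_simps)
  qed auto
  have "(\<Sum>i<a. \<Sum>j<b. \<Sum>k<c. l i * m j * g k * ln (l i * m j * g k)) =
    (\<Sum>i<a. \<Sum>j<b. \<Sum>k<c. (l i * ln (l i)) * m j * g k + l i * (m j * ln (m j)) * g k + l i * m j * (g k * ln (g k)))"
    by (intro sum.cong refl pt) auto
  also have "\<dots> = (\<Sum>i<a. l i * ln (l i)) * (\<Sum>j<b. m j) * (\<Sum>k<c. g k) +
    (\<Sum>i<a. l i) * (\<Sum>j<b. m j * ln (m j)) * (\<Sum>k<c. g k) + (\<Sum>i<a. l i) * (\<Sum>j<b. m j) * (\<Sum>k<c. g k * ln (g k))"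
    by (simp only: sum.distrib sum_product3)
  finally show ?thesis by (simp add: l m g)
qed

text \<open>The logarithm of a product splits into one term per factor, each seeing only a marginal
  of \<open>t\<close>. The first two marginals equal the reference factors, so their terms become
  entropies; the bath marginal \<open>tg'\<close> differs from \<open>g\<close>.\<close>

lemma cross_entropy_product:
  fixes d m g :: "nat \<Rightarrow> real" and t :: "nat \<Rightarrow> nat \<Rightarrow> nat \<Rightarrow> real"
  assumes d: "\<And>i. i < a \<Longrightarrow> d i \<ge> 0" and m: "\<And>i. i < b \<Longrightarrow> m i \<ge> 0" and g: "\<And>i. i < c \<Longrightarrow> g i \<ge> 0"
    and supp: "\<And>i j k. i < a \<Longrightarrow> j < b \<Longrightarrow> k < c \<Longrightarrow> d i * m j * g k = 0 \<Longrightarrow> t i j k = 0"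
    and td: "\<And>i. i < a \<Longrightarrow> (\<Sum>j<b. \<Sum>k<c. t i j k) = d i"
    and tm: "\<And>j. j < b \<Longrightarrow> (\<Sum>i<a. \<Sum>k<c. t i j k) = m j"
    and tg: "\<And>k. k < c \<Longrightarrow> (\<Sum>i<a. \<Sum>j<b. t i j k) = tg' k"
  shows "(\<Sum>i<a. \<Sum>j<b. \<Sum>k<c. t i j k * ln (d i * m j * g k)) =
    (\<Sum>i<a. d i * ln (d i)) + (\<Sum>j<b. m j * ln (m j)) + (\<Sum>k<c. tg' k * ln (g k))"
proof -
  have pt: "t i j k * ln (d i * m j * g k) = t i j k * ln (d i) + t i j k * ln (m j) + t i j k * ln (g k)"
    if "i < a" "j < b" "k < c" for i j k
  proof (cases "d i * m j * g k = 0")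
    case False
    hence "d i > 0" "m j > 0" "g k > 0" using that d m g by (auto simp: order_less_le)
    hence "ln (d i * m j * g k) = ln (d i) + ln (m j) + ln (g k)" by (simp add: ln_mult)
    then show ?thesis by (simp add: algebra_simps)
  qed (use supp that in auto)
  have "(\<Sum>i<a. \<Sum>j<b. \<Sum>k<c. t i j k * ln (d i * m j * g k)) =
    (\<Sum>i<a. \<Sum>j<b. \<Sum>k<c. t i j k * ln (d i) + t i j k * ln (m j) + t i j k * ln (g k))"
    by (intro sum.cong refl pt) auto
  also have "\<dots> = (\<Sum>i<a. \<Sum>j<b. \<Sum>k<c. t i j k * ln (d i)) + (\<Sum>i<a. \<Sum>j<b. \<Sum>k<c. t i j k * ln (m j)) +
     (\<Sum>i<a. \<Sum>j<b. \<Sum>k<c. t i j k * ln (g k))"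
    by (simp add: sum.distrib)
  also have "(\<Sum>i<a. \<Sum>j<b. \<Sum>k<c. t i j k * ln (d i)) = (\<Sum>i<a. d i * ln (d i))"
    unfolding sum_distrib_right[symmetric] by (intro sum.cong refl) (simp add: td)
  also have "(\<Sum>i<a. \<Sum>j<b. \<Sum>k<c. t i j k * ln (m j)) = (\<Sum>j<b. \<Sum>i<a. \<Sum>k<c. t i j k * ln (m j))"
    by (rule sum.swap)
  also have "\<dots> = (\<Sum>j<b. m j * ln (m j))"
    unfolding sum_distrib_right[symmetric] by (intro sum.cong refl) (simp add: tm)
  also have "(\<Sum>i<a. \<Sum>j<b. \<Sum>k<c. t i j k * ln (g k)) = (\<Sum>k<c. \<Sum>i<a. \<Sum>j<b. t i j k * ln (g k))"
    by (rule sum_rotate)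
  also have "\<dots> = (\<Sum>k<c. tg' k * ln (g k))"
    unfolding sum_distrib_right[symmetric] by (intro sum.cong refl) (simp add: tg)
  finally show ?thesis .
qed

text \<open>The reference suits the bound for two reasons: \<open>d\<close> holds the actual final
  populations of the system, so its cross entropy is an entropy, and \<open>ln (g k)\<close> is
  affine in \<open>\<epsilon> k\<close>, so the bath terms combine to \<open>- \<beta> * Q\<close>.
  The witness for \<open>e\<close> is \<open>d 0 - d 1\<close>.\<close>

lemma diagonal_protocol_second_law:
  fixes \<beta> R \<phi> Q :: real and \<epsilon> \<mu> :: "nat \<Rightarrow> real"
  assumes R: "0 \<le> R" "R \<le> 1" and p: "protocol \<beta> pauliZ (qubit_matrix (qubit_kernel (R * cos \<phi>) (R * sin \<phi>))) dM dE HM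
    (diagm dE (\<lambda>i. of_real (\<epsilon> i))) (diagm dM (\<lambda>i. of_real (\<mu> i))) U Q"
  shows "\<exists>e. -1 \<le> e \<and> e \<le> 1 \<and> Q = R * cos \<phi> - e \<and> binary_entropy ((1 + R) / 2) \<le> binary_entropy ((1 + e) / 2) + \<beta> * Q"
proof -
  define \<rho> where "\<rho> = qubit_matrix (qubit_kernel (R * cos \<phi>) (R * sin \<phi>))"
  have \<rho>c: "\<rho> \<in> carrier_mat 2 2" by (simp add: \<rho>_def qubit_matrix_def)
  have Zc: "pauliZ \<in> carrier_mat 2 2" by (simp add: pauliZ_diagm)
  define HE where "HE = diagm dE (\<lambda>i. complex_of_real (\<epsilon> i))"
  define RM where "RM = diagm dM (\<lambda>i. complex_of_real (\<mu> i))"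
  define Z where "Z = (\<Sum>k<dE. exp (- (\<beta> * \<epsilon> k)))"
  define g where "g k = exp (- (\<beta> * \<epsilon> k)) / Z" for k
  define \<gamma> where "\<gamma> = diagm dE (\<lambda>k. complex_of_real (g k))"
  have gibbs: "gibbs \<beta> HE = \<gamma>" unfolding HE_def gibbs_diagm \<gamma>_def g_def Z_def ..
  define D where "D = 2 * dM * dE"
  define K where "K = kron (kron \<rho> RM) \<gamma>"
  define \<eta> where "\<eta> = uconj U K"
  have pos: "0 < dM" "0 < dE" and HM: "hermitian dM HM" and RM: "density dM RM"
    and U: "unitary D U" and comm: "U * htot pauliZ dM dE HM HE = htot pauliZ dM dE HM HE * U"
    and marg: "ptrace_first 2 dM (ptrace_second (2 * dM) dE \<eta>) = RM"
    and Qe: "Q = Re (mtrace (HE * (ptrace_first (2 * dM) dE \<eta> - \<gamma>)))"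
    using p unfolding \<rho>_def[symmetric] protocol_def HE_def[symmetric] RM_def[symmetric] gibbs \<eta>_def K_def D_def by blast+
  have HMc: "HM \<in> carrier_mat dM dM" by (rule hermitian_carrier[OF HM])
  have c: "HE \<in> carrier_mat dE dE" "RM \<in> carrier_mat dM dM" "\<gamma> \<in> carrier_mat dE dE"
    by (simp_all add: HE_def RM_def \<gamma>_def)
  have kc: "kron \<rho> RM \<in> carrier_mat (2 * dM) (2 * dM)" by (rule kron_carrier[OF \<rho>c c(2)])
  have Kc: "K \<in> carrier_mat D D" unfolding K_def D_def by (rule kron_carrier[OF kc c(3)])
  have Uc: "U \<in> carrier_mat D D" by (rule unitaryD(1)[OF U])
  have \<eta>c: "\<eta> \<in> carrier_mat D D" unfolding \<eta>_def using Uc Kc by simp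
  note \<mu> = density_diagm[OF RM[unfolded RM_def]]
  have Z0: "Z > 0" unfolding Z_def using pos by (intro sum_pos) auto
  have g0: "g k > 0" for k using Z0 by (simp add: g_def)
  have g1: "(\<Sum>k<dE. g k) = 1" unfolding g_def sum_divide_distrib[symmetric] using Z0 by (simp add: Z_def)
  have tr\<rho>: "mtrace \<rho> = 1" using qubit_kernel_trace by (simp add: \<rho>_def mtrace_def qubit_matrix_def sum_lessThan_2)
  have trRM: "mtrace RM = 1" using RM by (simp add: density_def)
  have tr\<gamma>: "mtrace \<gamma> = 1" using g1 by (simp add: \<gamma>_def mtrace_diagm flip: of_real_sum)

  define t where "t s m k = Re (\<eta> $$ ((s * dM + m) * dE + k, (s * dM + m) * dE + k))" for s m k
  define d where "d s = (\<Sum>m<dM. \<Sum>k<dE. t s m k)" for s :: nat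
  define tE where "tE k = (\<Sum>s<2. \<Sum>m<dM. t s m k)" for k
  define \<eta>S where "\<eta>S = ptrace_second 2 dM (ptrace_second (2 * dM) dE \<eta>)"
  have dS: "Re (\<eta>S $$ (s, s)) = d s" if "s < 2" for s
    using that by (simp add: \<eta>S_def ptrace_second_def d_def t_def mult_add_less)
  have tE: "Re (ptrace_first (2 * dM) dE \<eta> $$ (k, k)) = tE k" if "k < dE" for k
    using that unfolding tE_def t_def by (simp add: ptrace_first_def sum_lessThan_mult[of _ 2 dM])
  have tM: "(\<Sum>s<2. \<Sum>k<dE. t s m k) = \<mu> m" if m: "m < dM" for m
  proof -
    have "ptrace_first 2 dM (ptrace_second (2 * dM) dE \<eta>) $$ (m, m) =
       (\<Sum>s<2. \<Sum>k<dE. \<eta> $$ ((s * dM + m) * dE + k, (s * dM + m) * dE + k))"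
      using m by (auto simp: ptrace_first_def ptrace_second_def mult_add_less intro!: sum.cong)
    hence "Re (RM $$ (m, m)) = (\<Sum>s<2. \<Sum>k<dE. t s m k)" unfolding marg by (simp add: t_def)
    then show ?thesis using m by (simp add: RM_def)
  qed

  \<comment> \<open>Total energy is conserved and the memory has the same energy before and after,
    so the bath gains what the system loses.\<close>
  have heat: "mtrace (HE * (ptrace_first (2 * dM) dE \<eta> - \<gamma>)) = mtrace (pauliZ * \<rho>) - mtrace (pauliZ * \<eta>S)"
  proof -
    have Hc: "htot pauliZ dM dE HM HE \<in> carrier_mat D D"
      unfolding D_def by (rule htot_carrier[OF Zc HMc c(1)])
    have "htot pauliZ dM dE HM HE * \<eta> = uconj U (htot pauliZ dM dE HM HE * K)"
    proof -
      have "htot pauliZ dM dE HM HE * \<eta> = (htot pauliZ dM dE HM HE * U) * (K * mat_adjoint U)"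
        unfolding \<eta>_def uconj_def using Hc Uc Kc mat_adjoint_carrier[OF Uc]
        by (simp add: square_mult_assoc[where n = D])
      also have "\<dots> = uconj U (htot pauliZ dM dE HM HE * K)"
        unfolding comm[symmetric] uconj_def using Hc Uc Kc mat_adjoint_carrier[OF Uc]
        by (simp add: square_mult_assoc[where n = D])
      finally show ?thesis .
    qed
    hence "mtrace (htot pauliZ dM dE HM HE * \<eta>) = mtrace (htot pauliZ dM dE HM HE * K)"
      using mtrace_uconj[OF U square_mult_carrier[OF Hc Kc]] by simp
    moreover have "mtrace (htot pauliZ dM dE HM HE * \<eta>) =
      mtrace (pauliZ * \<eta>S) + mtrace (HM * RM) + mtrace (HE * ptrace_first (2 * dM) dE \<eta>)"
      unfolding mtrace_htot_mult[OF Zc HMc c(1) \<eta>c[unfolded D_def]] marg \<eta>S_def ..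
    moreover have "mtrace (htot pauliZ dM dE HM HE * K) = mtrace (pauliZ * \<rho>) + mtrace (HM * RM) + mtrace (HE * \<gamma>)"
    proof -
      have "ptrace_second (2 * dM) dE K = kron \<rho> RM"
        unfolding K_def ptrace_kron(2)[OF kc c(3)] tr\<gamma> by simp
      moreover have "ptrace_first (2 * dM) dE K = \<gamma>"
        unfolding K_def ptrace_kron(1)[OF kc c(3)] mtrace_kron[OF \<rho>c c(2)] tr\<rho> trRM by simp
      ultimately show ?thesis
        unfolding mtrace_htot_mult[OF Zc HMc c(1) Kc[unfolded D_def]]
        by (simp add: ptrace_kron[OF \<rho>c c(2)] tr\<rho> trRM)
    qed
    moreover have "mtrace (HE * (ptrace_first (2 * dM) dE \<eta> - \<gamma>)) =
      mtrace (HE * ptrace_first (2 * dM) dE \<eta>) - mtrace (HE * \<gamma>)"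
      unfolding mult_minus_distrib_mat[OF c(1) ptrace_carrier(1) c(3)]
      by (rule mtrace_minus[OF square_mult_carrier[OF c(1) ptrace_carrier(1)] square_mult_carrier[OF c(1,3)]])
    moreover have "x - y = z - w" if "w + m + x = z + m + y" for x y z w m :: complex
    proof -
      have "x - y = (w + m + x) - (w + m + y)" by simp
      also have "\<dots> = z - w" unfolding that by simp
      finally show ?thesis .
    qed
    ultimately show ?thesis by metis
  qed
  have trZ: "mtrace (pauliZ * X) = X $$ (0, 0) - X $$ (1, 1)" if "X \<in> carrier_mat 2 2" for X
    unfolding mtrace_def pauliZ_diagm using that by (simp add: sum_lessThan_2 diagm_mult_index del: index_mult_mat(1))
  have \<eta>Sc: "\<eta>S \<in> carrier_mat 2 2" unfolding \<eta>S_def by (rule ptrace_carrier(2))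
  have "Re (mtrace (pauliZ * \<rho>)) = R * cos \<phi>"
    unfolding trZ[OF \<rho>c] by (simp add: \<rho>_def qubit_matrix_def qubit_kernel_def field_simps)
  moreover have "Re (mtrace (pauliZ * \<eta>S)) = d 0 - d 1"
    unfolding trZ[OF \<eta>Sc] using dS[of 0] dS[of 1] by simp
  ultimately have Qd: "Q = R * cos \<phi> - (d 0 - d 1)" unfolding Qe heat by simp

  define A where "A = mat 2 2 (\<lambda>(i, j). complex_of_real (qubit_eigenvector \<phi> (i = 0) (j = 0)))"
  note A = qubit_matrix_eigen(1)[where \<phi> = \<phi>, folded A_def] qubit_matrix_eigen(2)[where \<phi> = \<phi> and R = R, folded A_def \<rho>_def]
  define l where "l i = (if i = 0 then (1 + R) / 2 else (1 - R) / 2)" for i :: nat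
  have l0: "l i \<ge> 0" for i using R by (simp add: l_def)
  have l1: "(\<Sum>i<2. l i) = 1" by (simp add: l_def sum_lessThan_2 field_simps)
  \<comment> \<open>\<open>P\<close> lists the eigenvalues of the global state, unchanged by the
    evolution, and \<open>q\<close> the reference; the columns of \<open>W\<close> below are the
    evolved eigenvectors.\<close>
  define P where "P i = l (i div dE div dM) * \<mu> (i div dE mod dM) * g (i mod dE)" for i
  define q where "q i = d (i div dE div dM) * \<mu> (i div dE mod dM) * g (i mod dE)" for i
  have enc: "(s * dM + m) * dE + k < D" "((s * dM + m) * dE + k) div dE div dM = s"
    "((s * dM + m) * dE + k) div dE mod dM = m" "((s * dM + m) * dE + k) mod dE = k"
    if "s < 2" "m < dM" "k < dE" for s m k
    using that by (auto simp: D_def intro!: mult_add_less)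
  have sumD: "(\<Sum>i<D. f i) = (\<Sum>s<2. \<Sum>m<dM. \<Sum>k<dE. f ((s * dM + m) * dE + k))" for f :: "nat \<Rightarrow> real"
    unfolding D_def sum_lessThan_mult ..
  define V where "V = kron (kron A (1\<^sub>m dM)) (1\<^sub>m dE)"
  have V: "unitary D V" unfolding V_def D_def by (intro unitary_kron A(1) unitary_one)
  define W where "W = U * V"
  have W: "unitary D W" unfolding W_def by (rule unitary_mult[OF U V])
  have Wc: "W \<in> carrier_mat D D" by (rule unitaryD(1)[OF W])
  have KV: "K = uconj V (diagm D (\<lambda>i. complex_of_real (P i)))"
  proof -
    have "diagm D (\<lambda>i. complex_of_real (P i)) = kron (kron (diagm 2 (\<lambda>i. of_real (l i))) RM) \<gamma>"
      unfolding RM_def \<gamma>_def kron_diagm D_def by (simp add: P_def)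
    then show ?thesis
      unfolding K_def V_def A(2) l_def[symmetric]
      using unitaryD(1)[OF A(1)] c
      by (simp add: uconj_kron[where a = "2 * dM" and b = dE] uconj_kron[where a = 2 and b = dM] one_uconj)
  qed
  have \<eta>W: "\<eta> = uconj W (diagm D (\<lambda>i. complex_of_real (P i)))"
    unfolding \<eta>_def KV W_def by (rule uconj_uconj[OF Uc unitaryD(1)[OF V] diagm_carrier])
  define T where "T i j = (cmod (W $$ (i, j)))\<^sup>2" for i j
  have \<eta>T: "Re (\<eta> $$ (i, i)) = (\<Sum>j<D. T i j * P j)" if "i < D" for i
  proof -
    have "\<eta> $$ (i, i) = (\<Sum>j<D. of_real (T i j * P j))"
      unfolding \<eta>W uconj_diagm_index[OF Wc that that] T_def of_real_mult of_real_cmod_power2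
      by (intro sum.cong refl) (simp add: mult_ac)
    then show ?thesis by simp
  qed
  have T0: "T i j \<ge> 0" for i j by (simp add: T_def)
  have Tc: "(\<Sum>i<D. T i j) = 1" if "j < D" for j
  proof -
    have "complex_of_real (\<Sum>i<D. T i j) = (\<Sum>i<D. W $$ (i, j) * cnj (W $$ (i, j)))"
      unfolding of_real_sum T_def of_real_cmod_power2 by (simp add: mult.commute)
    also have "\<dots> = 1" using unitary_columns[OF W that that] by simp
    finally show ?thesis by (simp only: of_real_eq_1_iff)
  qed
  have Tr: "(\<Sum>j<D. T i j) = 1" if "i < D" for i
  proof -
    have "complex_of_real (\<Sum>j<D. T i j) = (\<Sum>j<D. mat_adjoint W $$ (j, i) * cnj (mat_adjoint W $$ (j, i)))"
      unfolding of_real_sum T_def of_real_cmod_power2 using Wc that by (intro sum.cong refl) simp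
    also have "\<dots> = 1" using unitary_columns[OF unitary_adjoint[OF W] that that] by simp
    finally show ?thesis by (simp only: of_real_eq_1_iff)
  qed
  have P0: "P j \<ge> 0" if "j < D" for j
  proof -
    have "j div dE mod dM < dM" using pos by simp
    then show ?thesis unfolding P_def using l0 \<mu>(1) g0 by (intro mult_nonneg_nonneg) (auto intro: less_imp_le)
  qed
  have P1: "(\<Sum>j<D. P j) = 1"
  proof -
    have "(\<Sum>j<D. P j) = (\<Sum>s<2. \<Sum>m<dM. \<Sum>k<dE. l s * \<mu> m * g k)"
      unfolding sumD by (intro sum.cong refl) (simp add: P_def enc)
    also have "\<dots> = (\<Sum>s<2. l s) * (\<Sum>m<dM. \<mu> m) * (\<Sum>k<dE. g k)"
      by (rule sum_product3)
    finally show ?thesis by (simp add: l1 \<mu>(2) g1)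
  qed
  have t\<eta>: "t s m k = (\<Sum>j<D. T ((s * dM + m) * dE + k) j * P j)" if "s < 2" "m < dM" "k < dE" for s m k
    unfolding t_def by (rule \<eta>T) (use enc that in auto)
  have t0: "t s m k \<ge> 0" if "s < 2" "m < dM" "k < dE" for s m k
    unfolding t\<eta>[OF that] using T0 P0 by (intro sum_nonneg mult_nonneg_nonneg) auto
  have d0: "d s \<ge> 0" if "s < 2" for s
    unfolding d_def using t0 that by (intro sum_nonneg) auto
  have sum_t: "(\<Sum>s<2. \<Sum>m<dM. \<Sum>k<dE. t s m k) = 1"
  proof -
    have "(\<Sum>s<2. \<Sum>m<dM. \<Sum>k<dE. t s m k) = (\<Sum>i<D. \<Sum>j<D. T i j * P j)"
      unfolding sumD[of "\<lambda>i. \<Sum>j<D. T i j * P j"] by (intro sum.cong refl t\<eta>) auto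
    also have "\<dots> = (\<Sum>j<D. \<Sum>i<D. T i j * P j)" by (rule sum.swap)
    also have "\<dots> = (\<Sum>j<D. P j)" unfolding sum_distrib_right[symmetric] by (intro sum.cong refl) (simp add: Tc)
    finally show ?thesis by (simp add: P1)
  qed
  have d1: "(\<Sum>s<2. d s) = 1" unfolding d_def by (rule sum_t)
  have tE1: "(\<Sum>k<dE. tE k) = 1"
  proof -
    have "(\<Sum>k<dE. tE k) = (\<Sum>s<2. \<Sum>m<dM. \<Sum>k<dE. t s m k)"
      unfolding tE_def by (rule sum_rotate[symmetric])
    then show ?thesis by (simp add: sum_t)
  qed
  have q0: "q j \<ge> 0" if "j < D" for j
  proof -
    have "j div dE mod dM < dM" "j div dE div dM < 2"
      using pos that by (auto simp: D_def intro!: div_less_mult)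
    then show ?thesis unfolding q_def using d0 \<mu>(1) g0 by (intro mult_nonneg_nonneg) (auto intro: less_imp_le)
  qed
  have q1: "(\<Sum>j<D. q j) = 1"
  proof -
    have "(\<Sum>j<D. q j) = (\<Sum>s<2. \<Sum>m<dM. \<Sum>k<dE. d s * \<mu> m * g k)"
      unfolding sumD by (intro sum.cong refl) (simp add: q_def enc)
    also have "\<dots> = (\<Sum>s<2. d s) * (\<Sum>m<dM. \<mu> m) * (\<Sum>k<dE. g k)"
      by (rule sum_product3)
    finally show ?thesis by (simp add: d1 \<mu>(2) g1)
  qed
  have supp: "t s m k = 0" if smk: "s < 2" "m < dM" "k < dE" and z: "d s * \<mu> m * g k = 0" for s m k
  proof -
    \<comment> \<open>Gibbs weights are positive, so a vanishing reference weight means a vanishing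
      marginal of \<open>t\<close>, and a sum of nonnegative terms vanishes termwise.\<close>
    have "d s = 0 \<or> \<mu> m = 0" using z g0[of k] by auto
    then show ?thesis
    proof
      assume "d s = 0"
      hence "\<forall>m\<in>{..<dM}. (\<Sum>k<dE. t s m k) = 0" unfolding d_def
        by (subst (asm) sum_nonneg_eq_0_iff) (use t0 smk in \<open>auto intro: sum_nonneg\<close>)
      hence "(\<Sum>k<dE. t s m k) = 0" using smk by blast
      then show ?thesis by (subst (asm) sum_nonneg_eq_0_iff) (use t0 smk in auto)
    next
      assume "\<mu> m = 0"
      hence "\<forall>s\<in>{..<2}. (\<Sum>k<dE. t s m k) = 0" unfolding tM[OF smk(2), symmetric]
        by (subst (asm) sum_nonneg_eq_0_iff) (use t0 smk in \<open>auto intro: sum_nonneg\<close>)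
      hence "(\<Sum>k<dE. t s m k) = 0" using smk by blast
      then show ?thesis by (subst (asm) sum_nonneg_eq_0_iff) (use t0 smk in auto)
    qed
  qed
  have "(\<Sum>i<D. Re (\<eta> $$ (i, i)) * ln (q i)) \<le> (\<Sum>j<D. P j * ln (P j))"
  proof (rule klein_inequality[where T = T])
    show "Re (\<eta> $$ (i, i)) = 0" if "i \<in> {..<D}" "q i = 0" for i
    proof -
      define s m k where "s = i div dE div dM" and "m = i div dE mod dM" and "k = i mod dE"
      have "s < 2" "m < dM" "k < dE"
        using pos that by (auto simp: D_def s_def m_def k_def intro!: div_less_mult)
      moreover have "q i = d s * \<mu> m * g k" unfolding q_def s_def m_def k_def ..
      ultimately have "t s m k = 0" using supp[of s m k] that(2) by simp
      moreover have i: "i = (s * dM + m) * dE + k" by (simp add: s_def m_def k_def)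
      ultimately show ?thesis by (simp only: t_def)
    qed
  qed (use T0 Tr Tc P0 P1 q0 q1 \<eta>T in auto)
  also have "(\<Sum>j<D. P j * ln (P j)) = (\<Sum>s<2. \<Sum>m<dM. \<Sum>k<dE. l s * \<mu> m * g k * ln (l s * \<mu> m * g k))"
    unfolding sumD by (intro sum.cong refl) (simp add: P_def enc)
  also have "\<dots> = (\<Sum>s<2. l s * ln (l s)) + (\<Sum>m<dM. \<mu> m * ln (\<mu> m)) + (\<Sum>k<dE. g k * ln (g k))"
    by (rule entropy_product) (use l0 l1 \<mu> g0 g1 in \<open>auto intro: less_imp_le\<close>)
  also have "(\<Sum>i<D. Re (\<eta> $$ (i, i)) * ln (q i)) = (\<Sum>s<2. \<Sum>m<dM. \<Sum>k<dE. t s m k * ln (d s * \<mu> m * g k))"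
    unfolding sumD by (intro sum.cong refl) (simp add: q_def enc t_def)
  also have "\<dots> = (\<Sum>s<2. d s * ln (d s)) + (\<Sum>m<dM. \<mu> m * ln (\<mu> m)) + (\<Sum>k<dE. tE k * ln (g k))"
    by (rule cross_entropy_product) (use d0 \<mu> g0 supp tM in \<open>auto simp: d_def tE_def intro: less_imp_le\<close>)
  finally have "(\<Sum>s<2. d s * ln (d s)) + (\<Sum>k<dE. tE k * ln (g k)) \<le> (\<Sum>s<2. l s * ln (l s)) + (\<Sum>k<dE. g k * ln (g k))"
    by simp
  moreover have "(\<Sum>k<dE. tE k * ln (g k)) - (\<Sum>k<dE. g k * ln (g k)) = - (\<beta> * Q)"
  proof -
    have lng: "ln (g k) = - (\<beta> * \<epsilon> k) - ln Z" for k using Z0 by (simp add: g_def ln_div)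
    have "(\<Sum>k<dE. tE k * ln (g k)) - (\<Sum>k<dE. g k * ln (g k)) =
      (\<Sum>k<dE. - \<beta> * (\<epsilon> k * (tE k - g k))) - (\<Sum>k<dE. tE k * ln Z) + (\<Sum>k<dE. g k * ln Z)"
      unfolding lng sum_subtractf[symmetric] sum.distrib[symmetric]
      by (intro sum.cong refl) (simp add: algebra_simps)
    also have "\<dots> = - \<beta> * (\<Sum>k<dE. \<epsilon> k * (tE k - g k))"
      unfolding sum_distrib_right[symmetric] sum_distrib_left[symmetric] tE1 g1 by simp
    also have "(\<Sum>k<dE. \<epsilon> k * (tE k - g k)) = Q"
    proof -
      have dim: "dim_row (ptrace_first (2 * dM) dE \<eta>) = dE" "dim_col (ptrace_first (2 * dM) dE \<eta>) = dE"
        by (rule carrier_matD[OF ptrace_carrier(1)])+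
      have "Q = (\<Sum>k<dE. Re (complex_of_real (\<epsilon> k) * (ptrace_first (2 * dM) dE \<eta> $$ (k, k) - complex_of_real (g k))))"
        unfolding Qe HE_def \<gamma>_def mtrace_def using dim
        by (simp add: diagm_mult_index del: index_mult_mat(1))
      also have "\<dots> = (\<Sum>k<dE. \<epsilon> k * (tE k - g k))"
        by (intro sum.cong refl) (simp add: tE)
      finally show ?thesis by simp
    qed
    finally show ?thesis by simp
  qed
  moreover have "(\<Sum>s<2. l s * ln (l s)) = - binary_entropy ((1 + R) / 2)"
  proof -
    have half: "1 - (1 + R) / 2 = (1 - R) / 2" by (simp add: field_simps)
    show ?thesis unfolding binary_entropy_def half by (simp add: sum_lessThan_2 l_def)
  qed
  moreover have "(\<Sum>s<2. d s * ln (d s)) = - binary_entropy ((1 + (d 0 - d 1)) / 2)"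
  proof -
    have "d 0 + d 1 = 1" using d1 by (simp add: sum_lessThan_2)
    hence half: "(1 + (d 0 - d 1)) / 2 = d 0" "1 - d 0 = d 1" by (auto simp: field_simps)
    show ?thesis unfolding half(1) binary_entropy_def half(2) by (simp add: sum_lessThan_2)
  qed
  ultimately have "binary_entropy ((1 + R) / 2) \<le> binary_entropy ((1 + (d 0 - d 1)) / 2) + \<beta> * Q" by linarith
  moreover have "d 0 + d 1 = 1" "d 0 \<ge> 0" "d 1 \<ge> 0" using d1 d0 by (auto simp: sum_lessThan_2)
  ultimately show ?thesis using Qd by (intro exI[of _ "d 0 - d 1"]) auto
qed

theorem heats_second_law:
  fixes \<beta> R \<phi> Q :: real
  assumes R: "0 \<le> R" "R \<le> 1" and Q: "Q \<in> heats \<beta> pauliZ (qubit_matrix (qubit_kernel (R * cos \<phi>) (R * sin \<phi>)))"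
  shows "\<exists>e. -1 \<le> e \<and> e \<le> 1 \<and> Q = R * cos \<phi> - e \<and> binary_entropy ((1 + R) / 2) \<le> binary_entropy ((1 + e) / 2) + \<beta> * Q"
proof (rule protocol_diagonalize[OF Q])
  show "pauliZ \<in> carrier_mat 2 2" by (simp add: pauliZ_diagm)
  show "qubit_matrix (qubit_kernel (R * cos \<phi>) (R * sin \<phi>)) \<in> carrier_mat 2 2" by (simp add: qubit_matrix_def)
qed (rule diagonal_protocol_second_law[OF R])

subsection \<open>Canonical form of a qubit\<close>

text \<open>Trivial memory and bath with the identity evolution. It makes heat sets nonempty, as the
  bounds through \<open>Inf\<close> and \<open>Sup\<close> require.\<close>

lemma zero_mem_heats: "0 \<in> heats \<beta> pauliZ (qubit_matrix (qubit_kernel E c))"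
proof -
  define J where "J = (UNIV :: bool set) \<times> {()} \<times> {()}"
  define u where "u z z' = complex_of_real (of_bool (z = z'))" for z z' :: "bool \<times> unit \<times> unit"
  define fin where "fin = final_kernel J u (\<lambda>(s, m, b) (s', m', b'). qubit_kernel E c s s' * 1 * (if b = b' then of_real 1 else 0))"
  have u: "u = (\<lambda>z z'. of_bool (z = z'))" by (simp add: u_def fun_eq_iff of_bool_def)
  have fJ: "finite J" by (simp add: J_def)
  have fin_eq: "fin (s, (), ()) (s', (), ()) = qubit_kernel E c s s'" for s s'
  proof -
    have z: "(s, (), ()) \<in> J" "(s', (), ()) \<in> J" for s by (auto simp: J_def)
    have "fin (s, (), ()) (s', (), ()) = (\<Sum>z1\<in>J. of_bool ((s, (), ()) = z1) *
       (\<Sum>z2\<in>J. of_bool ((s', (), ()) = z2) * (case z1 of (s, m, b) \<Rightarrow> case z2 of (s', m', b') \<Rightarrow> qubit_kernel E c s s')))"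
      unfolding fin_def final_kernel_def u sum_distrib_left by (intro sum.cong refl) (auto simp: mult_ac)
    then show ?thesis by (simp only: sum_of_bool_mult_left fJ z) simp
  qed
  have "(\<Sum>b\<in>{()}. 0 * (Re (\<Sum>s\<in>UNIV. \<Sum>m\<in>{()}. fin (s, m, b) (s, m, b)) - 1)) \<in> heats \<beta> pauliZ (qubit_matrix (qubit_kernel E c))"
  proof (rule heats_intro[where \<rho>M = "\<lambda>_ _. 1" and hM = "\<lambda>_. 0" and hB = "\<lambda>_. 0" and u = u and \<gamma> = "\<lambda>_. 1"
        and \<rho> = "qubit_kernel E c" and M = "{()}" and B = "{()}" and fin = fin])
    show "unitary_on (UNIV \<times> {()} \<times> {()}) u" unfolding u by (rule unitary_on_id) simp
    show "fin = final_kernel (UNIV \<times> {()} \<times> {()}) u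
      (\<lambda>(s, m, b) (s', m', b'). qubit_kernel E c s s' * 1 * (if b = b' then complex_of_real 1 else 0))"
      by (simp add: fin_def J_def)
    show "0 \<le> Re (\<Sum>m\<in>{()}. \<Sum>m'\<in>{()}. cnj (v m) * 1 * v m')" for v
    proof -
      have "cnj (v ()) * v () = of_real ((cmod (v ()))\<^sup>2)" by (rule of_real_cmod_power2[symmetric])
      then show ?thesis by (simp del: of_real_power)
    qed
    show "u (s, m, b) (s', m', b') = 0"
      if "(if s then 1 else - 1) + (0 :: real) + 0 \<noteq> (if s' then 1 else - 1) + 0 + 0" for s m b s' m' b'
      using that by (cases s; cases s') (auto simp: u_def)
    show "(\<Sum>s\<in>UNIV. \<Sum>b\<in>{()}. fin (s, m, b) (s, m', b)) = 1" for m m'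
      using qubit_kernel_trace[of E c] by (simp add: fin_eq UNIV_bool add.commute)
  qed simp_all
  then show ?thesis by simp
qed

section \<open>Bloch vectors and the normal form of a Hamiltonian with a state\<close>

lemma sigma_dot_mat:
  "sigma_dot (x, y, z) = mat 2 2 (\<lambda>(i, j). if i = 0 then if j = 0 then of_real z else Complex x (- y)
     else if j = 0 then Complex x y else - of_real z)"
  by (rule eq_matI)
    (auto simp: sigma_dot_def pauliX_def pauliY_def pauliZ_def mat_of_rows_list_def numeral_2_eq_2 less_Suc_eq complex_eq_iff)

lemma mtrace_mult_2:
  assumes "A \<in> carrier_mat 2 2" "B \<in> carrier_mat 2 2"
  shows "mtrace (A * B) = A $$ (0, 0) * B $$ (0, 0) + A $$ (0, 1) * B $$ (1, 0) + A $$ (1, 0) * B $$ (0, 1) + A $$ (1, 1) * B $$ (1, 1)"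
  unfolding mtrace_mult[OF assms] by (simp add: sum_lessThan_2)

lemma eq_mat_2I:
  assumes "A \<in> carrier_mat 2 2" "B \<in> carrier_mat 2 2" "A $$ (0, 0) = B $$ (0, 0)" "A $$ (0, 1) = B $$ (0, 1)"
    "A $$ (1, 0) = B $$ (1, 0)" "A $$ (1, 1) = B $$ (1, 1)"
  shows "A = B"
  by (rule eq_matI) (use assms in \<open>auto simp: numeral_2_eq_2 less_Suc_eq\<close>)

lemma qstate_carrier: "qstate r \<in> carrier_mat 2 2"
  by (cases r) (auto simp: qstate_def sigma_dot_mat)

lemma sigma_dot_carrier: "sigma_dot r \<in> carrier_mat 2 2"
  by (cases r) (auto simp: sigma_dot_mat)

lemma sigma_dot_hermitian: "hermitian 2 (sigma_dot r)"
  unfolding hermitian_def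
proof (intro conjI sigma_dot_carrier)
  obtain x y z where r: "r = (x, y, z)" by (cases r) auto
  show "mat_adjoint (sigma_dot r) = sigma_dot r"
    by (rule eq_mat_2I) (auto simp: r sigma_dot_mat complex_eq_iff)
qed

lemma qstate_hermitian: "mat_adjoint (qstate r) = qstate r"
proof -
  obtain x y z where r: "r = (x, y, z)" by (cases r) auto
  show ?thesis
    by (rule eq_mat_2I) (auto simp: r sigma_dot_mat qstate_def complex_eq_iff)
qed

lemma sigma_dot_traces:
  "mtrace (sigma_dot h) = 0" "mtrace (sigma_dot h * sigma_dot h) = of_real (2 * dot3 h h)"
  "mtrace (qstate r) = 1" "mtrace (sigma_dot h * qstate r) = of_real (dot3 h r)"
  "mtrace (qstate r * qstate r) = of_real ((1 + dot3 r r) / 2)"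
proof -
  obtain x y z where r: "r = (x, y, z)" by (cases r) auto
  obtain a b c where h: "h = (a, b, c)" by (cases h) auto
  show "mtrace (sigma_dot h) = 0" by (simp add: h sigma_dot_mat mtrace_def sum_lessThan_2)
  show "mtrace (sigma_dot h * sigma_dot h) = of_real (2 * dot3 h h)"
    unfolding mtrace_mult_2[OF sigma_dot_carrier sigma_dot_carrier]
    by (simp add: h sigma_dot_mat dot3_def complex_eq_iff)
  show "mtrace (qstate r) = 1" by (simp add: r qstate_def sigma_dot_mat mtrace_def sum_lessThan_2 field_simps)
  show "mtrace (sigma_dot h * qstate r) = of_real (dot3 h r)"
    unfolding mtrace_mult_2[OF sigma_dot_carrier qstate_carrier]
    by (simp add: h r sigma_dot_mat qstate_def dot3_def complex_eq_iff field_simps)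
  show "mtrace (qstate r * qstate r) = of_real ((1 + dot3 r r) / 2)"
    unfolding mtrace_mult_2[OF qstate_carrier qstate_carrier]
    by (simp add: r sigma_dot_mat qstate_def dot3_def complex_eq_iff field_simps)
qed

lemma norm2_power2: "(norm2 r)\<^sup>2 = dot3 r r"
proof -
  have "dot3 r r \<ge> 0" by (cases r) (auto simp: dot3_def)
  then show ?thesis by (simp add: norm2_def)
qed

text \<open>The trace 0 and the trace 2 of the square pin the eigenvalues to 1 and -1; a swap
  corrects their order if necessary.\<close>

lemma sigma_dot_diagonalize:
  assumes "norm2 h = 1"
  obtains V where "unitary 2 V" "uconj V (sigma_dot h) = pauliZ"
proof -
  obtain P d where P: "unitary 2 P" and hP: "sigma_dot h = uconj P (diagm 2 (\<lambda>i. complex_of_real (d i)))"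
    using spectral_theorem[OF sigma_dot_hermitian] by blast
  have "mtrace (sigma_dot h) = of_real (d 0 + d 1)"
    unfolding hP mtrace_uconj[OF P diagm_carrier] mtrace_diagm by (simp add: sum_lessThan_2)
  hence "d 0 + d 1 = 0" unfolding sigma_dot_traces by (metis of_real_eq_0_iff)
  moreover have "mtrace (sigma_dot h * sigma_dot h) = of_real (d 0 * d 0 + d 1 * d 1)"
    unfolding hP uconj_mult[OF P diagm_carrier diagm_carrier] diagm_mult mtrace_uconj[OF P diagm_carrier] mtrace_diagm
    by (simp add: sum_lessThan_2)
  hence "d 0 * d 0 + d 1 * d 1 = 2"
    unfolding sigma_dot_traces of_real_eq_iff using assms norm2_power2[of h] by simp
  ultimately have "d 1 = - d 0" "d 0 * d 0 = 1" by (auto simp: add_eq_0_iff)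
  hence "d 0 = 1 \<and> d 1 = - 1 \<or> d 0 = - 1 \<and> d 1 = 1"
    using square_eq_1_iff[of "d 0"] by auto
  then show thesis
  proof
    assume d: "d 0 = 1 \<and> d 1 = - 1"
    have Z: "diagm 2 (\<lambda>i. complex_of_real (d i)) = pauliZ"
      unfolding pauliZ_diagm by (rule eq_mat_2I) (use d in auto)
    show thesis
      by (rule that[OF unitary_adjoint[OF P]]) (use hP Z uconj_inverse(2)[OF P] in \<open>simp add: pauliZ_diagm\<close>)
  next
    assume d: "d 0 = - 1 \<and> d 1 = 1"
    define S where "S = mat 2 2 (\<lambda>(i, j). complex_of_real (of_bool (i \<noteq> j)))"
    have S: "S \<in> carrier_mat 2 2" by (simp add: S_def)
    have S2: "S $$ (0, 0) = 0" "S $$ (0, 1) = 1" "S $$ (1, 0) = 1" "S $$ (1, 1) = 0"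
      by (simp_all add: S_def)
    have SS: "unitary 2 S"
      unfolding unitary_def
    proof (intro conjI S)
      show "S * mat_adjoint S = 1\<^sub>m 2"
        by (rule eq_mat_2I) (use S in \<open>auto simp: index_mult_mat_sum sum_lessThan_2 S_def simp del: index_mult_mat(1)\<close>)
      show "mat_adjoint S * S = 1\<^sub>m 2"
        by (rule eq_mat_2I) (use S in \<open>auto simp: index_mult_mat_sum sum_lessThan_2 S_def simp del: index_mult_mat(1)\<close>)
    qed
    have Z: "uconj S (diagm 2 (\<lambda>i. complex_of_real (d i))) = pauliZ"
    proof (rule eq_mat_2I)
      show "uconj S (diagm 2 (\<lambda>i. complex_of_real (d i))) \<in> carrier_mat 2 2" using S by simp
    qed (use d S2 in \<open>simp_all add: uconj_diagm_index[OF S] sum_lessThan_2 pauliZ_diagm\<close>)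
    have "uconj (S * mat_adjoint P) (sigma_dot h) = uconj S (uconj (mat_adjoint P) (sigma_dot h))"
      by (rule uconj_uconj[symmetric, where n = 2]) (use S unitaryD[OF P] sigma_dot_carrier in auto)
    also have "\<dots> = pauliZ" unfolding hP uconj_inverse(2)[OF P diagm_carrier] by (rule Z)
    finally show thesis by (rule that[OF unitary_mult[OF SS unitary_adjoint[OF P]]])
  qed
qed

text \<open>Diagonalising the Hamiltonian fixes the populations through trace and energy, the purity
  fixes the modulus of the coherence, and a diagonal phase, which commutes with
  \<open>pauliZ\<close>, makes it real. Heat sets therefore depend only on energy and
  length.\<close>

lemma heats_canonical:
  assumes h: "norm2 h = 1"
  shows "dot3 h r ^ 2 \<le> (norm2 r)\<^sup>2" "heats \<beta> (sigma_dot h) (qstate r) =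
     heats \<beta> pauliZ (qubit_matrix (qubit_kernel (dot3 h r) (sqrt ((norm2 r)\<^sup>2 - (dot3 h r)\<^sup>2))))"
proof -
  define E where "E = dot3 h r"
  define R where "R = norm2 r"
  obtain V where V: "unitary 2 V" and hV: "uconj V (sigma_dot h) = pauliZ"
    using sigma_dot_diagonalize[OF h] by blast
  define \<rho> where "\<rho> = uconj V (qstate r)"
  have \<rho>: "\<rho> \<in> carrier_mat 2 2" unfolding \<rho>_def using unitaryD(1)[OF V] qstate_carrier by simp
  have Zc: "pauliZ \<in> carrier_mat 2 2" by (simp add: pauliZ_diagm)
  have ad: "mat_adjoint \<rho> = \<rho>"
    unfolding \<rho>_def uconj_adjoint[OF unitaryD(1)[OF V] qstate_carrier] qstate_hermitian ..
  have c01: "\<rho> $$ (1, 0) = cnj (\<rho> $$ (0, 1))"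
    using mat_adjoint_index[of 1 \<rho> 0] \<rho> by (simp add: ad)
  have t1: "\<rho> $$ (0, 0) + \<rho> $$ (1, 1) = 1"
  proof -
    have "mtrace \<rho> = 1" unfolding \<rho>_def mtrace_uconj[OF V qstate_carrier] by (rule sigma_dot_traces)
    then show ?thesis using \<rho> by (simp add: mtrace_def sum_lessThan_2)
  qed
  have t2: "\<rho> $$ (0, 0) - \<rho> $$ (1, 1) = of_real E"
  proof -
    have "mtrace (pauliZ * \<rho>) = of_real E"
      unfolding \<rho>_def hV[symmetric] uconj_mult[OF V sigma_dot_carrier qstate_carrier]
        mtrace_uconj[OF V square_mult_carrier[OF sigma_dot_carrier qstate_carrier]] E_def by (rule sigma_dot_traces)
    then show ?thesis unfolding mtrace_mult_2[OF Zc \<rho>] by (simp add: pauliZ_diagm)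
  qed
  have e0: "\<rho> $$ (0, 0) = of_real ((1 + E) / 2)"
  proof -
    have "\<rho> $$ (0, 0) * 2 = (\<rho> $$ (0, 0) + \<rho> $$ (1, 1)) + (\<rho> $$ (0, 0) - \<rho> $$ (1, 1))" by simp
    also have "\<dots> = 1 + of_real E" unfolding t1 t2 ..
    finally show ?thesis by simp
  qed
  have e1: "\<rho> $$ (1, 1) = of_real ((1 - E) / 2)"
  proof -
    have "\<rho> $$ (1, 1) = 1 - \<rho> $$ (0, 0)" unfolding t1[symmetric] by simp
    then show ?thesis unfolding e0 by (simp add: field_simps)
  qed
  define b where "b = \<rho> $$ (0, 1)"
  have bb: "(cmod b)\<^sup>2 = (R\<^sup>2 - E\<^sup>2) / 4"
  proof -
    have "mtrace (\<rho> * \<rho>) = of_real ((1 + R\<^sup>2) / 2)"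
      unfolding \<rho>_def uconj_mult[OF V qstate_carrier qstate_carrier]
        mtrace_uconj[OF V square_mult_carrier[OF qstate_carrier qstate_carrier]] R_def norm2_power2 by (rule sigma_dot_traces)
    moreover have "mtrace (\<rho> * \<rho>) = of_real (((1 + E) / 2) * ((1 + E) / 2) + 2 * (cmod b)\<^sup>2 + ((1 - E) / 2) * ((1 - E) / 2))"
      unfolding mtrace_mult_2[OF \<rho> \<rho>] e0 e1 c01 b_def[symmetric] of_real_add of_real_mult of_real_cmod_power2
      by (simp add: mult.commute)
    ultimately have "(1 + R\<^sup>2) / 2 = ((1 + E) / 2) * ((1 + E) / 2) + 2 * (cmod b)\<^sup>2 + ((1 - E) / 2) * ((1 - E) / 2)"
      by (simp only: of_real_eq_iff)
    then show ?thesis by (simp add: field_simps power2_eq_square)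
  qed
  have le: "E\<^sup>2 \<le> R\<^sup>2" using zero_le_power2[of "cmod b"] unfolding bb by simp
  then show "dot3 h r ^ 2 \<le> (norm2 r)\<^sup>2" by (simp add: E_def R_def)
  have cb: "sqrt (R\<^sup>2 - E\<^sup>2) = 2 * cmod b"
  proof -
    have eq: "R\<^sup>2 - E\<^sup>2 = (2 * cmod b)\<^sup>2" using bb by (simp add: power_mult_distrib)
    show ?thesis unfolding eq real_sqrt_abs by simp
  qed
  \<comment> \<open>The phase of the coherence; 1 stands in when there is none, so that
    \<open>w\<close> always has modulus one.\<close>
  define w where "w = (if b = 0 then 1 else sgn b)"
  have w: "w * cnj w = 1" "cnj w * w = 1"
    by (auto simp: w_def complex_norm_square[symmetric] mult.commute[of "cnj _"] norm_sgn)
  have bw: "b * cnj w = of_real (cmod b)"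
  proof (cases "b = 0")
    case False
    then show ?thesis
      by (simp add: w_def sgn_div_norm scaleR_conv_of_real complex_norm_square[symmetric] power2_eq_square field_simps)
  qed simp
  define W where "W = diagm 2 (\<lambda>i. if i = 0 then 1 else w)"
  have W: "W \<in> carrier_mat 2 2" by (simp add: W_def)
  have WU: "unitary 2 W"
    unfolding unitary_def
  proof (intro conjI W)
    show "W * mat_adjoint W = 1\<^sub>m 2"
      by (rule eq_mat_2I) (use W w in \<open>auto simp: index_mult_mat_sum sum_lessThan_2 W_def simp del: index_mult_mat(1)\<close>)
    show "mat_adjoint W * W = 1\<^sub>m 2"
      by (rule eq_mat_2I) (use W w in \<open>auto simp: index_mult_mat_sum sum_lessThan_2 W_def simp del: index_mult_mat(1)\<close>)
  qed
  have W2: "W $$ (0, 0) = 1" "W $$ (0, 1) = 0" "W $$ (1, 0) = 0" "W $$ (1, 1) = w"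
    by (simp_all add: W_def)
  have Z2: "pauliZ $$ (0, 0) = 1" "pauliZ $$ (0, 1) = 0" "pauliZ $$ (1, 0) = 0" "pauliZ $$ (1, 1) = - 1"
    by (simp_all add: pauliZ_diagm)
  note W2 = W2 W2[unfolded One_nat_def] and Z2 = Z2 Z2[unfolded One_nat_def]
  have WZ: "uconj W pauliZ = pauliZ"
  proof (rule eq_mat_2I)
    show "uconj W pauliZ \<in> carrier_mat 2 2" using W Zc by simp
  qed (use w in \<open>simp_all add: uconj_index[OF W Zc] sum_lessThan_2 W2 Z2 Zc\<close>)
  have W\<rho>: "uconj W \<rho> = qubit_matrix (qubit_kernel E (sqrt (R\<^sup>2 - E\<^sup>2)))"
  proof (rule eq_mat_2I)
    show "uconj W \<rho> \<in> carrier_mat 2 2" using W \<rho> by simp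
    show "uconj W \<rho> $$ (0, 1) = qubit_matrix (qubit_kernel E (sqrt (R\<^sup>2 - E\<^sup>2))) $$ (0, 1)"
      using bw by (simp add: uconj_index[OF W \<rho>] sum_lessThan_2 W2 qubit_matrix_def qubit_kernel_def cb b_def)
    show "uconj W \<rho> $$ (1, 0) = qubit_matrix (qubit_kernel E (sqrt (R\<^sup>2 - E\<^sup>2))) $$ (1, 0)"
      using arg_cong[OF bw, of cnj] c01 by (simp add: uconj_index[OF W \<rho>] sum_lessThan_2 W2 qubit_matrix_def qubit_kernel_def cb b_def mult.commute)
    show "uconj W \<rho> $$ (0, 0) = qubit_matrix (qubit_kernel E (sqrt (R\<^sup>2 - E\<^sup>2))) $$ (0, 0)"
      using e0 by (simp add: uconj_index[OF W \<rho>] sum_lessThan_2 W2 qubit_matrix_def qubit_kernel_def)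
    have "uconj W \<rho> $$ (1, 1) = w * \<rho> $$ (1, 1) * cnj w"
      by (simp add: uconj_index[OF W \<rho>] sum_lessThan_2 W2)
    also have "\<dots> = (w * cnj w) * \<rho> $$ (1, 1)" by simp
    finally show "uconj W \<rho> $$ (1, 1) = qubit_matrix (qubit_kernel E (sqrt (R\<^sup>2 - E\<^sup>2))) $$ (1, 1)"
      using e1 w by (simp add: qubit_matrix_def qubit_kernel_def)
  qed (simp add: qubit_matrix_def)
  have "heats \<beta> (sigma_dot h) (qstate r) = heats \<beta> pauliZ \<rho>"
    using heats_uconj[OF sigma_dot_carrier qstate_carrier V, of \<beta> h r] unfolding hV \<rho>_def by simp
  also have "\<dots> = heats \<beta> pauliZ (uconj W \<rho>)"
    using heats_uconj[OF Zc \<rho> WU, of \<beta>] unfolding WZ by simp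
  finally show "heats \<beta> (sigma_dot h) (qstate r) =
     heats \<beta> pauliZ (qubit_matrix (qubit_kernel (dot3 h r) (sqrt ((norm2 r)\<^sup>2 - (dot3 h r)\<^sup>2))))"
    unfolding W\<rho> E_def R_def .
qed

lemma polar_coordinates:
  fixes E R :: real
  assumes "R \<ge> 0" "E\<^sup>2 \<le> R\<^sup>2"
  obtains \<phi> where "E = R * cos \<phi>" "sqrt (R\<^sup>2 - E\<^sup>2) = R * sin \<phi>"
proof (cases "R = 0")
  case True
  then show thesis using assms that[of 0] by simp
next
  case False
  have "(E / R)\<^sup>2 + (sqrt (R\<^sup>2 - E\<^sup>2) / R)\<^sup>2 = 1"
    using assms False by (simp add: power_divide add_divide_distrib[symmetric])
  then obtain \<phi> where "E / R = cos \<phi>" "sqrt (R\<^sup>2 - E\<^sup>2) / R = sin \<phi>"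
    using sincos_total_2pi by metis
  then show thesis using False by (intro that[of \<phi>]) (auto simp: field_simps)
qed

subsection \<open>Free energy and the stabilizer window\<close>

text \<open>The bound \<open>ln y \<le> y - 1\<close> at \<open>y = 1 / sqrt x\<close> squeezes the
  product below \<open>2 * sqrt x\<close>.\<close>

lemma tendsto_x_ln_x: "((\<lambda>x::real. x * ln x) \<longlongrightarrow> 0) (at 0 within {0..1})"
proof (rule tendsto_rabs_zero_cancel, rule real_tendsto_sandwich)
  show "\<forall>\<^sub>F x::real in at 0 within {0..1}. 0 \<le> \<bar>x * ln x\<bar>"
    by (intro always_eventually allI abs_ge_zero)
  show "\<forall>\<^sub>F x::real in at 0 within {0..1}. \<bar>x * ln x\<bar> \<le> 2 * sqrt x"
  proof (unfold eventually_at_topological, intro exI[of _ UNIV] conjI ballI impI)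
    fix x :: real assume "x \<noteq> 0" "x \<in> {0..1}"
    hence x: "0 < x" "x \<le> 1" by auto
    have "- ln x = 2 * ln (1 / sqrt x)" using x by (simp add: ln_div ln_sqrt)
    also have "ln (1 / sqrt x) \<le> 1 / sqrt x - 1" using x by (intro ln_le_minus_one) simp
    finally have "- ln x \<le> 2 / sqrt x" by simp
    hence "x * (- ln x) \<le> x * (2 / sqrt x)" using x by (intro mult_left_mono) auto
    also have "x * (2 / sqrt x) = 2 * sqrt x" using x by (simp add: field_simps)
    finally show "\<bar>x * ln x\<bar> \<le> 2 * sqrt x" using x by (simp add: abs_mult)
  qed simp_all
  show "((\<lambda>x::real. 2 * sqrt x) \<longlongrightarrow> 0) (at 0 within {0..1})"
    by (rule tendsto_eq_rhs[OF tendsto_mult[OF tendsto_const tendsto_real_sqrt[OF tendsto_ident_at]]]) simp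
qed simp

lemma continuous_on_x_ln_x: "continuous_on {0..1::real} (\<lambda>x. x * ln x)"
proof (rule continuous_on_eq_continuous_within[THEN iffD2], rule ballI)
  fix x :: real assume "x \<in> {0..1}"
  then consider "x = 0" | "x > 0" by fastforce
  then show "continuous (at x within {0..1}) (\<lambda>x. x * ln x)"
  proof cases
    case 1
    then show ?thesis using tendsto_x_ln_x by (simp add: continuous_within)
  next
    case 2
    then show ?thesis by (intro continuous_intros) auto
  qed
qed

lemma continuous_on_binary_entropy: "continuous_on {0..1} binary_entropy"
proof -
  have "continuous_on {0..1::real} (\<lambda>p. (1 - p) * ln (1 - p))"
    by (rule continuous_on_compose2[OF continuous_on_x_ln_x]) (auto intro!: continuous_intros)
  then have "continuous_on {0..1} (\<lambda>p::real. - (p * ln p + (1 - p) * ln (1 - p)))"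
    by (intro continuous_on_minus continuous_on_add continuous_on_x_ln_x)
  then show ?thesis by (simp add: binary_entropy_def[abs_def])
qed

text \<open>The derivative \<open>ln (1 - x) - ln x\<close> is negative right of 1/2. It diverges at
  1, so it is taken on the open interval only, with continuity at the ends.\<close>

lemma binary_entropy_strict_decreasing:
  assumes "1 / 2 \<le> a" "a < b" "b \<le> 1"
  shows "binary_entropy b < binary_entropy a"
proof (rule DERIV_neg_imp_decreasing_open[OF assms(2)])
  fix x assume x: "a < x" "x < b"
  have "(binary_entropy has_real_derivative - (ln x + 1 - (ln (1 - x) + 1))) (at x)"
  proof -
    have d1: "((\<lambda>p. p * ln p) has_real_derivative ln x + 1) (at x)"
      using x assms by (auto intro!: derivative_eq_intros)
    have d2: "((\<lambda>p. (1 - p) * ln (1 - p)) has_real_derivative - (ln (1 - x) + 1)) (at x)"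
      using x assms by (auto intro!: derivative_eq_intros)
    show ?thesis
      unfolding binary_entropy_def[abs_def] by (rule DERIV_cong[OF DERIV_minus[OF DERIV_add[OF d1 d2]]]) simp
  qed
  moreover have "- (ln x + 1 - (ln (1 - x) + 1)) < 0" using x assms by simp
  ultimately show "\<exists>y. DERIV binary_entropy x :> y \<and> y < 0" by blast
next
  show "continuous_on {a..b} binary_entropy"
    by (rule continuous_on_subset[OF continuous_on_binary_entropy]) (use assms in auto)
qed

lemma binary_entropy_nonneg:
  assumes "0 \<le> p" "p \<le> 1" shows "binary_entropy p \<ge> 0"
proof -
  have "p * ln p \<le> 0" if "0 \<le> p" "p \<le> 1" for p :: real
    using that by (cases "p = 0") (auto intro: mult_nonneg_nonpos)
  from this[of p] this[of "1 - p"] show ?thesis using assms by (simp add: binary_entropy_def)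
qed

text \<open>The negative free energy (in units of the temperature) of the diagonal state of energy \<open>e\<close>.\<close>

definition \<psi> :: "real \<Rightarrow> real \<Rightarrow> real" where
  "\<psi> \<beta> e = binary_entropy ((1 + e) / 2) - \<beta> * e"

lemma continuous_on_\<psi>: "continuous_on {-1..1} (\<psi> \<beta>)"
  unfolding \<psi>_def[abs_def]
  by (intro continuous_intros continuous_on_compose2[OF continuous_on_binary_entropy]) auto

lemma \<psi>_neighbourhood:
  assumes "e \<in> {-1..1}" "y < \<psi> \<beta> e"
  obtains d where "d > 0" "\<And>x. x \<in> {-1..1} \<Longrightarrow> \<bar>x - e\<bar> < d \<Longrightarrow> y < \<psi> \<beta> x"
proof -
  have "(\<psi> \<beta> \<longlongrightarrow> \<psi> \<beta> e) (at e within {-1..1})"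
    using continuous_on_\<psi>[of \<beta>] assms(1) by (auto simp: continuous_on_def)
  from order_tendstoD(1)[OF this assms(2)] obtain d where d: "d > 0"
    "\<And>x. x \<in> {-1..1} \<Longrightarrow> x \<noteq> e \<Longrightarrow> dist x e < d \<Longrightarrow> y < \<psi> \<beta> x"
    unfolding eventually_at by blast
  show thesis
  proof (rule that[OF d(1)])
    fix x assume "x \<in> {-1..1}" "\<bar>x - e\<bar> < d"
    then show "y < \<psi> \<beta> x" using d(2)[of x] assms(2) by (cases "x = e") (auto simp: dist_real_def)
  qed
qed

text \<open>Achievability needs an interior energy, whereas the second law may return an endpoint.
  Shrinking \<open>e\<close> towards 0 by the factor \<open>1 - m\<close> stays close to it and
  enters the open interval.\<close>

lemma \<psi>_approximate:
  assumes e: "e \<in> {-1..1}" and y: "y < \<psi> \<beta> e" and \<delta>: "\<delta> > 0"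
  obtains x where "-1 < x" "x < 1" "\<bar>x - e\<bar> \<le> \<delta>" "y < \<psi> \<beta> x"
proof -
  obtain d where d: "d > 0" "\<And>x. x \<in> {-1..1} \<Longrightarrow> \<bar>x - e\<bar> < d \<Longrightarrow> y < \<psi> \<beta> x"
    using \<psi>_neighbourhood[OF e y] by blast
  define m where "m = min (1 / 2) (min \<delta> (d / 2))"
  have m: "0 < m" "m \<le> 1 / 2" "m \<le> \<delta>" "m < d" using d(1) \<delta> by (auto simp: m_def)
  define x where "x = e * (1 - m)"
  have ex: "x - e = - (m * e)" by (simp add: x_def algebra_simps)
  have ae: "\<bar>e\<bar> \<le> 1" using e by auto
  have "\<bar>m * e\<bar> \<le> m * 1" unfolding abs_mult using m ae by (intro mult_mono) auto
  hence xe: "\<bar>x - e\<bar> \<le> m" unfolding ex by simp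
  have "\<bar>x\<bar> \<le> 1 * (1 - m)" unfolding x_def abs_mult using m ae by (intro mult_mono) auto
  hence x1: "\<bar>x\<bar> < 1" using m by simp
  show thesis
  proof (rule that)
    show "-1 < x" "x < 1" using x1 by auto
    show "\<bar>x - e\<bar> \<le> \<delta>" using xe m by simp
    have "x \<in> {-1..1}" using x1 by auto
    then show "y < \<psi> \<beta> x" by (rule d(2)) (use xe m in linarith)
  qed
qed

section \<open>The slice of the stabilizer octahedron at fixed energy\<close>

lemma compact_stab1: "compact (stab1 h E)"
proof -
  obtain a b c where h: "h = (a, b, c)" by (cases h) auto
  have eq: "stab1 h E = ({-1..1} \<times> ({-1..1} \<times> {-1..1})) \<inter>
     ({s. \<bar>fst s\<bar> + \<bar>fst (snd s)\<bar> + \<bar>snd (snd s)\<bar> \<le> 1} \<inter> {s. a * fst s + b * fst (snd s) + c * snd (snd s) = E})"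
    by (auto simp: stab1_def norm1_def dot3_def h)
  show ?thesis
    unfolding eq
    by (intro compact_Int_closed compact_Times compact_Icc closed_Int closed_Collect_le closed_Collect_eq continuous_intros)
qed

lemma norm2_le_norm1: "norm2 s \<le> norm1 s"
proof -
  obtain x y z where s: "s = (x, y, z)" by (cases s) auto
  have "0 \<le> \<bar>x\<bar> * \<bar>y\<bar>" "0 \<le> \<bar>x\<bar> * \<bar>z\<bar>" "0 \<le> \<bar>y\<bar> * \<bar>z\<bar>" by auto
  hence "x * x + y * y + z * z \<le> (\<bar>x\<bar> + \<bar>y\<bar> + \<bar>z\<bar>)\<^sup>2"
    by (simp add: power2_eq_square algebra_simps)
  then show ?thesis unfolding norm2_def by (intro real_le_lsqrt) (auto simp: s dot3_def norm1_def)
qed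

text \<open>The slice is compact and the length continuous, so the supremum defining
  \<open>Rstar\<close> is a maximum with a witness to compare against.\<close>

lemma stab1_maximum:
  assumes "stab1 h E \<noteq> {}"
  obtains s where "s \<in> stab1 h E" "\<And>t. t \<in> stab1 h E \<Longrightarrow> norm2 t \<le> norm2 s" "Rstar h E = norm2 s"
proof -
  have "norm2 = (\<lambda>s. sqrt (fst s * fst s + fst (snd s) * fst (snd s) + snd (snd s) * snd (snd s)))"
    by (auto simp: fun_eq_iff norm2_def dot3_def)
  moreover have "continuous_on (stab1 h E) (\<lambda>s. sqrt (fst s * fst s + fst (snd s) * fst (snd s) + snd (snd s) * snd (snd s)))"
    by (intro continuous_intros)
  ultimately obtain s where s: "s \<in> stab1 h E" "\<forall>t\<in>stab1 h E. norm2 t \<le> norm2 s"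
    using continuous_attains_sup[OF compact_stab1 assms] by metis
  then have "Rstar h E = norm2 s" unfolding Rstar_def by (intro cSup_eq_maximum) auto
  then show thesis using that s by blast
qed

section \<open>Heat bounds as functions of the length at fixed energy\<close>

lemma heats_eq:
  assumes "norm2 h = 1" "dot3 h s = dot3 h t" "norm2 s = norm2 t"
  shows "heats \<beta> (sigma_dot h) (qstate s) = heats \<beta> (sigma_dot h) (qstate t)"
  unfolding heats_canonical(2)[OF assms(1)] assms(2,3) ..

lemma norm2_nonneg: "norm2 s \<ge> 0"
proof -
  have "dot3 s s \<ge> 0" by (cases s) (auto simp: dot3_def)
  then show ?thesis by (simp add: norm2_def)
qed

lemma heats_bloch_second_law:
  assumes h: "norm2 h = 1" and s: "norm2 s \<le> 1" and Q: "Q \<in> heats \<beta> (sigma_dot h) (qstate s)"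
  obtains e where "e \<in> {-1..1}" "Q = dot3 h s - e" "binary_entropy ((1 + norm2 s) / 2) - \<beta> * dot3 h s \<le> \<psi> \<beta> e"
proof -
  obtain \<phi> where \<phi>: "dot3 h s = norm2 s * cos \<phi>" "sqrt ((norm2 s)\<^sup>2 - (dot3 h s)\<^sup>2) = norm2 s * sin \<phi>"
    using polar_coordinates[OF norm2_nonneg heats_canonical(1)[OF h]] by blast
  have "Q \<in> heats \<beta> pauliZ (qubit_matrix (qubit_kernel (norm2 s * cos \<phi>) (norm2 s * sin \<phi>)))"
    using Q unfolding heats_canonical(2)[OF h] \<phi>(2) unfolding \<phi>(1) .
  from heats_second_law[OF norm2_nonneg s this] obtain e where
    e: "-1 \<le> e" "e \<le> 1" "Q = norm2 s * cos \<phi> - e" "binary_entropy ((1 + norm2 s) / 2) \<le> binary_entropy ((1 + e) / 2) + \<beta> * Q" by blast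
  have Qe: "Q = dot3 h s - e" using e(3) \<phi>(1) by simp
  have "\<beta> * Q = \<beta> * dot3 h s - \<beta> * e" by (simp add: Qe right_diff_distrib)
  with e(4) have "binary_entropy ((1 + norm2 s) / 2) - \<beta> * dot3 h s \<le> \<psi> \<beta> e" unfolding \<psi>_def by linarith
  with e(1,2) Qe show thesis by (intro that) auto
qed

lemma heats_bloch_achievable:
  assumes b: "\<beta> > 0" and h: "norm2 h = 1" and s: "norm2 s \<le> 1" and e: "-1 < e" "e < 1"
    and gap: "binary_entropy ((1 + norm2 s) / 2) - \<beta> * dot3 h s < \<psi> \<beta> e" and eps: "\<epsilon> > 0"
  obtains Q where "Q \<in> heats \<beta> (sigma_dot h) (qstate s)" "\<bar>Q - (dot3 h s - e)\<bar> \<le> \<epsilon>"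
proof -
  obtain \<phi> where \<phi>: "dot3 h s = norm2 s * cos \<phi>" "sqrt ((norm2 s)\<^sup>2 - (dot3 h s)\<^sup>2) = norm2 s * sin \<phi>"
    using polar_coordinates[OF norm2_nonneg heats_canonical(1)[OF h]] by blast
  have "binary_entropy ((1 + norm2 s) / 2) + \<beta> * (e - norm2 s * cos \<phi>) < binary_entropy ((1 + e) / 2)"
    using gap by (simp add: \<psi>_def \<phi>(1) algebra_simps)
  from heats_achievable[OF b norm2_nonneg s e eps this] show thesis
    using that unfolding heats_canonical(2)[OF h] \<phi>(2) unfolding \<phi>(1) by blast
qed

lemma zero_mem_heats_bloch: "norm2 h = 1 \<Longrightarrow> 0 \<in> heats \<beta> (sigma_dot h) (qstate s)"
  unfolding heats_canonical(2) by (rule zero_mem_heats)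

lemma heats_bounded:
  assumes "norm2 h = 1" "norm2 s \<le> 1"
  shows "bdd_below (heats \<beta> (sigma_dot h) (qstate s))" "bdd_above (heats \<beta> (sigma_dot h) (qstate s))"
proof -
  have "dot3 h s - 1 \<le> Q \<and> Q \<le> dot3 h s + 1" if "Q \<in> heats \<beta> (sigma_dot h) (qstate s)" for Q
    by (rule heats_bloch_second_law[OF assms that]) auto
  then show "bdd_below (heats \<beta> (sigma_dot h) (qstate s))" "bdd_above (heats \<beta> (sigma_dot h) (qstate s))"
    unfolding bdd_below_def bdd_above_def by blast+
qed

lemma binary_entropy_bloch_less:
  assumes "norm2 s < norm2 t" "norm2 t \<le> 1"
  shows "binary_entropy ((1 + norm2 t) / 2) < binary_entropy ((1 + norm2 s) / 2)"
  by (rule binary_entropy_strict_decreasing) (use assms norm2_nonneg[of s] in auto)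

text \<open>The final energy behind \<open>Q\<close> lies strictly inside the range allowed to
  \<open>t\<close>, by the drop in entropy. Half of \<open>\<epsilon>\<close> pays for moving that
  energy off the endpoints, half for the error of the protocol.\<close>

lemma heats_approximate:
  assumes b: "\<beta> > 0" and h: "norm2 h = 1" and E: "dot3 h s = dot3 h t" and st: "norm2 s < norm2 t" "norm2 t \<le> 1"
    and Q: "Q \<in> heats \<beta> (sigma_dot h) (qstate s)" and eps: "\<epsilon> > 0"
  obtains Q' where "Q' \<in> heats \<beta> (sigma_dot h) (qstate t)" "\<bar>Q' - Q\<bar> \<le> \<epsilon>"
proof -
  have s1: "norm2 s \<le> 1" using st by simp
  obtain e where e: "e \<in> {-1..1}" "Q = dot3 h s - e" "binary_entropy ((1 + norm2 s) / 2) - \<beta> * dot3 h s \<le> \<psi> \<beta> e"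
    using heats_bloch_second_law[OF h s1 Q] by blast
  have lt: "binary_entropy ((1 + norm2 t) / 2) - \<beta> * dot3 h t < \<psi> \<beta> e"
    using binary_entropy_bloch_less[OF st] e(3) E by simp
  have e2: "\<epsilon> / 2 > 0" using eps by simp
  obtain x where x: "-1 < x" "x < 1" "\<bar>x - e\<bar> \<le> \<epsilon> / 2" "binary_entropy ((1 + norm2 t) / 2) - \<beta> * dot3 h t < \<psi> \<beta> x"
    using \<psi>_approximate[OF e(1) lt e2] by blast
  obtain Q' where Q': "Q' \<in> heats \<beta> (sigma_dot h) (qstate t)" "\<bar>Q' - (dot3 h t - x)\<bar> \<le> \<epsilon> / 2"
    using heats_bloch_achievable[OF b h st(2) x(1,2,4) e2] by blast
  show thesis by (rule that[OF Q'(1)]) (use Q'(2) x(3) e(2) E in linarith)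
qed

text \<open>Any heat of the shorter vector is a limit of heats of the longer one, so it respects the
  bounds of the longer one up to every \<open>\<epsilon>\<close>. At equal lengths there is no
  entropy gap, but the heat sets coincide.\<close>

lemma Qc_Qh_mono:
  assumes b: "\<beta> > 0" and h: "norm2 h = 1" and E: "dot3 h s = dot3 h t" and st: "norm2 s \<le> norm2 t" "norm2 t \<le> 1"
  shows "Qc \<beta> (sigma_dot h) (qstate t) \<le> Qc \<beta> (sigma_dot h) (qstate s)"
    "Qh \<beta> (sigma_dot h) (qstate s) \<le> Qh \<beta> (sigma_dot h) (qstate t)"
proof -
  have s1: "norm2 s \<le> 1" using st by simp
  have ne: "heats \<beta> (sigma_dot h) (qstate s) \<noteq> {}" using zero_mem_heats_bloch[OF h, of \<beta> s] by blast
  have "Qc \<beta> (sigma_dot h) (qstate t) \<le> Q \<and> Q \<le> Qh \<beta> (sigma_dot h) (qstate t)"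
    if Q: "Q \<in> heats \<beta> (sigma_dot h) (qstate s)" for Q
  proof (cases "norm2 s = norm2 t")
    case True
    then show ?thesis using Q heats_eq[OF h E True] heats_bounded[OF h st(2)]
      by (auto simp: Qc_def Qh_def intro: cInf_lower cSup_upper)
  next
    case False
    hence lt: "norm2 s < norm2 t" using st by simp
    have "Qc \<beta> (sigma_dot h) (qstate t) \<le> Q + \<epsilon> \<and> Q \<le> Qh \<beta> (sigma_dot h) (qstate t) + \<epsilon>" if eps: "\<epsilon> > 0" for \<epsilon>
    proof -
      obtain Q' where Q': "Q' \<in> heats \<beta> (sigma_dot h) (qstate t)" "\<bar>Q' - Q\<bar> \<le> \<epsilon>"
        using heats_approximate[OF b h E lt st(2) Q eps] by blast
      have "Qc \<beta> (sigma_dot h) (qstate t) \<le> Q'" "Q' \<le> Qh \<beta> (sigma_dot h) (qstate t)"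
        unfolding Qc_def Qh_def using Q'(1) heats_bounded[OF h st(2)] by (auto intro: cInf_lower cSup_upper)
      then show ?thesis using Q'(2) by linarith
    qed
    note close = this
    show ?thesis
    proof
      show "Qc \<beta> (sigma_dot h) (qstate t) \<le> Q"
        by (rule field_le_epsilon) (rule conjunct1[OF close])
      show "Q \<le> Qh \<beta> (sigma_dot h) (qstate t)"
        by (rule field_le_epsilon) (rule conjunct2[OF close])
    qed
  qed
  then show "Qc \<beta> (sigma_dot h) (qstate t) \<le> Qc \<beta> (sigma_dot h) (qstate s)"
    "Qh \<beta> (sigma_dot h) (qstate s) \<le> Qh \<beta> (sigma_dot h) (qstate t)"
    unfolding Qc_def[of _ _ "qstate s"] Qh_def[of _ _ "qstate s"] using ne
    by (auto intro: cInf_greatest cSup_least)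
qed

text \<open>Let \<open>e\<close> be the largest final energy that the second law allows for
  \<open>s\<close>. There the longer vector still has slack, so it overshoots to
  \<open>e + m\<close> and draws more from the bath than any protocol on \<open>s\<close>.\<close>

lemma Qc_strict_mono:
  assumes b: "\<beta> > 0" and h: "norm2 h = 1" and E: "dot3 h s = dot3 h t" and st: "norm2 s < norm2 t" "norm2 t \<le> 1"
  shows "Qc \<beta> (sigma_dot h) (qstate t) < Qc \<beta> (sigma_dot h) (qstate s)"
proof -
  define y where "y = binary_entropy ((1 + norm2 s) / 2) - \<beta> * dot3 h s"
  define S where "S = \<psi> \<beta> -` {y..} \<inter> {-1..1}"
  have s1: "norm2 s \<le> 1" using st by simp
  have sl: "\<exists>e\<in>S. Q = dot3 h s - e" if Q: "Q \<in> heats \<beta> (sigma_dot h) (qstate s)" for Q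
  proof (rule heats_bloch_second_law[OF h s1 Q])
    fix e assume "e \<in> {-1..1}" "Q = dot3 h s - e" "binary_entropy ((1 + norm2 s) / 2) - \<beta> * dot3 h s \<le> \<psi> \<beta> e"
    then show ?thesis by (intro bexI[of _ e]) (auto simp: S_def y_def)
  qed
  have "closed S" unfolding S_def
    using continuous_on_closed_vimage[OF closed_atLeastAtMost] continuous_on_\<psi> closed_atLeast by blast
  then have compact_S: "compact S"
    using compact_Int_closed[OF compact_Icc[of "-1" "1::real"], of S] by (simp add: S_def Int_commute)
  have "S \<noteq> {}" using sl[OF zero_mem_heats_bloch[OF h]] by blast
  from continuous_attains_sup[OF compact_S this continuous_on_id]
  obtain e where e: "e \<in> S" "\<And>x. x \<in> S \<Longrightarrow> x \<le> e" by blast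
  have lt: "binary_entropy ((1 + norm2 t) / 2) - \<beta> * dot3 h t < \<psi> \<beta> e"
    using e(1) binary_entropy_bloch_less[OF st] by (simp add: S_def y_def E)
  have "dot3 h t \<le> 1"
  proof -
    have "(dot3 h t)\<^sup>2 \<le> (norm2 t)\<^sup>2" by (rule heats_canonical(1)[OF h])
    hence "\<bar>dot3 h t\<bar> \<le> norm2 t" using norm2_nonneg[of t] by (simp add: abs_le_square_iff[symmetric])
    then show ?thesis using st by simp
  qed
  \<comment> \<open>There is room above \<open>e\<close>: at 1 the value of \<open>\<psi>\<close> is
    \<open>- \<beta>\<close>, while the entropy of \<open>t\<close> is nonnegative and its energy at
    most 1, so \<open>lt\<close> would fail.\<close>
  have "e \<noteq> 1"
  proof
    assume e1: "e = 1"
    have "binary_entropy ((1 + norm2 t) / 2) \<ge> 0" by (rule binary_entropy_nonneg) (use norm2_nonneg[of t] st in auto)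
    moreover have "\<beta> * dot3 h t \<le> \<beta> * 1" using \<open>dot3 h t \<le> 1\<close> b by (intro mult_left_mono) auto
    moreover have "\<psi> \<beta> e = - \<beta>" by (simp add: e1 \<psi>_def binary_entropy_def)
    ultimately show False using lt by simp
  qed
  moreover have eI: "e \<in> {-1..1}" using e(1) by (simp add: S_def)
  ultimately have e1: "e < 1" by auto
  obtain d where d: "d > 0" "\<And>x. x \<in> {-1..1} \<Longrightarrow> \<bar>x - e\<bar> < d \<Longrightarrow> binary_entropy ((1 + norm2 t) / 2) - \<beta> * dot3 h t < \<psi> \<beta> x"
    using \<psi>_neighbourhood[OF eI lt] by blast
  \<comment> \<open>Half the smaller margin keeps \<open>e + m\<close> inside both the neighbourhood
    and the open interval; an error of \<open>m / 2\<close> then still leaves the heat below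
    \<open>dot3 h s - e\<close>.\<close>
  define m where "m = min d (1 - e) / 2"
  have m0: "m > 0" and m2: "2 * m \<le> d" "2 * m \<le> 1 - e" using d(1) e1 by (simp_all add: m_def)
  have m: "m > 0" "m < d" "e + m < 1" using m0 m2 d(1) e1 by argo+
  have x: "-1 < e + m" "binary_entropy ((1 + norm2 t) / 2) - \<beta> * dot3 h t < \<psi> \<beta> (e + m)"
    using eI m by (auto intro!: d(2))
  obtain Q where Q: "Q \<in> heats \<beta> (sigma_dot h) (qstate t)" "\<bar>Q - (dot3 h t - (e + m))\<bar> \<le> m / 2"
    using heats_bloch_achievable[OF b h st(2) x(1) m(3) x(2), of "m / 2"] m(1) by auto
  have "Qc \<beta> (sigma_dot h) (qstate t) \<le> Q"
    unfolding Qc_def by (rule cInf_lower[OF Q(1) heats_bounded(1)[OF h st(2)]])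
  also have "Q < dot3 h s - e" using Q(2) m(1) E by linarith
  also have "dot3 h s - e \<le> Qc \<beta> (sigma_dot h) (qstate s)"
    unfolding Qc_def
  proof (rule cInf_greatest)
    show "heats \<beta> (sigma_dot h) (qstate s) \<noteq> {}" using zero_mem_heats_bloch[OF h, of \<beta> s] by blast
    show "dot3 h s - e \<le> Q" if "Q \<in> heats \<beta> (sigma_dot h) (qstate s)" for Q
      using sl[OF that] e(2) by auto
  qed
  finally show ?thesis .
qed

theorem theorem1:
  fixes \<beta> :: real and h r :: bloch
  assumes "\<beta> > 0"
    and "norm2 h = 1"
    and "norm2 r \<le> 1"
    and "stab1 h (dot3 h r) \<noteq> {}"
  shows "witness_detects \<beta> h r \<longleftrightarrow> norm2 r > Rstar h (dot3 h r)"
proof -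
  define E where "E = dot3 h r"
  note b = assms(1) and h = assms(2) and r = assms(3)
  obtain s where s: "s \<in> stab1 h E" "\<And>t. t \<in> stab1 h E \<Longrightarrow> norm2 t \<le> norm2 s" and R: "Rstar h E = norm2 s"
    using stab1_maximum[OF assms(4)] unfolding E_def by blast
  \<comment> \<open>The octahedron lies in the unit ball, so its vectors are states and the heat
    bounds apply to them.\<close>
  have st: "dot3 h t = E" "norm2 t \<le> 1" if "t \<in> stab1 h E" for t
    using that norm2_le_norm1[of t] by (auto simp: stab1_def)
  have mono: "Qc \<beta> (sigma_dot h) (qstate s) \<le> Qc \<beta> (sigma_dot h) (qstate t)"
    "Qh \<beta> (sigma_dot h) (qstate t) \<le> Qh \<beta> (sigma_dot h) (qstate s)" if "t \<in> stab1 h E" for t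
    using Qc_Qh_mono[OF b h _ s(2)[OF that] st(2)[OF s(1)]] st(1)[OF that] st(1)[OF s(1)] by auto
  have qc: "QcSTAB \<beta> h E = Qc \<beta> (sigma_dot h) (qstate s)"
    unfolding QcSTAB_def by (rule cInf_eq_minimum) (use s(1) mono(1) in auto)
  have qh: "QhSTAB \<beta> h E = Qh \<beta> (sigma_dot h) (qstate s)"
    unfolding QhSTAB_def by (rule cSup_eq_maximum) (use s(1) mono(2) in auto)
  have sE: "dot3 h s = dot3 h r" using st(1)[OF s(1)] by (simp add: E_def)
  show ?thesis
  proof (cases "norm2 r > norm2 s")
    case True
    \<comment> \<open>The first disjunct already holds, so detection never has to rely on
      \<open>Qh\<close>.\<close>
    from Qc_strict_mono[OF b h sE True r] show ?thesis
      unfolding witness_detects_def E_def[symmetric] qc R using True by simp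
  next
    case False
    hence "norm2 r \<le> norm2 s" by simp
    \<comment> \<open>The bounds of the maximiser now enclose those of \<open>r\<close>, which rules
      out both disjuncts.\<close>
    from Qc_Qh_mono[OF b h sE[symmetric] this st(2)[OF s(1)]] show ?thesis
      unfolding witness_detects_def E_def[symmetric] qc qh R using False by simp
  qed
qed

end
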